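(* Let $H$ be a finitely generated free abelian group. Then $\eta'_2:\mathcal{A}^t_2(H)\to\mathsf{D}'_2(H)$ is an isomorphism.
   Context: $\mathcal{A}^t_n(H)$ is the quotient of the free abelian group generated by unitrivalent trees with $n$ trivalent vertices (hence $n+2$ univalent vertices), each trivalent vertex equipped with an orientation (a cyclic ordering of its three incident edges) and each univalent vertex labeled by an element of $H$, by the following relations. (i) Anti-symmetry: $T+T'=0$ if $T'$ is identical with $T$ except that one trivalent vertex has the opposite orientation. (ii) IHX: for rooted labeled oriented trees $A,B,C,D$ let $W(A,B,C,D)$ be the tree with two adjacent trivalent vertices $u,v$ joined by an edge $e$, with $A,B$ attached at $u$ in cyclic order $(A,B,e)$ and $C,D$ attached at $v$ in cyclic order $(e,C,D)$; then $W(A,B,C,D)+W(B,C,A,D)+W(C,A,B,D)=0$. (iii) Linearity: $T=T_1+T_2$ if $T_1,T_2,T$ are identical except that one univalent vertex has labels $a_1,a_2,a_1+a_2\in H$ respectively. A quasi-Lie algebra (over $\mathbb{Z}$) is an abelian group with a bilinear bracket satisfying $[\alpha,\beta]+[\beta,\alpha]=0$ and the Jacobi identity $[[\alpha,\beta],\gamma]+[[\beta,\gamma],\alpha]+[[\gamma,\alpha],\beta]=0$ (the relation $[\alpha,\alpha]=0$ is not required). $\mathsf{L}'(H)=\bigoplus_n\mathsf{L}'_n(H)$ is the free quasi-Lie algebra on $H$, graded with $H$ in degree $1$. A unitrivalent tree, each of whose trivalent vertices is equipped with an orientation (a cyclic ordering of its three incident edges), with one univalent vertex unlabeled and designated as the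 root, and with the other $m$ univalent vertices labeled by elements of $H$, determines an element of $\mathsf{L}'_m(H)$ by iterated bracketing: a trivalent vertex with cyclic order (edge towards the root, first branch, second branch) gives the bracket [first, second]. $\mathsf{D}'_n(H)$ is the kernel of $\beta'_n:H\otimes\mathsf{L}'_{n+1}(H)\to\mathsf{L}'_{n+2}(H)$, $h\otimes\lambda\mapsto[h,\lambda]$. The homomorphism $\eta'_n:\mathcal{A}^t_n(H)\to H\otimes\mathsf{L}'_{n+1}(H)$ is $\eta'_n(T)=\sum_i h_i\otimes[T_i]$, the sum over all univalent vertices of $T$, where $h_i$ is the label of the $i$-th one and $[T_i]\in\mathsf{L}'_{n+1}(H)$ is the element determined by the rooted tree $T_i$ obtained from $T$ by making that vertex the (unlabeled) root. It is known that the image of $\eta'_n$ is exactly $\mathsf{D}'_n(H)$, and $\eta'_n$ is also regarded as a map onto $\mathsf{D}'_n(H)$. *)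

theory Defs
  imports "HOL-Algebra.Free_Abelian_Groups"
begin

text \<open>
  All groups are commutative groups in the sense of HOL-Algebra, hence written multiplicatively;
  elements of free abelian groups are finitely supported integer functions
  (\<open>frag_of x\<close> is the generator \<open>x\<close>), for which the group operation is \<open>+\<close>.
\<close>

definition fg_free_abelian_group :: "('h, 'b) monoid_scheme \<Rightarrow> bool" where
  "fg_free_abelian_group H \<longleftrightarrow>
     comm_group H \<and> (\<exists>S :: nat set. finite S \<and> free_Abelian_group S \<cong> H)"

text \<open>The homomorphism from a free abelian group to \<open>G\<close> which is \<open>f\<close> on generators, and the map
  it induces on a quotient; the latter is meaningful if the former is constant on cosets.\<close>

definition free_lift :: "('g, 'm) monoid_scheme \<Rightarrow> ('a \<Rightarrow> 'g) \<Rightarrow> ('a \<Rightarrow>\<^sub>0 int) \<Rightarrow> 'g" where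
  "free_lift G f c =
     finprod G (\<lambda>x. f x [^]\<^bsub>G\<^esub> Poly_Mapping.lookup c x) (Poly_Mapping.keys c)"

definition quot_lift :: "('g, 'm) monoid_scheme \<Rightarrow> ('a \<Rightarrow> 'g) \<Rightarrow> ('a \<Rightarrow>\<^sub>0 int) set \<Rightarrow> 'g" where
  "quot_lift G f X = the_elem (free_lift G f ` X)"


section \<open>Tensor products of abelian groups\<close>

definition tensor_relators ::
    "('a, 'm) monoid_scheme \<Rightarrow> ('b, 'n) monoid_scheme \<Rightarrow> ('a \<times> 'b \<Rightarrow>\<^sub>0 int) set" where
  "tensor_relators G K =
     {frag_of (a \<otimes>\<^bsub>G\<^esub> a', b) - frag_of (a, b) - frag_of (a', b) | a a' b.
        a \<in> carrier G \<and> a' \<in> carrier G \<and> b \<in> carrier K} \<union>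
     {frag_of (a, b \<otimes>\<^bsub>K\<^esub> b') - frag_of (a, b) - frag_of (a, b') | a b b'.
        a \<in> carrier G \<and> b \<in> carrier K \<and> b' \<in> carrier K}"

definition tensor_kernel ::
    "('a, 'm) monoid_scheme \<Rightarrow> ('b, 'n) monoid_scheme \<Rightarrow> ('a \<times> 'b \<Rightarrow>\<^sub>0 int) set" where
  "tensor_kernel G K =
     generate (free_Abelian_group (carrier G \<times> carrier K)) (tensor_relators G K)"

definition tensor ::
    "('a, 'm) monoid_scheme \<Rightarrow> ('b, 'n) monoid_scheme \<Rightarrow> ('a \<times> 'b \<Rightarrow>\<^sub>0 int) set monoid" where
  "tensor G K = free_Abelian_group (carrier G \<times> carrier K) Mod tensor_kernel G K"

definition pure_tensor ::
    "('a, 'm) monoid_scheme \<Rightarrow> ('b, 'n) monoid_scheme \<Rightarrow> 'a \<Rightarrow> 'b \<Rightarrow> ('a \<times> 'b \<Rightarrow>\<^sub>0 int) set" where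
  "pure_tensor G K a b =
     tensor_kernel G K #>\<^bsub>free_Abelian_group (carrier G \<times> carrier K)\<^esub> frag_of (a, b)"


section \<open>The free quasi-Lie algebra\<close>

text \<open>Planar binary trees: at once the nonassociative words in the elements of \<open>H\<close>, and the
  rooted oriented labeled unitrivalent trees, \<open>Node s t\<close> standing for a trivalent vertex with
  cyclic order (edge towards the root, \<open>s\<close>, \<open>t\<close>).\<close>

datatype (labels: 'h) rtree = Leaf 'h | Node "'h rtree" "'h rtree"

primrec num_leaves :: "'h rtree \<Rightarrow> nat" where
  "num_leaves (Leaf h) = 1"
| "num_leaves (Node s t) = num_leaves s + num_leaves t"

definition words :: "('h, 'b) monoid_scheme \<Rightarrow> 'h rtree set" where
  "words H = {t. labels t \<subseteq> carrier H}"

text \<open>The free abelian group on the words, with the bilinear product extending \<open>Node\<close>, is the free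
  nonassociative ring on the set \<open>carrier H\<close>.  The free quasi-Lie algebra on the abelian group
  \<open>H\<close> is its quotient by the two-sided ideal generated by the additivity relations on \<open>H\<close>,
  antisymmetry and the Jacobi identity.\<close>

abbreviation word_ring :: "('h, 'b) monoid_scheme \<Rightarrow> ('h rtree \<Rightarrow>\<^sub>0 int) monoid" where
  "word_ring H \<equiv> free_Abelian_group (words H)"

definition word_bracket :: "('h rtree \<Rightarrow>\<^sub>0 int) \<Rightarrow> ('h rtree \<Rightarrow>\<^sub>0 int) \<Rightarrow> ('h rtree \<Rightarrow>\<^sub>0 int)" where
  "word_bracket x y = frag_extend (\<lambda>s. frag_extend (\<lambda>t. frag_of (Node s t)) y) x"

inductive_set qlie_ideal :: "('h, 'b) monoid_scheme \<Rightarrow> ('h rtree \<Rightarrow>\<^sub>0 int) set"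
  for H :: "('h, 'b) monoid_scheme" where
  additive: "a \<in> carrier H \<Longrightarrow> b \<in> carrier H \<Longrightarrow>
    frag_of (Leaf (a \<otimes>\<^bsub>H\<^esub> b)) - frag_of (Leaf a) - frag_of (Leaf b) \<in> qlie_ideal H"
| antisym: "x \<in> carrier (word_ring H) \<Longrightarrow> y \<in> carrier (word_ring H) \<Longrightarrow>
    word_bracket x y + word_bracket y x \<in> qlie_ideal H"
| jacobi: "x \<in> carrier (word_ring H) \<Longrightarrow> y \<in> carrier (word_ring H) \<Longrightarrow>
    z \<in> carrier (word_ring H) \<Longrightarrow>
    word_bracket (word_bracket x y) z + word_bracket (word_bracket y z) x
      + word_bracket (word_bracket z x) y \<in> qlie_ideal H"
| bracket_left: "x \<in> qlie_ideal H \<Longrightarrow> y \<in> carrier (word_ring H) \<Longrightarrow>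
    word_bracket x y \<in> qlie_ideal H"
| bracket_right: "x \<in> carrier (word_ring H) \<Longrightarrow> y \<in> qlie_ideal H \<Longrightarrow>
    word_bracket x y \<in> qlie_ideal H"
| zero: "0 \<in> qlie_ideal H"
| diff: "x \<in> qlie_ideal H \<Longrightarrow> y \<in> qlie_ideal H \<Longrightarrow> x - y \<in> qlie_ideal H"

definition qlie :: "('h, 'b) monoid_scheme \<Rightarrow> ('h rtree \<Rightarrow>\<^sub>0 int) set monoid" where
  "qlie H = word_ring H Mod qlie_ideal H"

definition qlie_gen :: "('h, 'b) monoid_scheme \<Rightarrow> 'h \<Rightarrow> ('h rtree \<Rightarrow>\<^sub>0 int) set" where
  "qlie_gen H h = qlie_ideal H #>\<^bsub>word_ring H\<^esub> frag_of (Leaf h)"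

text \<open>The union is over equal cosets; \<open>Mod\<close> multiplies cosets in the same way.\<close>

definition qlie_bracket ::
    "('h, 'b) monoid_scheme \<Rightarrow> ('h rtree \<Rightarrow>\<^sub>0 int) set \<Rightarrow> ('h rtree \<Rightarrow>\<^sub>0 int) set
      \<Rightarrow> ('h rtree \<Rightarrow>\<^sub>0 int) set" where
  "qlie_bracket H X Y = (\<Union>x\<in>X. \<Union>y\<in>Y. qlie_ideal H #>\<^bsub>word_ring H\<^esub> word_bracket x y)"

definition qlie_deg :: "('h, 'b) monoid_scheme \<Rightarrow> nat \<Rightarrow> ('h rtree \<Rightarrow>\<^sub>0 int) set monoid" where
  "qlie_deg H m = (qlie H)\<lparr>carrier :=
     {qlie_ideal H #>\<^bsub>word_ring H\<^esub> x | x.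
        Poly_Mapping.keys x \<subseteq> {t \<in> words H. num_leaves t = m}}\<rparr>"

primrec iterated_bracket :: "('h, 'b) monoid_scheme \<Rightarrow> 'h rtree \<Rightarrow> ('h rtree \<Rightarrow>\<^sub>0 int) set" where
  "iterated_bracket H (Leaf h) = qlie_gen H h"
| "iterated_bracket H (Node s t) =
     qlie_bracket H (iterated_bracket H s) (iterated_bracket H t)"


section \<open>Oriented labeled unitrivalent trees\<close>

text \<open>Since the underlying graph is simple, the edges at a vertex \<open>v\<close> correspond to the neighbours
  of \<open>v\<close>, and an orientation at a trivalent \<open>v\<close> is given by the function \<open>cyc T v\<close> sending each
  neighbour to the next one.  The values of \<open>cyc\<close> and \<open>lab\<close> elsewhere are irrelevant.\<close>

record 'h utree =
  verts :: "nat set"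
  edges :: "nat set set"
  cyc :: "nat \<Rightarrow> nat \<Rightarrow> nat"
  lab :: "nat \<Rightarrow> 'h"

definition nbrs :: "'h utree \<Rightarrow> nat \<Rightarrow> nat set" where
  "nbrs T v = {w. {v, w} \<in> edges T}"

definition univalent :: "'h utree \<Rightarrow> nat set" where
  "univalent T = {v \<in> verts T. card (nbrs T v) = 1}"

definition trivalent :: "'h utree \<Rightarrow> nat set" where
  "trivalent T = {v \<in> verts T. card (nbrs T v) = 3}"

definition is_cycle :: "nat set set \<Rightarrow> nat list \<Rightarrow> bool" where
  "is_cycle E c \<longleftrightarrow> 3 \<le> length c \<and> distinct c \<and>
     (\<forall>i < length c. {c ! i, c ! (Suc i mod length c)} \<in> E)"

definition is_tree :: "nat set \<Rightarrow> nat set set \<Rightarrow> bool" where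
  "is_tree V E \<longleftrightarrow> finite V \<and> V \<noteq> {} \<and> (\<forall>e\<in>E. e \<subseteq> V \<and> card e = 2) \<and>
     (\<forall>v\<in>V. \<forall>w\<in>V. (v, w) \<in> {(x, y). {x, y} \<in> E}\<^sup>*) \<and> (\<nexists>c. is_cycle E c)"

text \<open>A permutation of a three-element set without fixed points is cyclic.\<close>

definition utrees :: "('h, 'b) monoid_scheme \<Rightarrow> nat \<Rightarrow> 'h utree set" where
  "utrees H n = {T. is_tree (verts T) (edges T) \<and>
     verts T = univalent T \<union> trivalent T \<and> card (trivalent T) = n \<and>
     (\<forall>v \<in> trivalent T. bij_betw (cyc T v) (nbrs T v) (nbrs T v) \<and>
        (\<forall>w \<in> nbrs T v. cyc T v w \<noteq> w)) \<and>
     (\<forall>v \<in> univalent T. lab T v \<in> carrier H)}"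

definition utree_iso :: "'h utree \<Rightarrow> 'h utree \<Rightarrow> bool" where
  "utree_iso T T' \<longleftrightarrow> (\<exists>f. bij_betw f (verts T) (verts T') \<and>
     (\<forall>v \<in> verts T. \<forall>w \<in> verts T. {v, w} \<in> edges T \<longleftrightarrow> {f v, f w} \<in> edges T') \<and>
     (\<forall>v \<in> trivalent T. \<forall>w \<in> nbrs T v. f (cyc T v w) = cyc T' (f v) (f w)) \<and>
     (\<forall>v \<in> univalent T. lab T v = lab T' (f v)))"

text \<open>\<open>branch T p q t\<close>: the part of \<open>T\<close> beyond the edge from \<open>p\<close> to \<open>q\<close>, as seen from \<open>p\<close>, is
  the rooted tree \<open>t\<close> (whose root edge is that edge).\<close>

inductive branch :: "'h utree \<Rightarrow> nat \<Rightarrow> nat \<Rightarrow> 'h rtree \<Rightarrow> bool" for T :: "'h utree" where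
  "{p, q} \<in> edges T \<Longrightarrow> q \<in> univalent T \<Longrightarrow> branch T p q (Leaf (lab T q))"
| "{p, q} \<in> edges T \<Longrightarrow> q \<in> trivalent T \<Longrightarrow>
   branch T q (cyc T q p) s \<Longrightarrow> branch T q (cyc T q (cyc T q p)) t \<Longrightarrow>
   branch T p q (Node s t)"

definition rooted_at :: "'h utree \<Rightarrow> nat \<Rightarrow> 'h rtree" where
  "rooted_at T r = (THE t. \<exists>q. branch T r q t)"

definition reverse_at :: "nat \<Rightarrow> 'h utree \<Rightarrow> 'h utree" where
  "reverse_at v T = T\<lparr>cyc := (cyc T)(v := \<lambda>w. cyc T v (cyc T v w))\<rparr>"

definition relabel :: "nat \<Rightarrow> 'h \<Rightarrow> 'h utree \<Rightarrow> 'h utree" where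
  "relabel v a T = T\<lparr>lab := (lab T)(v := a)\<rparr>"

definition is_W :: "'h utree \<Rightarrow> 'h rtree \<Rightarrow> 'h rtree \<Rightarrow> 'h rtree \<Rightarrow> 'h rtree \<Rightarrow> bool" where
  "is_W T A B C D \<longleftrightarrow> (\<exists>u v. branch T v u (Node A B) \<and> branch T u v (Node C D))"

text \<open>Dividing by \<open>iso_relators\<close> makes the generators isomorphism classes of trees.\<close>

definition iso_relators :: "('h, 'b) monoid_scheme \<Rightarrow> nat \<Rightarrow> ('h utree \<Rightarrow>\<^sub>0 int) set" where
  "iso_relators H n =
     {frag_of T - frag_of T' | T T'. T \<in> utrees H n \<and> T' \<in> utrees H n \<and> utree_iso T T'}"

definition AS_relators :: "('h, 'b) monoid_scheme \<Rightarrow> nat \<Rightarrow> ('h utree \<Rightarrow>\<^sub>0 int) set" where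
  "AS_relators H n =
     {frag_of T + frag_of (reverse_at v T) | T v. T \<in> utrees H n \<and> v \<in> trivalent T}"

definition IHX_relators :: "('h, 'b) monoid_scheme \<Rightarrow> nat \<Rightarrow> ('h utree \<Rightarrow>\<^sub>0 int) set" where
  "IHX_relators H n =
     {frag_of T\<^sub>1 + frag_of T\<^sub>2 + frag_of T\<^sub>3 | T\<^sub>1 T\<^sub>2 T\<^sub>3.
        T\<^sub>1 \<in> utrees H n \<and> T\<^sub>2 \<in> utrees H n \<and> T\<^sub>3 \<in> utrees H n \<and>
        (\<exists>A B C D. is_W T\<^sub>1 A B C D \<and> is_W T\<^sub>2 B C A D \<and> is_W T\<^sub>3 C A B D)}"

definition linearity_relators :: "('h, 'b) monoid_scheme \<Rightarrow> nat \<Rightarrow> ('h utree \<Rightarrow>\<^sub>0 int) set" where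
  "linearity_relators H n =
     {frag_of (relabel v (a \<otimes>\<^bsub>H\<^esub> b) T) - frag_of (relabel v a T) - frag_of (relabel v b T) | T v a b.
        T \<in> utrees H n \<and> v \<in> univalent T \<and> a \<in> carrier H \<and> b \<in> carrier H}"

definition tree_group :: "('h, 'b) monoid_scheme \<Rightarrow> nat \<Rightarrow> ('h utree \<Rightarrow>\<^sub>0 int) set monoid" where
  "tree_group H n = free_Abelian_group (utrees H n) Mod
     generate (free_Abelian_group (utrees H n))
       (iso_relators H n \<union> AS_relators H n \<union> IHX_relators H n \<union> linearity_relators H n)"


section \<open>The maps \<open>\<beta>'\<^sub>n\<close> and \<open>\<eta>'\<^sub>n\<close>\<close>

definition beta ::
    "('h, 'b) monoid_scheme \<Rightarrow> nat \<Rightarrow> ('h \<times> ('h rtree \<Rightarrow>\<^sub>0 int) set \<Rightarrow>\<^sub>0 int) set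
      \<Rightarrow> ('h rtree \<Rightarrow>\<^sub>0 int) set" where
  "beta H n = quot_lift (qlie_deg H (n + 2)) (\<lambda>(h, l). qlie_bracket H (qlie_gen H h) l)"

definition D_group ::
    "('h, 'b) monoid_scheme \<Rightarrow> nat \<Rightarrow> ('h \<times> ('h rtree \<Rightarrow>\<^sub>0 int) set \<Rightarrow>\<^sub>0 int) set monoid" where
  "D_group H n = (tensor H (qlie_deg H (n + 1)))\<lparr>carrier :=
     kernel (tensor H (qlie_deg H (n + 1))) (qlie_deg H (n + 2)) (beta H n)\<rparr>"

definition eta_tree ::
    "('h, 'b) monoid_scheme \<Rightarrow> nat \<Rightarrow> 'h utree
      \<Rightarrow> ('h \<times> ('h rtree \<Rightarrow>\<^sub>0 int) set \<Rightarrow>\<^sub>0 int) set" where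
  "eta_tree H n T = finprod (tensor H (qlie_deg H (n + 1)))
     (\<lambda>i. pure_tensor H (qlie_deg H (n + 1)) (lab T i) (iterated_bracket H (rooted_at T i)))
     (univalent T)"

definition eta ::
    "('h, 'b) monoid_scheme \<Rightarrow> nat \<Rightarrow> ('h utree \<Rightarrow>\<^sub>0 int) set
      \<Rightarrow> ('h \<times> ('h rtree \<Rightarrow>\<^sub>0 int) set \<Rightarrow>\<^sub>0 int) set" where
  "eta H n = quot_lift (tensor H (qlie_deg H (n + 1))) (eta_tree H n)"

end

theory Submission
  imports Defs
begin

text \<open>
  A tree with two trivalent vertices is H-shaped and given by the labels \<open>a\<close>, \<open>b\<close> at one end and \<open>c\<close>,
  \<open>d\<close> at the other.  If \<open>W(a, b, c, d)\<close> denotes this tree, then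
  \<open>\<eta>'(W(a, b, c, d)) = a \<otimes> [b, [c, d]] + b \<otimes> [[c, d], a] + c \<otimes> [d, [a, b]] + d \<otimes> [[a, b], c]\<close>.
  That \<open>\<eta>'\<close> respects antisymmetry, IHX and linearity, and that its values are in the kernel of \<open>\<beta>'\<close>,
  follows from antisymmetry and the Jacobi identity applied to this formula (\<open>eta_rep_antisym\<close>,
  \<open>eta_rep_IHX\<close>, \<open>frag_extend_beta_frag_eta_rep\<close>).

  For surjectivity onto the kernel, consider a homomorphism \<open>\<sigma>\<close> from the quartic
  part of the quasi-Lie algebra to the cokernel of \<open>\<eta>'\<close> with \<open>\<sigma>[h,
  \<lambda>] = h \<otimes> \<lambda>\<close>. By the Jacobi identity its values on the remaining
  generators have to be \<open>\<sigma>[[a, b], z] = a \<otimes> [b, z] - b \<otimes> [a, z]\<close>.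
  All relations are respected already in the tensor product, with the exception of \<open>[[a, b], [c,
  d]] + [[c, d], [a, b]] = 0\<close>, and what \<open>\<sigma>\<close> makes of this is exactly
  \<open>\<eta>'(W(a, b, c, d)) = 0\<close> (\<open>bracket_section_ideal\<close>). As
  \<open>\<sigma>\<close> inverts \<open>\<beta>'\<close> modulo the image of \<open>\<eta>'\<close>,
  this image contains the kernel of \<open>\<beta>'\<close> (\<open>exactness\<close>).

  For injectivity, attach \<open>h\<close> to the root of \<open>\<lambda>\<close>. This maps \<open>h
  \<otimes> \<lambda>\<close> back to a tree, and applied to \<open>\<eta>'(T)\<close> it gives
  \<open>T\<close> once for each of the four leaves. So the kernel of \<open>\<eta>'\<close> is
  annihilated by 4, and it remains to show that the tree group has no torsion. This is where freeness of
  \<open>H\<close> enters. The function \<open>W\<close> is quadrilinear and has the symmetries of a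
  curvature tensor, IHX being the Bianchi identity; the values at basis elements can therefore be
  straightened to those at standard two by two tableaux. The straightened values, as formal linear
  combinations of trees, satisfy the same relations exactly (\<open>straight_bianchi\<close>), which
  gives a section of the projection from the free abelian group on trees to the tree group and embeds
  the latter into a free abelian group (\<open>eta_frag_injective\<close>).

  All groups here are quotients of free abelian groups, or subgroups of such quotients, and all maps are
  induced by linear maps between the free abelian groups (\<open>quot_lift_frag_coset\<close>).  The arguments
  are carried out on representatives, modulo the respective subgroups of relations.
\<close>

section \<open>Additive subgroups and quotients of free abelian groups\<close>

text \<open>The condition refers to the operations of the type and not to a carrier, so that it is inherited by
  preimages under linear maps.  Relations are checked below by showing that they lie in such a
  preimage.\<close>

definition add_subgroup :: "'a::ab_group_add set \<Rightarrow> bool" where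
  "add_subgroup N \<longleftrightarrow> 0 \<in> N \<and> (\<forall>x\<in>N. \<forall>y\<in>N. x - y \<in> N)"

lemma add_subgroup_zero: "add_subgroup N \<Longrightarrow> 0 \<in> N"
  and add_subgroup_diff: "add_subgroup N \<Longrightarrow> x \<in> N \<Longrightarrow> y \<in> N \<Longrightarrow> x - y \<in> N"
  by (auto simp: add_subgroup_def)

lemma add_subgroup_minus: "add_subgroup N \<Longrightarrow> x \<in> N \<Longrightarrow> - x \<in> N"
  by (metis add_subgroup_def diff_0)

lemma add_subgroup_add: "add_subgroup N \<Longrightarrow> x \<in> N \<Longrightarrow> y \<in> N \<Longrightarrow> x + y \<in> N"
  by (metis add_subgroup_diff add_subgroup_minus diff_minus_eq_add)

lemma add_subgroup_trans:
  "add_subgroup N \<Longrightarrow> x - y \<in> N \<Longrightarrow> y - z \<in> N \<Longrightarrow> x - z \<in> N"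
  using add_subgroup_add[of N "x - y" "y - z"] by simp

lemma add_subgroup_sym: "add_subgroup N \<Longrightarrow> x - y \<in> N \<Longrightarrow> y - x \<in> N"
  using add_subgroup_minus[of N "x - y"] by simp

lemma add_subgroup_mem_iff: "add_subgroup N \<Longrightarrow> x - y \<in> N \<Longrightarrow> x \<in> N \<longleftrightarrow> y \<in> N"
  using add_subgroup_add[of N "x - y" y] add_subgroup_diff[of N x "x - y"] by auto

lemma add_subgroup_frags: "add_subgroup {c :: 'a \<Rightarrow>\<^sub>0 int. Poly_Mapping.keys c \<subseteq> S}"
  using keys_diff by (fastforce simp: add_subgroup_def)

lemma keys_diff_subset:
  "Poly_Mapping.keys x \<subseteq> S \<Longrightarrow> Poly_Mapping.keys y \<subseteq> S \<Longrightarrow> Poly_Mapping.keys (x - y :: 'a \<Rightarrow>\<^sub>0 int) \<subseteq> S"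
  using add_subgroup_diff[OF add_subgroup_frags] by blast

lemma keys_add_subset:
  "Poly_Mapping.keys x \<subseteq> S \<Longrightarrow> Poly_Mapping.keys y \<subseteq> S \<Longrightarrow> Poly_Mapping.keys (x + y :: 'a \<Rightarrow>\<^sub>0 int) \<subseteq> S"
  using add_subgroup_add[OF add_subgroup_frags] by blast

lemma frag_extend_mem:
  assumes "add_subgroup N" "\<And>x. x \<in> Poly_Mapping.keys c \<Longrightarrow> f x \<in> N"
  shows "frag_extend f c \<in> N"
  by (rule frag_induction[of c "Poly_Mapping.keys c"])
     (use assms in \<open>auto simp: frag_extend_diff add_subgroup_zero add_subgroup_diff\<close>)

lemma frag_extend_diff_fun:
  "frag_extend (\<lambda>x. f x - g x) c = frag_extend f c - frag_extend g c"
  by (rule frag_induction[of c UNIV]) (auto simp: frag_extend_diff)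

lemma frag_extend_add_fun:
  "frag_extend (\<lambda>x. f x + g x) c = frag_extend f c + frag_extend g c"
  by (rule frag_induction[of c UNIV]) (auto simp: frag_extend_diff)

lemma frag_extend_minus_fun: "frag_extend (\<lambda>x. - f x) c = - frag_extend f c"
  by (rule frag_induction[of c UNIV]) (auto simp: frag_extend_diff)

lemma frag_extend_cmul_fun: "frag_extend (\<lambda>x. frag_cmul k (f x)) c = frag_cmul k (frag_extend f c)"
  by (simp add: frag_extend_def frag_cmul_sum mult.commute)

lemma frag_extend_congruent:
  assumes "add_subgroup N" "\<And>x. x \<in> Poly_Mapping.keys c \<Longrightarrow> f x - g x \<in> N"
  shows "frag_extend f c - frag_extend g c \<in> N"
  using frag_extend_mem[OF assms] by (simp add: frag_extend_diff_fun)

lemma frag_extend_frag_extend: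
  "frag_extend f (frag_extend g c) = frag_extend (\<lambda>x. frag_extend f (g x)) c"
  by (rule frag_induction[of c UNIV]) (auto simp: frag_extend_diff)

lemma add_subgroup_vimage_frag_extend:
  "add_subgroup N \<Longrightarrow> add_subgroup {c. frag_extend f c \<in> N}"
  by (auto simp: add_subgroup_def frag_extend_diff)

lemma add_subgroup_frag_extend_image:
  assumes "add_subgroup N"
  shows "add_subgroup {z. \<exists>x. Poly_Mapping.keys x \<subseteq> S \<and> z - frag_extend f x \<in> N}"
proof -
  have "\<exists>x. Poly_Mapping.keys x \<subseteq> S \<and> (z - w) - frag_extend f x \<in> N"
    if "Poly_Mapping.keys x \<subseteq> S" "z - frag_extend f x \<in> N"
       "Poly_Mapping.keys y \<subseteq> S" "w - frag_extend f y \<in> N" for x y z w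
    using keys_diff_subset[of x S y] add_subgroup_diff[OF assms that(2,4)] that
    by (intro exI[of _ "x - y"]) (simp add: frag_extend_diff algebra_simps)
  moreover have "\<exists>x. Poly_Mapping.keys x \<subseteq> S \<and> 0 - frag_extend f x \<in> N"
    by (rule exI[of _ 0]) (simp add: add_subgroup_zero[OF assms])
  ultimately show ?thesis
    unfolding add_subgroup_def by blast
qed

lemma subgroup_free_Abelian_group_iff:
  "subgroup N (free_Abelian_group S) \<longleftrightarrow>
     add_subgroup N \<and> N \<subseteq> carrier (free_Abelian_group S)"
proof
  assume N: "subgroup N (free_Abelian_group S)"
  then have sub: "N \<subseteq> carrier (free_Abelian_group S)"
    by (rule subgroup.subset)
  have "x - y \<in> N" if "x \<in> N" "y \<in> N" for x y
  proof -
    have "- y \<in> N"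
      using subgroup.m_inv_closed[OF N that(2)] sub that(2) by auto
    then show ?thesis
      using subgroup.m_closed[OF N that(1)] by fastforce
  qed
  moreover have "0 \<in> N"
    using subgroup.one_closed[OF N] by simp
  ultimately show "add_subgroup N \<and> N \<subseteq> carrier (free_Abelian_group S)"
    using sub by (simp add: add_subgroup_def)
next
  assume N: "add_subgroup N \<and> N \<subseteq> carrier (free_Abelian_group S)"
  then have "inv\<^bsub>free_Abelian_group S\<^esub> x \<in> N" if "x \<in> N" for x
    using that add_subgroup_minus[of N x] by fastforce
  with N show "subgroup N (free_Abelian_group S)"
    by (auto simp: subgroup_def add_subgroup_add add_subgroup_zero)
qed

lemma generate_frag:
  assumes "R \<subseteq> carrier (free_Abelian_group S)"
  shows "subgroup (generate (free_Abelian_group S) R) (free_Abelian_group S)"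
    and "add_subgroup (generate (free_Abelian_group S) R)"
  using group.generate_is_subgroup[OF group_free_Abelian_group assms]
  by (simp_all add: subgroup_free_Abelian_group_iff)

lemma generate_frag_subset:
  assumes R: "R \<subseteq> carrier (free_Abelian_group S)" and "add_subgroup M" "R \<subseteq> M"
  shows "generate (free_Abelian_group S) R \<subseteq> M"
proof
  fix x assume "x \<in> generate (free_Abelian_group S) R"
  then show "x \<in> M"
  proof induction
    case (inv h)
    then show ?case
      using assms add_subgroup_minus[of M h] by (metis carrier_free_Abelian_group_iff inv_free_Abelian_group subsetD)
  qed (use assms in \<open>auto intro: add_subgroup_zero add_subgroup_add\<close>)
qed

context
  fixes S :: "'a set" and N :: "('a \<Rightarrow>\<^sub>0 int) set"
  assumes N: "subgroup N (free_Abelian_group S)"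
begin

lemma frag_normal: "N \<lhd> free_Abelian_group S"
  by (rule comm_group.normal_iff_subgroup[THEN iffD2, OF abelian_free_Abelian_group N])

lemma frag_subgroup: "add_subgroup N" "N \<subseteq> carrier (free_Abelian_group S)"
  using N by (simp_all add: subgroup_free_Abelian_group_iff)

lemma comm_group_frag_quotient: "comm_group (free_Abelian_group S Mod N)"
  by (rule comm_group.abelian_FactGroup[OF abelian_free_Abelian_group N])

lemma frag_coset_mult:
  assumes "Poly_Mapping.keys x \<subseteq> S" "Poly_Mapping.keys y \<subseteq> S"
  shows "(N #>\<^bsub>free_Abelian_group S\<^esub> x) <#>\<^bsub>free_Abelian_group S\<^esub> (N #>\<^bsub>free_Abelian_group S\<^esub> y)
    = N #>\<^bsub>free_Abelian_group S\<^esub> (x + y)"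
  using normal.rcos_sum[OF frag_normal, of x y] assms by simp

lemma mem_frag_coset_iff: "z \<in> N #>\<^bsub>free_Abelian_group S\<^esub> x \<longleftrightarrow> z - x \<in> N"
  by (force simp: r_coset_def)

lemma frag_coset_eq_iff:
  "N #>\<^bsub>free_Abelian_group S\<^esub> x = N #>\<^bsub>free_Abelian_group S\<^esub> y \<longleftrightarrow> x - y \<in> N"
proof
  assume "N #>\<^bsub>free_Abelian_group S\<^esub> x = N #>\<^bsub>free_Abelian_group S\<^esub> y"
  then show "x - y \<in> N"
    using mem_frag_coset_iff[of x x] mem_frag_coset_iff[of x y] add_subgroup_zero[OF frag_subgroup(1)]
    by simp
next
  assume xy: "x - y \<in> N"
  show "N #>\<^bsub>free_Abelian_group S\<^esub> x = N #>\<^bsub>free_Abelian_group S\<^esub> y"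
    using add_subgroup_trans[OF frag_subgroup(1) _ xy]
      add_subgroup_trans[OF frag_subgroup(1) _ add_subgroup_sym[OF frag_subgroup(1) xy]]
    by (auto simp: mem_frag_coset_iff)
qed

lemma frag_coset_zero: "N #>\<^bsub>free_Abelian_group S\<^esub> 0 = N"
  by (auto simp: mem_frag_coset_iff)

lemma carrier_frag_quotient:
  "carrier (free_Abelian_group S Mod N) =
     {N #>\<^bsub>free_Abelian_group S\<^esub> x | x. Poly_Mapping.keys x \<subseteq> S}"
  by (auto simp: carrier_FactGroup)

text \<open>The group \<open>Q\<close> may be the quotient itself or a subgroup of it, as for the homogeneous
  parts of the free quasi-Lie algebra, which are given by restricting the carrier.\<close>

context
  fixes Q :: "('a \<Rightarrow>\<^sub>0 int) set monoid"
  assumes Q: "comm_group Q" "mult Q = mult (free_Abelian_group S Mod N)" "one Q = N"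
    "carrier Q \<subseteq> carrier (free_Abelian_group S Mod N)"
begin

lemma mult_frag_coset:
  assumes "Poly_Mapping.keys x \<subseteq> S" "Poly_Mapping.keys y \<subseteq> S"
  shows "(N #>\<^bsub>free_Abelian_group S\<^esub> x) \<otimes>\<^bsub>Q\<^esub> (N #>\<^bsub>free_Abelian_group S\<^esub> y)
    = N #>\<^bsub>free_Abelian_group S\<^esub> (x + y)"
  using frag_coset_mult[OF assms] by (simp add: Q(2))

lemma finprod_frag_coset:
  assumes "finite A" "\<And>i. i \<in> A \<Longrightarrow> N #>\<^bsub>free_Abelian_group S\<^esub> g i \<in> carrier Q"
    "\<And>i. i \<in> A \<Longrightarrow> Poly_Mapping.keys (g i) \<subseteq> S"
  shows "finprod Q (\<lambda>i. N #>\<^bsub>free_Abelian_group S\<^esub> g i) A = N #>\<^bsub>free_Abelian_group S\<^esub> sum g A"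
  using assms
proof (induction A rule: finite_induct)
  case empty
  interpret comm_group Q by (rule Q)
  show ?case by (simp add: frag_coset_zero Q)
next
  case (insert a A)
  interpret comm_group Q by (rule Q)
  have keys: "Poly_Mapping.keys (sum g A) \<subseteq> S"
    using sum_closed_free_Abelian_group[of A g S] insert.prems by auto
  show ?case
    using insert keys by (simp add: Pi_iff mult_frag_coset)
qed

lemma int_pow_frag_coset:
  assumes X: "N #>\<^bsub>free_Abelian_group S\<^esub> x \<in> carrier Q" and x: "Poly_Mapping.keys x \<subseteq> S"
  shows "(N #>\<^bsub>free_Abelian_group S\<^esub> x) [^]\<^bsub>Q\<^esub> (k::int) = N #>\<^bsub>free_Abelian_group S\<^esub> frag_cmul k x"
proof -
  interpret comm_group Q by (rule Q)
  let ?c = "\<lambda>y. N #>\<^bsub>free_Abelian_group S\<^esub> y"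
  have keys: "Poly_Mapping.keys (frag_cmul i x) \<subseteq> S" for i
    using x keys_cmul[of i x] by blast
  have nat: "?c x [^]\<^bsub>Q\<^esub> (n::nat) = ?c (frag_cmul (int n) x)" for n
    by (induction n)
       (simp_all add: frag_coset_zero Q(3) mult_frag_coset keys x frag_cmul_distrib add.commute)
  show ?thesis
  proof (cases "k \<ge> 0")
    case True
    then show ?thesis
      using nat[of "nat k"] int_pow_int[of Q "?c x" "nat k"] by simp
  next
    case False
    then obtain n where n: "k = - int n"
      by (metis int_cases2 of_nat_0_le_iff)
    have C: "?c x [^]\<^bsub>Q\<^esub> n \<in> carrier Q"
      using X by simp
    obtain y where y: "inv\<^bsub>Q\<^esub> (?c x [^]\<^bsub>Q\<^esub> n) = ?c y" "Poly_Mapping.keys y \<subseteq> S"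
      using Q(4) inv_closed[OF C] unfolding carrier_frag_quotient by blast
    have "?c y \<otimes>\<^bsub>Q\<^esub> ?c (frag_cmul (int n) x) = ?c 0"
      using l_inv[OF C] y by (simp add: nat Q(3) frag_coset_zero)
    then have "y - frag_cmul k x \<in> N"
      using y keys by (simp add: mult_frag_coset frag_coset_eq_iff n flip: minus_frag_cmul)
    then show ?thesis
      using y X by (simp add: n int_pow_neg_int frag_coset_eq_iff)
  qed
qed

lemma free_lift_frag_coset:
  assumes "\<And>k. k \<in> Poly_Mapping.keys c \<Longrightarrow> f k = N #>\<^bsub>free_Abelian_group S\<^esub> g k"
    "\<And>k. k \<in> Poly_Mapping.keys c \<Longrightarrow> f k \<in> carrier Q"
    "\<And>k. k \<in> Poly_Mapping.keys c \<Longrightarrow> Poly_Mapping.keys (g k) \<subseteq> S"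
  shows "free_lift Q f c = N #>\<^bsub>free_Abelian_group S\<^esub> frag_extend g c"
proof -
  interpret comm_group Q by (rule Q)
  have fk: "f k [^]\<^bsub>Q\<^esub> Poly_Mapping.lookup c k
      = N #>\<^bsub>free_Abelian_group S\<^esub> frag_cmul (Poly_Mapping.lookup c k) (g k)"
    and fC: "f k [^]\<^bsub>Q\<^esub> Poly_Mapping.lookup c k \<in> carrier Q"
    if "k \<in> Poly_Mapping.keys c" for k
    using int_pow_frag_coset[of "g k" "Poly_Mapping.lookup c k"] assms[OF that] int_pow_closed[of "f k"]
    by metis+
  have "free_lift Q f c = finprod Q
      (\<lambda>k. N #>\<^bsub>free_Abelian_group S\<^esub> frag_cmul (Poly_Mapping.lookup c k) (g k)) (Poly_Mapping.keys c)"
    unfolding free_lift_def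
    by (rule finprod_cong') (use fk fC in \<open>auto simp del: int_pow_closed\<close>)
  also have "\<dots> = N #>\<^bsub>free_Abelian_group S\<^esub> frag_extend g c"
    unfolding frag_extend_def
  proof (rule finprod_frag_coset)
    show "Poly_Mapping.keys (frag_cmul (Poly_Mapping.lookup c k) (g k)) \<subseteq> S"
      if "k \<in> Poly_Mapping.keys c" for k
      using assms(3)[OF that] keys_cmul[of _ "g k"] by blast
  qed (use fk fC in auto)
  finally show ?thesis .
qed

text \<open>All maps of the theorem are given by extending linearly to a free abelian group and passing
  to quotients; here such a map is computed on representatives.\<close>

lemma quot_lift_frag_coset:
  assumes M: "subgroup M (free_Abelian_group T)"
    and f: "\<And>k. k \<in> T \<Longrightarrow> f k = N #>\<^bsub>free_Abelian_group S\<^esub> g k" "\<And>k. k \<in> T \<Longrightarrow> f k \<in> carrier Q"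
      "\<And>k. k \<in> T \<Longrightarrow> Poly_Mapping.keys (g k) \<subseteq> S"
    and gM: "\<And>m. m \<in> M \<Longrightarrow> frag_extend g m \<in> N"
    and c: "Poly_Mapping.keys c \<subseteq> T"
  shows "quot_lift Q f (M #>\<^bsub>free_Abelian_group T\<^esub> c) = N #>\<^bsub>free_Abelian_group S\<^esub> frag_extend g c"
proof -
  have "free_lift Q f d = N #>\<^bsub>free_Abelian_group S\<^esub> frag_extend g c"
    if d: "d \<in> M #>\<^bsub>free_Abelian_group T\<^esub> c" for d
  proof -
    obtain m where m: "m \<in> M" "d = m + c"
      using d by (auto simp: r_coset_def)
    have "Poly_Mapping.keys m \<subseteq> T"
      using subsetD[OF subgroup.subset[OF M] m(1)] by simp
    with m c have "Poly_Mapping.keys d \<subseteq> T"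
      by (simp add: keys_add_subset)
    then have "free_lift Q f d = N #>\<^bsub>free_Abelian_group S\<^esub> frag_extend g d"
      by (intro free_lift_frag_coset f) auto
    also have "\<dots> = N #>\<^bsub>free_Abelian_group S\<^esub> frag_extend g c"
      using gM[OF m(1)] by (simp add: frag_coset_eq_iff m frag_extend_add)
    finally show ?thesis .
  qed
  moreover have "c \<in> M #>\<^bsub>free_Abelian_group T\<^esub> c"
    using M subgroup.one_closed[OF M] by (force simp: r_coset_def)
  ultimately have "free_lift Q f ` (M #>\<^bsub>free_Abelian_group T\<^esub> c)
      = {N #>\<^bsub>free_Abelian_group S\<^esub> frag_extend g c}"
    by auto
  then show ?thesis
    by (simp add: quot_lift_def)
qed

end

end

section \<open>The free quasi-Lie algebra on representatives\<close>

lemma word_bracket_of [simp]: "word_bracket (frag_of s) (frag_of t) = frag_of (Node s t)"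
  by (simp add: word_bracket_def)

lemma word_bracket_simps:
  "word_bracket 0 y = 0" "word_bracket x 0 = 0"
  "word_bracket (- x) y = - word_bracket x y" "word_bracket x (- y) = - word_bracket x y"
  "word_bracket (x + x') y = word_bracket x y + word_bracket x' y"
  "word_bracket x (y + y') = word_bracket x y + word_bracket x y'"
  "word_bracket (x - x') y = word_bracket x y - word_bracket x' y"
  "word_bracket x (y - y') = word_bracket x y - word_bracket x y'"
  by (simp_all add: word_bracket_def frag_extend_add frag_extend_diff frag_extend_minus
      frag_extend_add_fun frag_extend_diff_fun frag_extend_minus_fun frag_extend_eq_0)

lemma word_bracket_mem:
  assumes "add_subgroup N"
    "\<And>s t. s \<in> Poly_Mapping.keys x \<Longrightarrow> t \<in> Poly_Mapping.keys y \<Longrightarrow> frag_of (Node s t) \<in> N"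
  shows "word_bracket x y \<in> N"
  unfolding word_bracket_def by (intro frag_extend_mem assms)

lemma Leaf_in_words [simp]: "Leaf a \<in> words H \<longleftrightarrow> a \<in> carrier H"
  and Node_in_words [simp]: "Node s t \<in> words H \<longleftrightarrow> s \<in> words H \<and> t \<in> words H"
  by (auto simp: words_def)

definition homogeneous_words :: "('h, 'b) monoid_scheme \<Rightarrow> nat \<Rightarrow> 'h rtree set" where
  "homogeneous_words H m = {t \<in> words H. num_leaves t = m}"

lemma num_leaves_pos: "num_leaves t > 0"
  by (induction t) auto

lemma num_leaves_eq_1: "num_leaves t = Suc 0 \<longleftrightarrow> (\<exists>a. t = Leaf a)"
proof (cases t)
  case (Node r s)
  then show ?thesis
    using num_leaves_pos[of r] num_leaves_pos[of s] by auto
qed auto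

lemma num_leaves_eq_2: "num_leaves t = 2 \<longleftrightarrow> (\<exists>a b. t = Node (Leaf a) (Leaf b))"
proof (cases t)
  case (Node r s)
  then show ?thesis
    using num_leaves_pos[of r] num_leaves_pos[of s] num_leaves_eq_1[of r] num_leaves_eq_1[of s]
    by force
qed auto

lemma keys_word_bracket_words:
  assumes "Poly_Mapping.keys x \<subseteq> words H" "Poly_Mapping.keys y \<subseteq> words H"
  shows "Poly_Mapping.keys (word_bracket x y) \<subseteq> words H"
  using word_bracket_mem[OF add_subgroup_frags[of "words H"], of x y] assms by auto

lemma keys_word_bracket_homogeneous:
  assumes "Poly_Mapping.keys x \<subseteq> homogeneous_words H k" "Poly_Mapping.keys y \<subseteq> homogeneous_words H l"
  shows "Poly_Mapping.keys (word_bracket x y) \<subseteq> homogeneous_words H (k + l)"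
  using word_bracket_mem[OF add_subgroup_frags[of "homogeneous_words H (k + l)"], of x y] assms
  by (fastforce simp: homogeneous_words_def)

lemma add_subgroup_word_bracket_right:
  assumes "add_subgroup N"
  shows "add_subgroup {y. word_bracket x y \<in> N}"
  using assms by (auto simp: add_subgroup_def word_bracket_simps)

lemma add_subgroup_qlie_ideal: "add_subgroup (qlie_ideal H)"
  by (auto simp: add_subgroup_def intro: qlie_ideal.zero qlie_ideal.diff)

context
  fixes H :: "('h, 'b) monoid_scheme"
  assumes H: "comm_group H"
begin

interpretation H: comm_group H by (rule H)

lemma qlie_ideal_subset_words: "qlie_ideal H \<subseteq> carrier (word_ring H)"
proof
  fix x assume "x \<in> qlie_ideal H"
  then show "x \<in> carrier (word_ring H)"
    by induction (simp_all add: keys_diff_subset keys_add_subset keys_word_bracket_words)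
qed

lemma subgroup_qlie_ideal: "subgroup (qlie_ideal H) (word_ring H)"
  by (simp add: subgroup_free_Abelian_group_iff add_subgroup_qlie_ideal qlie_ideal_subset_words)

lemma qlie_ideal_bracket_cong:
  assumes "x - x' \<in> qlie_ideal H" "y - y' \<in> qlie_ideal H"
    "Poly_Mapping.keys x' \<subseteq> words H" "Poly_Mapping.keys y \<subseteq> words H"
  shows "word_bracket x y - word_bracket x' y' \<in> qlie_ideal H"
proof -
  have "word_bracket x y - word_bracket x' y' = word_bracket (x - x') y + word_bracket x' (y - y')"
    by (simp add: word_bracket_simps)
  moreover have "word_bracket (x - x') y \<in> qlie_ideal H" "word_bracket x' (y - y') \<in> qlie_ideal H"
    using assms by (auto intro: qlie_ideal.bracket_left qlie_ideal.bracket_right)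
  ultimately show ?thesis
    by (simp add: add_subgroup_add[OF add_subgroup_qlie_ideal])
qed

lemma qlie_bracket_coset:
  assumes x: "Poly_Mapping.keys x \<subseteq> words H" and y: "Poly_Mapping.keys y \<subseteq> words H"
  shows "qlie_bracket H (qlie_ideal H #>\<^bsub>word_ring H\<^esub> x) (qlie_ideal H #>\<^bsub>word_ring H\<^esub> y)
    = qlie_ideal H #>\<^bsub>word_ring H\<^esub> word_bracket x y"
proof -
  note mem = mem_frag_coset_iff[OF subgroup_qlie_ideal]
  have "qlie_ideal H #>\<^bsub>word_ring H\<^esub> word_bracket x' y' = qlie_ideal H #>\<^bsub>word_ring H\<^esub> word_bracket x y"
    if "x' \<in> qlie_ideal H #>\<^bsub>word_ring H\<^esub> x" "y' \<in> qlie_ideal H #>\<^bsub>word_ring H\<^esub> y" for x' y'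
  proof -
    have "y' - y \<in> qlie_ideal H" "x' - x \<in> qlie_ideal H"
      using that by (simp_all add: mem)
    moreover have "Poly_Mapping.keys y' \<subseteq> words H"
      using keys_add_subset[of "y' - y" "words H" y] y subsetD[OF qlie_ideal_subset_words calculation(1)]
      by simp
    ultimately show ?thesis
      using qlie_ideal_bracket_cong x by (simp add: frag_coset_eq_iff[OF subgroup_qlie_ideal])
  qed
  moreover have "x \<in> qlie_ideal H #>\<^bsub>word_ring H\<^esub> x" "y \<in> qlie_ideal H #>\<^bsub>word_ring H\<^esub> y"
    by (simp_all add: mem qlie_ideal.zero)
  ultimately show ?thesis
    unfolding qlie_bracket_def by blast
qed

lemma iterated_bracket_eq_coset:
  "t \<in> words H \<Longrightarrow> iterated_bracket H t = qlie_ideal H #>\<^bsub>word_ring H\<^esub> frag_of t"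
  by (induction t) (simp_all add: qlie_gen_def qlie_bracket_coset)

lemma carrier_qlie_deg:
  "carrier (qlie_deg H m) =
     {qlie_ideal H #>\<^bsub>word_ring H\<^esub> x | x. Poly_Mapping.keys x \<subseteq> homogeneous_words H m}"
  by (simp add: qlie_deg_def homogeneous_words_def)

lemma homogeneous_words_subset: "homogeneous_words H m \<subseteq> words H"
  by (auto simp: homogeneous_words_def)

lemma qlie_deg_quotient:
  shows comm_group_qlie_deg: "comm_group (qlie_deg H m)"
    and mult_qlie_deg: "mult (qlie_deg H m) = mult (word_ring H Mod qlie_ideal H)"
    and one_qlie_deg: "one (qlie_deg H m) = qlie_ideal H"
    and carrier_qlie_deg_subset: "carrier (qlie_deg H m) \<subseteq> carrier (word_ring H Mod qlie_ideal H)"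
proof -
  let ?Q = "word_ring H Mod qlie_ideal H"
  let ?c = "\<lambda>x. qlie_ideal H #>\<^bsub>word_ring H\<^esub> x"
  interpret Q: comm_group ?Q
    by (rule comm_group_frag_quotient[OF subgroup_qlie_ideal])
  show mult: "mult (qlie_deg H m) = mult ?Q" and "one (qlie_deg H m) = qlie_ideal H"
    by (simp_all add: qlie_deg_def qlie_def)
  show sub: "carrier (qlie_deg H m) \<subseteq> carrier ?Q"
    using homogeneous_words_subset
    by (auto simp: carrier_qlie_deg carrier_frag_quotient[OF subgroup_qlie_ideal])
  have "subgroup (carrier (qlie_deg H m)) ?Q"
  proof (rule Q.subgroupI[OF sub])
    show "carrier (qlie_deg H m) \<noteq> {}"
      unfolding carrier_qlie_deg using keys_zero by blast
  next
    fix X assume "X \<in> carrier (qlie_deg H m)"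
    then obtain x where x: "X = ?c x" "Poly_Mapping.keys x \<subseteq> homogeneous_words H m"
      by (auto simp: carrier_qlie_deg)
    have "?c (- x) \<otimes>\<^bsub>?Q\<^esub> X = \<one>\<^bsub>?Q\<^esub>"
      using x homogeneous_words_subset frag_coset_mult[OF subgroup_qlie_ideal, of "- x" x]
      by (simp add: frag_coset_zero[OF subgroup_qlie_ideal] order_trans)
    moreover have "?c (- x) \<in> carrier (qlie_deg H m)"
      using x unfolding carrier_qlie_deg by (intro CollectI exI[of _ "- x"]) simp
    ultimately have "inv\<^bsub>?Q\<^esub> X = ?c (- x)"
      using \<open>X \<in> _\<close> sub by (intro Q.inv_equality) blast+
    then show "inv\<^bsub>?Q\<^esub> X \<in> carrier (qlie_deg H m)"
      using \<open>?c (- x) \<in> _\<close> by simp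
  next
    fix X Y assume "X \<in> carrier (qlie_deg H m)" "Y \<in> carrier (qlie_deg H m)"
    then obtain x y where xy: "X = ?c x" "Poly_Mapping.keys x \<subseteq> homogeneous_words H m"
        "Y = ?c y" "Poly_Mapping.keys y \<subseteq> homogeneous_words H m"
      unfolding carrier_qlie_deg by blast
    then have "X \<otimes>\<^bsub>?Q\<^esub> Y = ?c (x + y)"
      using frag_coset_mult[OF subgroup_qlie_ideal, of x y] homogeneous_words_subset[of m] by simp
    then show "X \<otimes>\<^bsub>?Q\<^esub> Y \<in> carrier (qlie_deg H m)"
      unfolding carrier_qlie_deg using keys_add_subset[OF xy(2,4)] by blast
  qed
  then show "comm_group (qlie_deg H m)"
    using Q.subgroup_imp_group[of "carrier (qlie_deg H m)"] Q.m_comm sub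
    by (intro group.group_comm_groupI) (auto simp: qlie_deg_def qlie_def)
qed

end

text \<open>The ideal is homogeneous: it is spanned, as an additive group, by the relators below, each
  of which lives in a single degree.  Brackets with the relator on the left are reduced to those with
  the relator on the right by antisymmetry.  Hence a linear map on words can be shown to kill the
  ideal by considering the few forms that a relator of a given degree can take.\<close>

inductive hrel :: "('h, 'b) monoid_scheme \<Rightarrow> nat \<Rightarrow> ('h rtree \<Rightarrow>\<^sub>0 int) \<Rightarrow> bool"
  for H :: "('h, 'b) monoid_scheme" where
  additive: "a \<in> carrier H \<Longrightarrow> b \<in> carrier H \<Longrightarrow>
    hrel H 1 (frag_of (Leaf (a \<otimes>\<^bsub>H\<^esub> b)) - frag_of (Leaf a) - frag_of (Leaf b))"
| antisym: "s \<in> words H \<Longrightarrow> t \<in> words H \<Longrightarrow>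
    hrel H (num_leaves s + num_leaves t) (frag_of (Node s t) + frag_of (Node t s))"
| jacobi: "s \<in> words H \<Longrightarrow> t \<in> words H \<Longrightarrow> u \<in> words H \<Longrightarrow>
    hrel H (num_leaves s + num_leaves t + num_leaves u)
      (frag_of (Node (Node s t) u) + frag_of (Node (Node t u) s) + frag_of (Node (Node u s) t))"
| right: "t \<in> words H \<Longrightarrow> hrel H k r \<Longrightarrow> hrel H (num_leaves t + k) (word_bracket (frag_of t) r)"

lemma hrel_in_qlie_ideal: "hrel H k r \<Longrightarrow> r \<in> qlie_ideal H"
proof (induction rule: hrel.induct)
  case (additive a b)
  then show ?case by (rule qlie_ideal.additive)
next
  case (antisym s t)
  then show ?case using qlie_ideal.antisym[of "frag_of s" H "frag_of t"] by simp
next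
  case (jacobi s t u)
  then show ?case using qlie_ideal.jacobi[of "frag_of s" H "frag_of t" "frag_of u"] by simp
next
  case (right t k r)
  then show ?case by (intro qlie_ideal.bracket_right) auto
qed

lemma keys_hrel:
  assumes "comm_group H" "hrel H k r"
  shows "Poly_Mapping.keys r \<subseteq> homogeneous_words H k"
  using assms(2)
proof (induction rule: hrel.induct)
  case (additive a b)
  interpret comm_group H by (rule assms)
  show ?case
    using additive by (intro keys_diff_subset) (auto simp: homogeneous_words_def)
next
  case (antisym s t)
  then show ?case by (intro keys_add_subset) (auto simp: homogeneous_words_def)
next
  case (jacobi s t u)
  then show ?case by (intro keys_add_subset) (auto simp: homogeneous_words_def)
next
  case (right t k r)
  then show ?case
    by (intro keys_word_bracket_homogeneous) (auto simp: homogeneous_words_def)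
qed

lemma qlie_ideal_subset:
  assumes H: "comm_group H" and N: "add_subgroup N" and rel: "\<And>k r. hrel H k r \<Longrightarrow> r \<in> N"
  shows "qlie_ideal H \<subseteq> N"
proof -
  let ?W = "word_ring H"
  define M where "M = generate ?W {r. \<exists>k. hrel H k r}"
  have relW: "{r. \<exists>k. hrel H k r} \<subseteq> carrier ?W"
    using keys_hrel[OF H] by (force simp: homogeneous_words_def)
  have M: "add_subgroup M" and MW: "M \<subseteq> carrier ?W"
    using generate_frag[OF relW] by (auto simp: M_def dest: subgroup.subset)
  have hrelM: "r \<in> M" if "hrel H k r" for k r
    using that by (auto simp: M_def intro: generate.incl)
  have of_right: "word_bracket (frag_of t) y \<in> M" if "t \<in> words H" "y \<in> M" for t y
    using generate_frag_subset[OF relW add_subgroup_word_bracket_right[OF M, of "frag_of t"]]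
      hrelM hrel.right[OF that(1)] that(2) by (auto simp: M_def)
  have right: "word_bracket x y \<in> M" if x: "x \<in> carrier ?W" and y: "y \<in> M" for x y
    using x unfolding carrier_free_Abelian_group_iff
    by (rule free_Abelian_group_induct)
       (simp_all add: word_bracket_simps of_right y add_subgroup_zero[OF M] add_subgroup_diff[OF M])
  have antisym_of: "word_bracket (frag_of s) y + word_bracket y (frag_of s) \<in> M"
    if s: "s \<in> words H" and y: "Poly_Mapping.keys y \<subseteq> words H" for s y
    using y
  proof (rule free_Abelian_group_induct)
    fix y z
    assume "word_bracket (frag_of s) y + word_bracket y (frag_of s) \<in> M"
      "word_bracket (frag_of s) z + word_bracket z (frag_of s) \<in> M"
    then show "word_bracket (frag_of s) (y - z) + word_bracket (y - z) (frag_of s) \<in> M"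
      using add_subgroup_diff[OF M] by (fastforce simp: word_bracket_simps algebra_simps)
  next
    show "word_bracket (frag_of s) (frag_of t) + word_bracket (frag_of t) (frag_of s) \<in> M"
      if "t \<in> words H" for t
      using hrelM[OF hrel.antisym[OF s that]] by simp
  qed (simp add: word_bracket_simps add_subgroup_zero[OF M])
  have anti: "word_bracket x y + word_bracket y x \<in> M"
    if x: "x \<in> carrier ?W" and y: "y \<in> carrier ?W" for x y
    using x unfolding carrier_free_Abelian_group_iff
  proof (rule free_Abelian_group_induct)
    fix x z
    assume "word_bracket x y + word_bracket y x \<in> M" "word_bracket z y + word_bracket y z \<in> M"
    then show "word_bracket (x - z) y + word_bracket y (x - z) \<in> M"
      using add_subgroup_diff[OF M] by (fastforce simp: word_bracket_simps algebra_simps)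
  qed (use y antisym_of in \<open>auto simp: word_bracket_simps add_subgroup_zero[OF M]\<close>)
  define J :: "('a rtree \<Rightarrow>\<^sub>0 int) \<Rightarrow> _ \<Rightarrow> _ \<Rightarrow> _" where
    "J x y z = word_bracket (word_bracket x y) z + word_bracket (word_bracket y z) x
      + word_bracket (word_bracket z x) y" for x y z
  have J_diff: "J (x - x') y z = J x y z - J x' y z" "J x (y - y') z = J x y z - J x y' z"
    "J x y (z - z') = J x y z - J x y z'" for x x' y y' z z'
    by (simp_all add: J_def word_bracket_simps algebra_simps)
  have J_zero: "J 0 y z = 0" "J x 0 z = 0" "J x y 0 = 0" for x y z
    by (simp_all add: J_def word_bracket_simps)
  have J_of: "J (frag_of s) (frag_of t) (frag_of u) \<in> M"
    if "s \<in> words H" "t \<in> words H" "u \<in> words H" for s t u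
    using hrelM[OF hrel.jacobi[OF that]] by (simp add: J_def)
  have J1: "J (frag_of s) (frag_of t) z \<in> M"
    if "s \<in> words H" "t \<in> words H" "Poly_Mapping.keys z \<subseteq> words H" for s t z
    using that(3)
    by (rule free_Abelian_group_induct)
       (simp_all add: J_diff J_zero J_of that add_subgroup_zero[OF M] add_subgroup_diff[OF M])
  have J2: "J (frag_of s) y z \<in> M"
    if "s \<in> words H" "Poly_Mapping.keys y \<subseteq> words H" "Poly_Mapping.keys z \<subseteq> words H" for s y z
    using that(2)
    by (rule free_Abelian_group_induct)
       (simp_all add: J_diff J_zero J1 that add_subgroup_zero[OF M] add_subgroup_diff[OF M])
  have J3: "J x y z \<in> M"
    if "Poly_Mapping.keys x \<subseteq> words H" "Poly_Mapping.keys y \<subseteq> words H" "Poly_Mapping.keys z \<subseteq> words H"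
    for x y z
    using that(1)
    by (rule free_Abelian_group_induct)
       (simp_all add: J_diff J_zero J2 that add_subgroup_zero[OF M] add_subgroup_diff[OF M])
  have "qlie_ideal H \<subseteq> M"
  proof
    fix x assume "x \<in> qlie_ideal H"
    then show "x \<in> M"
    proof induction
      case (additive a b)
      then show ?case by (rule hrelM[OF hrel.additive])
    next
      case (antisym x y)
      then show ?case by (rule anti)
    next
      case (jacobi x y z)
      then show ?case using J3[of x y z] by (simp add: J_def)
    next
      case (bracket_left x y)
      have "x \<in> carrier ?W"
        using bracket_left MW by blast
      then have "word_bracket x y + word_bracket y x \<in> M" "word_bracket y x \<in> M"
        using bracket_left by (simp_all add: anti right del: carrier_free_Abelian_group_iff)
      then show ?case using add_subgroup_diff[OF M] by fastforce
    next
      case (bracket_right x y)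
      then show ?case by (intro right)
    next
      case zero
      show ?case by (rule add_subgroup_zero[OF M])
    next
      case (diff x y)
      then show ?case by (intro add_subgroup_diff[OF M])
    qed
  qed
  also have "M \<subseteq> N"
    unfolding M_def by (rule generate_frag_subset[OF relW N]) (use rel in auto)
  finally show ?thesis .
qed

section \<open>Trees with two trivalent vertices\<close>

text \<open>The tree with adjacent trivalent vertices \<open>u\<close> and \<open>v\<close>, where the edge between them is followed in
  the cyclic order by the leaves \<open>p\<close>, \<open>q\<close> at \<open>u\<close> and by \<open>r\<close>, \<open>s\<close> at \<open>v\<close>.\<close>

definition H_shape :: "'h utree \<Rightarrow> nat \<Rightarrow> nat \<Rightarrow> nat \<Rightarrow> nat \<Rightarrow> nat \<Rightarrow> nat \<Rightarrow> bool" where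
  "H_shape T u v p q r s \<longleftrightarrow> distinct [u, v, p, q, r, s] \<and> verts T = {u, v, p, q, r, s} \<and>
     edges T = {{u, v}, {u, p}, {u, q}, {v, r}, {v, s}} \<and>
     cyc T u v = p \<and> cyc T u p = q \<and> cyc T u q = v \<and>
     cyc T v u = r \<and> cyc T v r = s \<and> cyc T v s = u"

lemma H_shape_swap: "H_shape T u v p q r s \<Longrightarrow> H_shape T v u r s p q"
proof -
  assume T: "H_shape T u v p q r s"
  have "{v, u, r, s, p, q} = {u, v, p, q, r, s}"
    "{{v, u}, {v, r}, {v, s}, {u, p}, {u, q}} = {{u, v}, {u, p}, {u, q}, {v, r}, {v, s}}"
    by (blast, auto)
  then show ?thesis
    using T unfolding H_shape_def by (metis distinct_length_2_or_more distinct_singleton)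
qed

lemma H_shape_nbrs:
  assumes "H_shape T u v p q r s"
  shows "nbrs T u = {v, p, q}" "nbrs T v = {u, r, s}"
    "nbrs T p = {u}" "nbrs T q = {u}" "nbrs T r = {v}" "nbrs T s = {v}"
  using assms unfolding H_shape_def nbrs_def by (simp_all add: doubleton_eq_iff) blast+

lemma H_shape_distinct: "H_shape T u v p q r s \<Longrightarrow> distinct [u, v, p, q, r, s]"
  by (simp add: H_shape_def)

lemma H_shape_card_nbrs:
  assumes "H_shape T u v p q r s"
  shows "card (nbrs T u) = 3" "card (nbrs T v) = 3"
    "card (nbrs T p) = 1" "card (nbrs T q) = 1" "card (nbrs T r) = 1" "card (nbrs T s) = 1"
  using H_shape_distinct[OF assms] unfolding H_shape_nbrs[OF assms] by simp_all

lemma H_shape_vertices: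
  assumes "H_shape T u v p q r s"
  shows "univalent T = {p, q, r, s}" "trivalent T = {u, v}"
proof -
  note c = H_shape_card_nbrs[OF assms]
  have verts: "w \<in> verts T \<longleftrightarrow> w = u \<or> w = v \<or> w = p \<or> w = q \<or> w = r \<or> w = s" for w
    using assms by (simp add: H_shape_def)

  have 1: "w \<noteq> u" "w \<noteq> v" if w: "w \<in> univalent T" for w
  proof -
    have "card (nbrs T w) = 1" using w unfolding univalent_def by blast
    then have "card (nbrs T w) \<noteq> 3" by linarith
    then show "w \<noteq> u" "w \<noteq> v" using c(1,2) by blast+
  qed
  have 2: "w \<noteq> p" "w \<noteq> q" "w \<noteq> r" "w \<noteq> s" if w: "w \<in> trivalent T" for w
  proof -
    have "card (nbrs T w) = 3" using w unfolding trivalent_def by blast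
    then have "card (nbrs T w) \<noteq> 1" by linarith
    then show "w \<noteq> p" "w \<noteq> q" "w \<noteq> r" "w \<noteq> s" using c by blast+
  qed
  have 3: "p \<in> univalent T" "q \<in> univalent T" "r \<in> univalent T" "s \<in> univalent T"
    "u \<in> trivalent T" "v \<in> trivalent T"
    using c verts unfolding univalent_def trivalent_def by blast+
  have sub: "univalent T \<subseteq> verts T" "trivalent T \<subseteq> verts T"
    unfolding univalent_def trivalent_def by blast+
  show "univalent T = {p, q, r, s}"
    using 1 3 sub(1) verts by blast
  show "trivalent T = {u, v}"
    using 2 3 sub(2) verts by blast
qed

subsection \<open>Rooted trees\<close>

lemma branch_unique: "branch T p q t \<Longrightarrow> branch T p q t' \<Longrightarrow> t = t'"
proof (induction arbitrary: t' rule: branch.induct)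
  case (1 p q)
  from 1(3) show ?case
    by cases (use 1(2) in \<open>auto simp: univalent_def trivalent_def\<close>)
next
  case (2 p q s t)
  from 2(7) show ?case
  proof cases
    case 1
    then show ?thesis
      using 2(2) by (simp add: univalent_def trivalent_def)
  next
    case (2 s' t'')
    then show ?thesis
      using "2.IH" by metis
  qed
qed

lemma H_shape_branches:
  assumes T: "H_shape T u v p q r s"
  shows "branch T u p (Leaf (lab T p))" "branch T u q (Leaf (lab T q))"
    "branch T v u (Node (Leaf (lab T p)) (Leaf (lab T q)))"
    "branch T p u (Node (Leaf (lab T q)) (Node (Leaf (lab T r)) (Leaf (lab T s))))"
    "branch T q u (Node (Node (Leaf (lab T r)) (Leaf (lab T s))) (Leaf (lab T p)))"
proof -
  have E: "{u, v} \<in> edges T" "{v, u} \<in> edges T" "{u, p} \<in> edges T" "{u, q} \<in> edges T"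
    "{p, u} \<in> edges T" "{q, u} \<in> edges T" "{v, r} \<in> edges T" "{v, s} \<in> edges T"
    using T by (simp_all add: H_shape_def insert_commute)
  have cyc: "cyc T u v = p" "cyc T u p = q" "cyc T u q = v" "cyc T v u = r" "cyc T v r = s"
    using T by (simp_all add: H_shape_def)
  have tri: "u \<in> trivalent T" "v \<in> trivalent T"
    and uni: "p \<in> univalent T" "q \<in> univalent T" "r \<in> univalent T" "s \<in> univalent T"
    by (simp_all add: H_shape_vertices[OF T])
  show p: "branch T u p (Leaf (lab T p))" and q: "branch T u q (Leaf (lab T q))"
    by (rule branch.intros(1)[OF E(3) uni(1)], rule branch.intros(1)[OF E(4) uni(2)])
  have r: "branch T v r (Leaf (lab T r))" and s: "branch T v s (Leaf (lab T s))"
    by (rule branch.intros(1)[OF E(7) uni(3)], rule branch.intros(1)[OF E(8) uni(4)])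
  show "branch T v u (Node (Leaf (lab T p)) (Leaf (lab T q)))"
    using branch.intros(2)[OF E(2) tri(1)] p q by (simp add: cyc)
  have uv: "branch T u v (Node (Leaf (lab T r)) (Leaf (lab T s)))"
    using branch.intros(2)[OF E(1) tri(2)] r s by (simp add: cyc)
  show "branch T p u (Node (Leaf (lab T q)) (Node (Leaf (lab T r)) (Leaf (lab T s))))"
    using branch.intros(2)[OF E(5) tri(1)] q uv by (simp add: cyc)
  show "branch T q u (Node (Node (Leaf (lab T r)) (Leaf (lab T s))) (Leaf (lab T p)))"
    using branch.intros(2)[OF E(6) tri(1)] p uv by (simp add: cyc)
qed

lemma branch_edge: "branch T p q t \<Longrightarrow> q \<in> nbrs T p"
  by (erule branch.cases) (auto simp: nbrs_def)

lemma rooted_atI: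
  assumes "nbrs T r = {q}" "branch T r q t"
  shows "rooted_at T r = t"
  unfolding rooted_at_def
proof (rule the_equality)
  show "\<exists>q. branch T r q t"
    using assms by blast
  fix t' assume "\<exists>q. branch T r q t'"
  then obtain q' where q': "branch T r q' t'" ..
  then have "q' = q"
    using branch_edge[OF q'] assms by simp
  then show "t' = t"
    using branch_unique[OF assms(2)] q' by blast
qed

lemma H_shape_rooted_at:
  assumes T: "H_shape T u v p q r s"
  shows "rooted_at T p = Node (Leaf (lab T q)) (Node (Leaf (lab T r)) (Leaf (lab T s)))"
    "rooted_at T q = Node (Node (Leaf (lab T r)) (Leaf (lab T s))) (Leaf (lab T p))"
    "rooted_at T r = Node (Leaf (lab T s)) (Node (Leaf (lab T p)) (Leaf (lab T q)))"
    "rooted_at T s = Node (Node (Leaf (lab T p)) (Leaf (lab T q))) (Leaf (lab T r))"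
  by (rule rooted_atI[OF H_shape_nbrs(3)[OF T] H_shape_branches(4)[OF T]]
      rooted_atI[OF H_shape_nbrs(4)[OF T] H_shape_branches(5)[OF T]]
      rooted_atI[OF H_shape_nbrs(5)[OF T] H_shape_branches(4)[OF H_shape_swap[OF T]]]
      rooted_atI[OF H_shape_nbrs(6)[OF T] H_shape_branches(5)[OF H_shape_swap[OF T]]])+

lemma H_shape_is_W:
  assumes T: "H_shape T u v p q r s" and W: "is_W T A B C D"
  obtains u' v' p' q' r' s' where "H_shape T u' v' p' q' r' s'"
    "A = Leaf (lab T p')" "B = Leaf (lab T q')" "C = Leaf (lab T r')" "D = Leaf (lab T s')"
proof -
  obtain x y where xy: "branch T y x (Node A B)" "branch T x y (Node C D)"
    using W by (auto simp: is_W_def)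
  have "x \<in> trivalent T" "y \<in> trivalent T"
    using xy by (auto elim: branch.cases)
  moreover have "x \<noteq> y"
    using branch_edge[OF xy(1)] H_shape_nbrs(1,2)[OF T] H_shape_distinct[OF T] calculation
    unfolding H_shape_vertices[OF T] by (metis distinct.simps(2) insert_iff list.set(2) singletonD)
  ultimately consider "x = u" "y = v" | "x = v" "y = u"
    by (auto simp: H_shape_vertices[OF T])
  then obtain p' q' r' s' where S: "H_shape T x y p' q' r' s'"
    by cases (use T H_shape_swap[OF T] in auto)
  show thesis
    using branch_unique[OF xy(1) H_shape_branches(3)[OF S]]
      branch_unique[OF xy(2) H_shape_branches(3)[OF H_shape_swap[OF S]]]
    by (intro that[OF S]) auto
qed

subsection \<open>All trees with two trivalent vertices have this shape\<close>

lemma cycle_two_neighbours: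
  assumes c: "is_cycle E c" and x: "x \<in> set c"
  shows "\<exists>y z. y \<noteq> z \<and> {x, y} \<in> E \<and> {x, z} \<in> E"
proof -
  obtain i where i: "i < length c" "x = c ! i"
    using x by (auto simp: in_set_conv_nth)
  let ?n = "length c"
  have n: "3 \<le> ?n" "distinct c" and E: "\<And>i. i < ?n \<Longrightarrow> {c ! i, c ! (Suc i mod ?n)} \<in> E"
    using c by (auto simp: is_cycle_def)
  define j where "j = (if i = 0 then ?n - 1 else i - 1)"
  have j: "j < ?n" "Suc j mod ?n = i"
    using i n by (auto simp: j_def)
  have "Suc i mod ?n \<noteq> j"
    using i n by (cases "Suc i = ?n") (auto simp: j_def)
  moreover have "Suc i mod ?n < ?n"
    using i by (intro mod_less_divisor) linarith
  ultimately have "c ! (Suc i mod ?n) \<noteq> c ! j"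
    using nth_eq_iff_index_eq[OF n(2), of "Suc i mod ?n" j] j i by simp
  moreover have "{x, c ! (Suc i mod ?n)} \<in> E" "{x, c ! j} \<in> E"
    using E[OF i(1)] E[OF j(1)] i j by (simp_all add: insert_commute)
  ultimately show ?thesis by blast
qed

text \<open>Each vertex on a cycle has two neighbours, hence is trivalent; but a cycle has at least three
  vertices.\<close>

lemma H_shape_is_tree:
  assumes T: "H_shape T u v p q r s"
  shows "is_tree (verts T) (edges T)"
proof -
  note S = T[unfolded H_shape_def]
  let ?R = "{(x, y). {x, y} \<in> edges T}"
  have sym: "(y, x) \<in> ?R\<^sup>*" if "(x, y) \<in> ?R\<^sup>*" for x y
    using that by (rule symD[OF sym_rtrancl, rotated]) (auto simp: sym_def insert_commute)
  have "(u, v) \<in> ?R" "(u, p) \<in> ?R" "(u, q) \<in> ?R" "(v, r) \<in> ?R" "(v, s) \<in> ?R"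
    using S by simp_all
  then have v: "(u, v) \<in> ?R\<^sup>*" and pq: "(u, p) \<in> ?R\<^sup>*" "(u, q) \<in> ?R\<^sup>*"
    and rs: "(v, r) \<in> ?R\<^sup>*" "(v, s) \<in> ?R\<^sup>*"
    by (blast intro: r_into_rtrancl)+
  have reach: "(u, x) \<in> ?R\<^sup>*" if "x \<in> verts T" for x
  proof -
    have "x \<in> {u, v, p, q, r, s}"
      using that S by blast
    then show ?thesis
      using v pq rtrancl_trans[OF v rs(1)] rtrancl_trans[OF v rs(2)] by blast
  qed
  have "\<not> is_cycle (edges T) c" for c
  proof
    assume c: "is_cycle (edges T) c"
    have "set c \<subseteq> {u, v}"
    proof
      fix x assume "x \<in> set c"
      then obtain y z where yz: "y \<noteq> z" "y \<in> nbrs T x" "z \<in> nbrs T x"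
        using cycle_two_neighbours[OF c] by (force simp: nbrs_def)
      then have "x \<in> verts T"
        using S by (auto simp: nbrs_def doubleton_eq_iff)
      then show "x \<in> {u, v}"
        using yz S H_shape_nbrs[OF T] by auto
    qed
    then have "card (set c) \<le> card {u, v}"
      by (intro card_mono) auto
    also have "\<dots> \<le> 2"
      by (cases "u = v") auto
    finally show False
      using c distinct_card[of c] by (simp add: is_cycle_def)
  qed
  moreover have "e \<subseteq> verts T \<and> card e = 2" if "e \<in> edges T" for e
    using that S by auto
  moreover have "(x, y) \<in> ?R\<^sup>*" if "x \<in> verts T" "y \<in> verts T" for x y
    using rtrancl_trans[OF sym[OF reach[OF that(1)]] reach[OF that(2)]] .
  ultimately show ?thesis
    using S unfolding is_tree_def by simp
qed

lemma H_shape_in_utrees: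
  assumes T: "H_shape T u v p q r s" and lab: "lab T ` {p, q, r, s} \<subseteq> carrier H"
  shows "T \<in> utrees H 2"
proof -
  note S = T[unfolded H_shape_def]
  have "bij_betw (cyc T u) {v, p, q} {v, p, q}" "bij_betw (cyc T v) {u, r, s} {u, r, s}"
    using S by (auto simp: bij_betw_def inj_on_def)
  moreover have "\<forall>w\<in>{v, p, q}. cyc T u w \<noteq> w" "\<forall>w\<in>{u, r, s}. cyc T v w \<noteq> w"
    using S by auto
  ultimately show ?thesis
    using S lab H_shape_is_tree[OF T] H_shape_vertices[OF T]
    by (auto simp: utrees_def H_shape_nbrs[OF T])
qed

text \<open>If \<open>f\<close> exchanged \<open>v\<close> and \<open>f v\<close>, it would fix the third element.\<close>

lemma three_cycle:
  assumes f: "bij_betw f A A" "\<forall>w\<in>A. f w \<noteq> w" and A: "card A = 3" "v \<in> A"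
  shows "A = {v, f v, f (f v)}" "f (f (f v)) = v" "distinct [v, f v, f (f v)]"
proof -
  have fA: "f x \<in> A" if "x \<in> A" for x
    using f(1) that by (auto simp: bij_betw_def)
  have inj: "f x = f y \<longleftrightarrow> x = y" if "x \<in> A" "y \<in> A" for x y
    using f(1) that by (auto simp: bij_betw_def inj_on_def)
  have finite: "finite A"
    using A(1) card.infinite by force
  have ne: "f v \<noteq> v" "f (f v) \<noteq> f v"
    using f A fA by auto
  have "f (f v) \<noteq> v"
  proof
    assume ffv: "f (f v) = v"
    have "card (A - {v, f v}) = 1"
      using A fA ne finite by (simp add: card_Diff_subset)
    then obtain x where x: "A - {v, f v} = {x}"
      by (auto simp: card_1_singleton_iff)
    then have x': "x \<in> A" "x \<noteq> v" "x \<noteq> f v"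
      by auto
    then have "f x \<noteq> f v" "f x \<noteq> f (f v)"
      using inj fA A(2) by metis+
    then have "f x \<in> A - {v, f v}"
      using fA[OF x'(1)] ffv by simp
    then have "f x = x"
      using x by simp
    then show False
      using f(2) x by blast
  qed
  with ne show d: "distinct [v, f v, f (f v)]"
    by auto
  then have "card {v, f v, f (f v)} = 3"
    by auto
  then show A_eq: "A = {v, f v, f (f v)}"
    using A fA finite by (intro card_subset_eq[symmetric]) auto
  have "f (f (f v)) \<in> A" "f (f (f v)) \<noteq> f (f v)" "f (f (f v)) \<noteq> f v"
    using fA A(2) inj[of "f (f v)" "f v"] inj[of "f (f v)" v] d by auto
  then show "f (f (f v)) = v"
    using A_eq by auto
qed

lemma connected_closed:
  assumes "\<forall>v\<in>V. \<forall>w\<in>V. (v, w) \<in> {(x, y). {x, y} \<in> E}\<^sup>*"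
    and "u \<in> C" "u \<in> V" "\<And>x y. x \<in> C \<Longrightarrow> {x, y} \<in> E \<Longrightarrow> y \<in> C"
  shows "V \<subseteq> C"
proof
  fix w assume "w \<in> V"
  then have "(u, w) \<in> {(x, y). {x, y} \<in> E}\<^sup>*"
    using assms by blast
  then show "w \<in> C"
    by (induction rule: rtrancl_induct) (use assms in auto)
qed

text \<open>The two trivalent vertices are adjacent: otherwise \<open>u\<close> and its three univalent neighbours would
  form a connected component.  No univalent vertex is adjacent to both, and by connectedness there
  are no further vertices.\<close>

lemma utrees_H_shape:
  assumes T: "T \<in> utrees H 2"
  obtains u v p q r s where "H_shape T u v p q r s" "lab T ` {p, q, r, s} \<subseteq> carrier H"
proof -
  note T' = T[unfolded utrees_def is_tree_def mem_Collect_eq]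
  have edge: "e \<subseteq> verts T" "card e = 2" if "e \<in> edges T" for e
    using T' that by blast+
  have conn: "\<forall>v\<in>verts T. \<forall>w\<in>verts T. (v, w) \<in> {(x, y). {x, y} \<in> edges T}\<^sup>*"
    using T' by blast
  have verts: "verts T = univalent T \<union> trivalent T"
    using T by (simp add: utrees_def)
  have cyc: "bij_betw (cyc T w) (nbrs T w) (nbrs T w)" "\<forall>x\<in>nbrs T w. cyc T w x \<noteq> x"
    "card (nbrs T w) = 3" if "w \<in> trivalent T" for w
    using T' that by (blast, blast, simp add: trivalent_def)
  have nbrs_sym: "y \<in> nbrs T x \<longleftrightarrow> x \<in> nbrs T y" for x y
    by (simp add: nbrs_def insert_commute)
  have nbrs_verts: "y \<in> verts T" "y \<noteq> x" if "y \<in> nbrs T x" for x y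
    using that edge[of "{x, y}"] by (auto simp: nbrs_def)
  have single: "nbrs T x = {y}" if "x \<in> univalent T" "y \<in> nbrs T x" for x y
    using that by (auto simp: univalent_def card_1_singleton_iff)
  have "card (trivalent T) = 2"
    using T' by blast
  then obtain u v where uv: "trivalent T = {u, v}" "u \<noteq> v"
    by (auto simp: card_2_iff)
  have adj: "v \<in> nbrs T u"
  proof (rule ccontr)
    assume nadj: "v \<notin> nbrs T u"
    have nb: "nbrs T w = {u}" if "w \<in> nbrs T u" for w
    proof (rule single)
      show "w \<in> univalent T"
        using that nbrs_verts[OF that] verts uv nadj by auto
      show "u \<in> nbrs T w"
        using that by (simp add: nbrs_sym)
    qed
    have "verts T \<subseteq> insert u (nbrs T u)"
    proof (rule connected_closed[OF conn])
      show "y \<in> insert u (nbrs T u)" if "x \<in> insert u (nbrs T u)" "{x, y} \<in> edges T" for x y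
        using that nb by (auto simp: nbrs_def)
      show "u \<in> verts T"
        using verts uv by simp
    qed simp
    then show False
      using verts uv nadj by auto
  qed
  define p where "p = cyc T u v"
  define q where "q = cyc T u p"
  define r where "r = cyc T v u"
  define s where "s = cyc T v r"
  have U: "nbrs T u = {v, p, q}" "cyc T u q = v" "distinct [v, p, q]"
    using three_cycle[OF cyc(1,2,3)[of u] adj] uv by (simp_all add: p_def q_def)
  have V: "nbrs T v = {u, r, s}" "cyc T v s = u" "distinct [u, r, s]"
    using three_cycle[OF cyc(1,2,3)[of v], of u] adj uv nbrs_sym[of u v]
    by (simp_all add: r_def s_def)
  have uni: "p \<in> univalent T" "q \<in> univalent T" "r \<in> univalent T" "s \<in> univalent T"
  proof -
    have leaf: "x \<in> univalent T" if "x \<in> nbrs T w" "x \<noteq> u" "x \<noteq> v" for x w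
      using nbrs_verts(1)[OF that(1)] that(2,3) verts uv(1) by blast
    have "p \<noteq> u" "q \<noteq> u" "r \<noteq> v" "s \<noteq> v"
      using nbrs_verts(2)[of _ u] nbrs_verts(2)[of _ v] U(1) V(1) by blast+
    moreover have "p \<noteq> v" "q \<noteq> v" "r \<noteq> u" "s \<noteq> u"
      using U(3) V(3) by auto
    ultimately show "p \<in> univalent T" "q \<in> univalent T" "r \<in> univalent T" "s \<in> univalent T"
      using leaf[of p u] leaf[of q u] leaf[of r v] leaf[of s v] \<open>p \<noteq> u\<close> \<open>q \<noteq> u\<close> \<open>r \<noteq> v\<close> \<open>s \<noteq> v\<close>
      unfolding U(1) V(1) by blast+
  qed
  have nb: "nbrs T p = {u}" "nbrs T q = {u}" "nbrs T r = {v}" "nbrs T s = {v}"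
  proof -
    have "p \<in> nbrs T u" "q \<in> nbrs T u" "r \<in> nbrs T v" "s \<in> nbrs T v"
      using U(1) V(1) by simp_all
    then have "u \<in> nbrs T p" "u \<in> nbrs T q" "v \<in> nbrs T r" "v \<in> nbrs T s"
      by (simp_all only: nbrs_sym[of p] nbrs_sym[of q] nbrs_sym[of r] nbrs_sym[of s])
    then show "nbrs T p = {u}" "nbrs T q = {u}" "nbrs T r = {v}" "nbrs T s = {v}"
      using single uni by blast+
  qed
  have "univalent T \<inter> trivalent T = {}"
    by (auto simp: univalent_def trivalent_def)
  then have "w \<noteq> u" "w \<noteq> v" if "w \<in> univalent T" for w
    using that uv(1) by blast+
  moreover have "x \<noteq> y" if "nbrs T x = {u}" "nbrs T y = {v}" for x y
    using that uv(2) by auto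
  ultimately have d: "distinct [u, v, p, q, r, s]"
    using U(3) V(3) uv(2) uni nb by (simp, metis)
  have vs: "verts T = {u, v, p, q, r, s}"
  proof
    show "verts T \<subseteq> {u, v, p, q, r, s}"
    proof (rule connected_closed[OF conn, of u])
      show "y \<in> {u, v, p, q, r, s}" if "x \<in> {u, v, p, q, r, s}" "{x, y} \<in> edges T" for x y
      proof -
        have "y \<in> nbrs T x"
          using that by (simp add: nbrs_def)
        then show ?thesis
          using that(1) U(1) V(1) nb by (elim insertE emptyE) (simp_all, blast+)
      qed
    qed (use verts uv in auto)
  qed (use verts uv uni in auto)
  have es: "edges T = {{u, v}, {u, p}, {u, q}, {v, r}, {v, s}}"
  proof
    show "{{u, v}, {u, p}, {u, q}, {v, r}, {v, s}} \<subseteq> edges T"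
      using U(1) V(1) by (auto simp: nbrs_def)
    show "edges T \<subseteq> {{u, v}, {u, p}, {u, q}, {v, r}, {v, s}}"
    proof
      fix e assume e: "e \<in> edges T"
      then obtain x y where xy: "e = {x, y}"
        using edge by (metis card_2_iff)
      then have "y \<in> nbrs T x" "x \<in> {u, v, p, q, r, s}"
        using e edge(1)[OF e] vs by (auto simp: nbrs_def)
      then have "x \<in> {u, v} \<or> y \<in> {u, v}"
        using nb by (elim insertE emptyE) simp_all
      then obtain z w where zw: "e = {w, z}" "w \<in> {u, v}"
        unfolding xy by (metis insert_commute)
      then have "z \<in> nbrs T w"
        using e by (simp add: nbrs_def)
      then have "w = u \<and> z \<in> {v, p, q} \<or> w = v \<and> z \<in> {u, r, s}"
        using zw(2) U(1) V(1) by blast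
      then show "e \<in> {{u, v}, {u, p}, {u, q}, {v, r}, {v, s}}"
        unfolding zw(1) by (elim disjE conjE insertE emptyE) (simp_all add: insert_commute)
    qed
  qed
  have "H_shape T u v p q r s"
    unfolding H_shape_def using d vs es U V by (simp add: p_def q_def r_def s_def)
  moreover have "lab T ` {p, q, r, s} \<subseteq> carrier H"
    using T uni by (auto simp: utrees_def)
  ultimately show thesis
    by (rule that)
qed

subsection \<open>Isomorphism, change of orientation, change of labels\<close>

text \<open>A standard representative for each isomorphism class, with the leaves numbered from 2 to 5.\<close>

definition H_tree :: "'h \<Rightarrow> 'h \<Rightarrow> 'h \<Rightarrow> 'h \<Rightarrow> 'h utree" where
  "H_tree a b c d =
     \<lparr>verts = {0, 1, 2, 3, 4, 5}, edges = {{0, 1}, {0, 2}, {0, 3}, {1, 4}, {1, 5}},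
      cyc = (\<lambda>v w. if v = 0 then (if w = 1 then 2 else if w = 2 then 3 else 1)
                   else (if w = 0 then 4 else if w = 4 then 5 else 0)),
      lab = (\<lambda>v. if v = 2 then a else if v = 3 then b else if v = 4 then c else d)\<rparr>"

lemma H_shape_H_tree: "H_shape (H_tree a b c d) 0 1 2 3 4 5"
  by (simp add: H_shape_def H_tree_def)

lemma lab_H_tree:
  "lab (H_tree a b c d) 2 = a" "lab (H_tree a b c d) 3 = b"
  "lab (H_tree a b c d) 4 = c" "lab (H_tree a b c d) 5 = d"
  by (simp_all add: H_tree_def)

lemma H_tree_in_utrees:
  assumes "a \<in> carrier H" "b \<in> carrier H" "c \<in> carrier H" "d \<in> carrier H"
  shows "H_tree a b c d \<in> utrees H 2"
  by (rule H_shape_in_utrees[OF H_shape_H_tree]) (use assms in \<open>simp add: lab_H_tree\<close>)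

lemma H_shape_utree_iso:
  assumes T: "H_shape T u v p q r s" and T': "H_shape T' u' v' p' q' r' s'"
    and lab: "lab T p = lab T' p'" "lab T q = lab T' q'" "lab T r = lab T' r'" "lab T s = lab T' s'"
  shows "utree_iso T T'"
proof -
  note S = T[unfolded H_shape_def] and S' = T'[unfolded H_shape_def]
  define f where "f = (\<lambda>x. if x = u then u' else if x = v then v' else if x = p then p'
    else if x = q then q' else if x = r then r' else s')"
  have f: "f u = u'" "f v = v'" "f p = p'" "f q = q'" "f r = r'" "f s = s'"
    using H_shape_distinct[OF T] by (auto simp: f_def)
  have "f ` verts T = verts T'"
    using S S' f by simp
  moreover have inj: "inj_on f (verts T)"
    using S S' f by (auto simp: inj_on_def)
  ultimately have "bij_betw f (verts T) (verts T')"
    by (simp add: bij_betw_def)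
  moreover have "{x, y} \<in> edges T \<longleftrightarrow> {f x, f y} \<in> edges T'" if "x \<in> verts T" "y \<in> verts T" for x y
  proof -
    have "edges T' = image f ` edges T"
      using S S' f by simp
    moreover have "inj_on (image f) (Pow (verts T))"
      using inj by (rule inj_on_image_Pow)
    moreover have "edges T \<subseteq> Pow (verts T)"
      using S by auto
    ultimately have "f ` {x, y} \<in> edges T' \<longleftrightarrow> {x, y} \<in> edges T"
      using that by (simp add: inj_on_image_mem_iff del: image_insert)
    then show ?thesis by simp
  qed
  moreover have "f (cyc T x y) = cyc T' (f x) (f y)" if "x \<in> trivalent T" "y \<in> nbrs T x" for x y
  proof -
    have "x = u \<and> y \<in> {v, p, q} \<or> x = v \<and> y \<in> {u, r, s}"
      using that by (auto simp: H_shape_nbrs[OF T] H_shape_vertices[OF T])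
    then show ?thesis
      using S S' f by (elim disjE conjE insertE emptyE) simp_all
  qed
  moreover have "lab T x = lab T' (f x)" if "x \<in> univalent T" for x
    using that lab f by (auto simp: H_shape_vertices[OF T])
  ultimately show ?thesis
    unfolding utree_iso_def by blast
qed

lemma utree_iso_H_shape:
  assumes T: "H_shape T u v p q r s" and T': "T' \<in> utrees H 2" and iso: "utree_iso T T'"
  obtains u' v' p' q' r' s' where "H_shape T' u' v' p' q' r' s'"
    "lab T' p' = lab T p" "lab T' q' = lab T q" "lab T' r' = lab T r" "lab T' s' = lab T s"
proof -
  note S = T[unfolded H_shape_def]
  obtain f where f: "bij_betw f (verts T) (verts T')"
    "\<forall>x\<in>verts T. \<forall>y\<in>verts T. {x, y} \<in> edges T \<longleftrightarrow> {f x, f y} \<in> edges T'"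
    "\<forall>x\<in>trivalent T. \<forall>y\<in>nbrs T x. f (cyc T x y) = cyc T' (f x) (f y)"
    "\<forall>x\<in>univalent T. lab T x = lab T' (f x)"
    using iso by (auto simp: utree_iso_def)
  have verts': "verts T' = f ` verts T" and inj: "inj_on f (verts T)"
    using f(1) by (auto simp: bij_betw_def)
  have verts: "verts T = {u, v, p, q, r, s}"
    using S by simp
  have d: "distinct [f u, f v, f p, f q, f r, f s]"
  proof -
    have "distinct (map f [u, v, p, q, r, s])"
      using H_shape_distinct[OF T] inj verts by (subst distinct_map) simp
    then show ?thesis by simp
  qed
  have "edges T' = image f ` edges T"
  proof
    show "edges T' \<subseteq> image f ` edges T"
    proof
      fix e assume e: "e \<in> edges T'"
      then have "e \<subseteq> verts T'" "card e = 2"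
        using T'[unfolded utrees_def is_tree_def mem_Collect_eq] by blast+
      then obtain x y where "x \<in> verts T" "y \<in> verts T" "e = {f x, f y}"
        unfolding verts' card_2_iff by auto
      then show "e \<in> image f ` edges T"
        using f(2) e by (intro image_eqI[of _ _ "{x, y}"]) auto
    qed
    show "image f ` edges T \<subseteq> edges T'"
    proof (rule image_subsetI)
      fix e assume e: "e \<in> edges T"
      then have "e \<subseteq> verts T" "card e = 2"
        using H_shape_is_tree[OF T, unfolded is_tree_def] by blast+
      then obtain x y where "x \<in> verts T" "y \<in> verts T" "e = {x, y}"
        unfolding card_2_iff by auto
      then show "f ` e \<in> edges T'"
        using f(2) e by simp
    qed
  qed
  moreover have "cyc T' (f u) (f v) = f p" "cyc T' (f u) (f p) = f q" "cyc T' (f u) (f q) = f v"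
    "cyc T' (f v) (f u) = f r" "cyc T' (f v) (f r) = f s" "cyc T' (f v) (f s) = f u"
  proof -
    have "cyc T' (f u) (f y) = f (cyc T u y)" if "y \<in> {v, p, q}" for y
      by (rule sym) (use f(3) that H_shape_nbrs(1)[OF T] H_shape_vertices(2)[OF T] in blast)
    moreover have "cyc T' (f v) (f y) = f (cyc T v y)" if "y \<in> {u, r, s}" for y
      by (rule sym) (use f(3) that H_shape_nbrs(2)[OF T] H_shape_vertices(2)[OF T] in blast)
    ultimately show "cyc T' (f u) (f v) = f p" "cyc T' (f u) (f p) = f q" "cyc T' (f u) (f q) = f v"
      "cyc T' (f v) (f u) = f r" "cyc T' (f v) (f r) = f s" "cyc T' (f v) (f s) = f u"
      using S by simp_all
  qed
  ultimately have "H_shape T' (f u) (f v) (f p) (f q) (f r) (f s)"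
    using d S verts' unfolding H_shape_def by simp
  then show thesis
    by (rule that) (use f(4) in \<open>auto simp: H_shape_vertices[OF T]\<close>)
qed

lemma H_shape_reverse_at:
  assumes "H_shape T u v p q r s"
  shows "H_shape (reverse_at u T) u v q p r s"
  using assms by (auto simp: H_shape_def reverse_at_def)

lemma lab_reverse_at [simp]: "lab (reverse_at w T) = lab T"
  by (simp add: reverse_at_def)

lemma H_shape_relabel:
  "H_shape (relabel w a T) u v p q r s \<longleftrightarrow> H_shape T u v p q r s"
  by (simp add: H_shape_def relabel_def)

lemma lab_relabel: "lab (relabel w a T) x = (if x = w then a else lab T x)"
  by (simp add: relabel_def)

section \<open>The tensor product with the cubic part\<close>

lemma add_subgroup_cong_add:
  "add_subgroup N \<Longrightarrow> x - x' \<in> N \<Longrightarrow> y - y' \<in> N \<Longrightarrow> x + y - (x' + y') \<in> N"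
  using add_subgroup_add[of N "x - x'" "y - y'"] by (simp add: algebra_simps)

text \<open>From here on the labels are fixed.  \<open>\<I>\<close>, \<open>\<K>\<close> and, later, \<open>\<N>\<close> are the relations of the quasi-Lie
  algebra, of the tensor product and of the tree group.\<close>

locale label_group = H: comm_group H for H :: "('h, 'b) monoid_scheme"
begin

lemma H: "comm_group H"
  by (rule H.comm_group_axioms)

abbreviation "cubic_part \<equiv> qlie_deg H 3"
abbreviation "\<K> \<equiv> tensor_kernel H cubic_part"
abbreviation "pairs \<equiv> carrier H \<times> carrier cubic_part"
abbreviation "\<I> \<equiv> qlie_ideal H"

interpretation L: comm_group cubic_part by (rule comm_group_qlie_deg[OF H])

lemma qlie_coset_eq_iff: "\<I> #>\<^bsub>word_ring H\<^esub> x = \<I> #>\<^bsub>word_ring H\<^esub> y \<longleftrightarrow> x - y \<in> \<I>"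
  by (rule frag_coset_eq_iff[OF subgroup_qlie_ideal[OF H]])

lemma qlie_coset_mult:
  assumes "Poly_Mapping.keys x \<subseteq> homogeneous_words H m" "Poly_Mapping.keys y \<subseteq> homogeneous_words H m"
  shows "(\<I> #>\<^bsub>word_ring H\<^esub> x) \<otimes>\<^bsub>qlie_deg H m\<^esub> (\<I> #>\<^bsub>word_ring H\<^esub> y) = \<I> #>\<^bsub>word_ring H\<^esub> (x + y)"
  using mult_frag_coset[OF subgroup_qlie_ideal[OF H] qlie_deg_quotient[OF H], of x y m] assms
    homogeneous_words_subset[OF H, of m] by blast

lemma qlie_coset_in_carrier:
  "Poly_Mapping.keys x \<subseteq> homogeneous_words H m \<Longrightarrow> \<I> #>\<^bsub>word_ring H\<^esub> x \<in> carrier (qlie_deg H m)"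
  by (auto simp: carrier_qlie_deg[OF H])

lemma tensor_relators_subset: "tensor_relators H cubic_part \<subseteq> carrier (free_Abelian_group pairs)"
proof
  fix x assume "x \<in> tensor_relators H cubic_part"
  then show "x \<in> carrier (free_Abelian_group pairs)"
    unfolding tensor_relators_def by (elim UnE CollectE exE conjE) (simp_all add: keys_diff_subset)
qed

lemma subgroup_tensor_kernel: "subgroup \<K> (free_Abelian_group pairs)"
  and add_subgroup_tensor_kernel: "add_subgroup \<K>"
  unfolding tensor_kernel_def by (rule generate_frag[OF tensor_relators_subset])+

lemma tensor_kernel_subset:
  assumes "add_subgroup N" "tensor_relators H cubic_part \<subseteq> N"
  shows "\<K> \<subseteq> N"
  unfolding tensor_kernel_def by (rule generate_frag_subset[OF tensor_relators_subset assms])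

lemma tensor_kernel_left:
  assumes "a \<in> carrier H" "a' \<in> carrier H" "l \<in> carrier cubic_part"
  shows "frag_of (a \<otimes>\<^bsub>H\<^esub> a', l) - frag_of (a, l) - frag_of (a', l) \<in> \<K>"
  unfolding tensor_kernel_def tensor_relators_def by (rule generate.incl) (use assms in blast)

lemma tensor_kernel_right:
  assumes "a \<in> carrier H" "l \<in> carrier cubic_part" "l' \<in> carrier cubic_part"
  shows "frag_of (a, l \<otimes>\<^bsub>cubic_part\<^esub> l') - frag_of (a, l) - frag_of (a, l') \<in> \<K>"
  unfolding tensor_kernel_def tensor_relators_def by (rule generate.incl) (use assms in blast)

text \<open>The two functions below represent \<open>h \<otimes> x\<close>.  The first is the generator of the tensor product given
  by the coset of \<open>x\<close> and is linear in \<open>x\<close> only modulo the tensor relations.  The second agrees with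
  it modulo these relations and is linear on the nose, which allows one to collect several terms with
  the same \<open>h\<close> into one and to apply a relation of the quasi-Lie algebra to their sum.\<close>

definition pure_rep :: "'h \<Rightarrow> ('h rtree \<Rightarrow>\<^sub>0 int) \<Rightarrow> ('h \<times> ('h rtree \<Rightarrow>\<^sub>0 int) set \<Rightarrow>\<^sub>0 int)" where
  "pure_rep h x = frag_of (h, \<I> #>\<^bsub>word_ring H\<^esub> x)"

definition lin_pure_rep :: "'h \<Rightarrow> ('h rtree \<Rightarrow>\<^sub>0 int) \<Rightarrow> ('h \<times> ('h rtree \<Rightarrow>\<^sub>0 int) set \<Rightarrow>\<^sub>0 int)" where
  "lin_pure_rep h x = frag_extend (\<lambda>t. pure_rep h (frag_of t)) x"

lemma lin_pure_rep_simps [simp]: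
  "lin_pure_rep h (frag_of t) = pure_rep h (frag_of t)" "lin_pure_rep h 0 = 0"
  "lin_pure_rep h (x + y) = lin_pure_rep h x + lin_pure_rep h y" "lin_pure_rep h (x - y) = lin_pure_rep h x - lin_pure_rep h y"
  "lin_pure_rep h (- x) = - lin_pure_rep h x"
  by (simp_all add: lin_pure_rep_def frag_extend_add frag_extend_diff frag_extend_minus)

lemma pure_rep_add:
  assumes "h \<in> carrier H" "Poly_Mapping.keys x \<subseteq> homogeneous_words H 3"
    "Poly_Mapping.keys y \<subseteq> homogeneous_words H 3"
  shows "pure_rep h (x + y) - pure_rep h x - pure_rep h y \<in> \<K>"
  unfolding pure_rep_def qlie_coset_mult[OF assms(2,3), symmetric]
  by (intro tensor_kernel_right qlie_coset_in_carrier assms)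

lemma pure_rep_mult:
  assumes "a \<in> carrier H" "b \<in> carrier H" "Poly_Mapping.keys x \<subseteq> homogeneous_words H 3"
  shows "pure_rep (a \<otimes>\<^bsub>H\<^esub> b) x - pure_rep a x - pure_rep b x \<in> \<K>"
  unfolding pure_rep_def by (intro tensor_kernel_left qlie_coset_in_carrier assms)

lemma pure_rep_zero:
  assumes "h \<in> carrier H"
  shows "pure_rep h 0 \<in> \<K>"
  using pure_rep_add[OF assms, of 0 0] add_subgroup_minus[OF add_subgroup_tensor_kernel, of "- pure_rep h 0"] by simp

lemma pure_rep_lin_pure_rep:
  assumes h: "h \<in> carrier H" and x: "Poly_Mapping.keys x \<subseteq> homogeneous_words H 3"
  shows "pure_rep h x - lin_pure_rep h x \<in> \<K>"
  using x
proof (rule free_Abelian_group_induct)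
  fix x y assume xy: "Poly_Mapping.keys x \<subseteq> homogeneous_words H 3"
    "Poly_Mapping.keys y \<subseteq> homogeneous_words H 3"
    and IH: "pure_rep h x - lin_pure_rep h x \<in> \<K>" "pure_rep h y - lin_pure_rep h y \<in> \<K>"
  have "pure_rep h x - pure_rep h (x - y) - pure_rep h y \<in> \<K>"
    using pure_rep_add[OF h keys_diff_subset[OF xy] xy(2)] by simp
  then have "(pure_rep h x - lin_pure_rep h x) - (pure_rep h y - lin_pure_rep h y) - (pure_rep h x - pure_rep h (x - y) - pure_rep h y) \<in> \<K>"
    by (rule add_subgroup_diff[OF add_subgroup_tensor_kernel
          add_subgroup_diff[OF add_subgroup_tensor_kernel IH]])
  then show "pure_rep h (x - y) - lin_pure_rep h (x - y) \<in> \<K>"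
    by (simp add: algebra_simps)
qed (use pure_rep_zero[OF h] add_subgroup_zero[OF add_subgroup_tensor_kernel] in auto)

lemma lin_pure_rep_ideal:
  assumes h: "h \<in> carrier H" and x: "x \<in> \<I>" "Poly_Mapping.keys x \<subseteq> homogeneous_words H 3"
  shows "lin_pure_rep h x \<in> \<K>"
proof -
  have "pure_rep h x = pure_rep h 0"
    using x qlie_coset_eq_iff[of x 0] unfolding pure_rep_def by (metis diff_zero)
  then show ?thesis
    using pure_rep_zero[OF h] pure_rep_lin_pure_rep[OF h x(2)]
      add_subgroup_mem_iff[OF add_subgroup_tensor_kernel] by metis
qed

lemma lin_pure_rep_hrel: "h \<in> carrier H \<Longrightarrow> hrel H 3 r \<Longrightarrow> lin_pure_rep h r \<in> \<K>"
  by (rule lin_pure_rep_ideal[OF _ hrel_in_qlie_ideal keys_hrel[OF H]])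

lemma homogeneous_Node [simp]:
  "Node s t \<in> homogeneous_words H m \<longleftrightarrow> s \<in> words H \<and> t \<in> words H \<and> num_leaves s + num_leaves t = m"
  by (auto simp: homogeneous_words_def)

section \<open>The map \<open>\<eta>'\<close> on representatives\<close>

text \<open>The value of \<open>\<eta>'\<close> on the tree with labels \<open>a\<close>, \<open>b\<close> at one end and \<open>c\<close>, \<open>d\<close> at the other.\<close>

definition eta_rep :: "'h \<Rightarrow> 'h \<Rightarrow> 'h \<Rightarrow> 'h \<Rightarrow> ('h \<times> ('h rtree \<Rightarrow>\<^sub>0 int) set \<Rightarrow>\<^sub>0 int)" where
  "eta_rep a b c d =
     pure_rep a (frag_of (Node (Leaf b) (Node (Leaf c) (Leaf d))))
   + pure_rep b (frag_of (Node (Node (Leaf c) (Leaf d)) (Leaf a)))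
   + pure_rep c (frag_of (Node (Leaf d) (Node (Leaf a) (Leaf b))))
   + pure_rep d (frag_of (Node (Node (Leaf a) (Leaf b)) (Leaf c)))"

definition eta_frag :: "'h utree \<Rightarrow> ('h \<times> ('h rtree \<Rightarrow>\<^sub>0 int) set \<Rightarrow>\<^sub>0 int)" where
  "eta_frag T = (\<Sum>i\<in>univalent T. pure_rep (lab T i) (frag_of (rooted_at T i)))"

lemma eta_frag_H_shape:
  assumes T: "H_shape T u v p q r s"
  shows "eta_frag T = eta_rep (lab T p) (lab T q) (lab T r) (lab T s)"
  using H_shape_distinct[OF T]
  by (simp add: eta_frag_def eta_rep_def H_shape_vertices[OF T] H_shape_rooted_at[OF T] add.assoc)

lemma keys_pure_rep:
  assumes "h \<in> carrier H" "Poly_Mapping.keys x \<subseteq> homogeneous_words H 3"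
  shows "Poly_Mapping.keys (pure_rep h x) \<subseteq> pairs"
  using assms qlie_coset_in_carrier by (simp add: pure_rep_def)

lemma keys_eta_rep:
  assumes "a \<in> carrier H" "b \<in> carrier H" "c \<in> carrier H" "d \<in> carrier H"
  shows "Poly_Mapping.keys (eta_rep a b c d) \<subseteq> pairs"
  unfolding eta_rep_def by (intro keys_add_subset keys_pure_rep) (use assms in auto)

text \<open>At each of the four roots, the two trees differ by reversing one bracket.\<close>

lemma eta_rep_antisym:
  assumes a: "a \<in> carrier H" and b: "b \<in> carrier H" and c: "c \<in> carrier H" and d: "d \<in> carrier H"
  shows "eta_rep a b c d + eta_rep b a c d \<in> \<K>"
proof -
  let ?z = "Node (Leaf c) (Leaf d)" and ?y = "Node (Leaf a) (Leaf b)" and ?y' = "Node (Leaf b) (Leaf a)"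
  have cd: "?z \<in> words H"
    using c d by simp
  have y: "hrel H 2 (frag_of ?y + frag_of ?y')"
    using hrel.antisym[of "Leaf a" H "Leaf b"] a b by (simp add: numeral_eq_Suc)
  have rel: "hrel H 3 (frag_of (Node (Leaf e) ?z) + frag_of (Node ?z (Leaf e)))"
    if "e \<in> carrier H" for e
    using hrel.antisym[of "Leaf e" H ?z] cd that by (simp add: numeral_eq_Suc)
  have 1: "lin_pure_rep a (frag_of (Node (Leaf b) ?z) + frag_of (Node ?z (Leaf b))) \<in> \<K>"
    "lin_pure_rep b (frag_of (Node (Leaf a) ?z) + frag_of (Node ?z (Leaf a))) \<in> \<K>"
    by (rule lin_pure_rep_hrel[OF _ rel]; fact)+
  have "word_bracket (frag_of (Leaf d)) (frag_of ?y + frag_of ?y') \<in> \<I>"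
    using hrel_in_qlie_ideal[OF y] d by (intro qlie_ideal.bracket_right) auto
  then have 2: "lin_pure_rep c (frag_of (Node (Leaf d) ?y) + frag_of (Node (Leaf d) ?y')) \<in> \<K>"
    using a b c d by (intro lin_pure_rep_ideal keys_add_subset) (auto simp: word_bracket_simps)
  have "word_bracket (frag_of ?y + frag_of ?y') (frag_of (Leaf c)) \<in> \<I>"
    using hrel_in_qlie_ideal[OF y] c by (intro qlie_ideal.bracket_left) auto
  then have 3: "lin_pure_rep d (frag_of (Node ?y (Leaf c)) + frag_of (Node ?y' (Leaf c))) \<in> \<K>"
    using a b c d by (intro lin_pure_rep_ideal keys_add_subset) (auto simp: word_bracket_simps)
  show ?thesis
    using add_subgroup_add[OF add_subgroup_tensor_kernel
        add_subgroup_add[OF add_subgroup_tensor_kernel 1] add_subgroup_add[OF add_subgroup_tensor_kernel 2 3]]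
    by (simp add: eta_rep_def algebra_simps)
qed

text \<open>Additivity in the tensor factor at the root \<open>a\<close>, and inside the brackets at the other roots.\<close>

lemma eta_rep_linear1:
  assumes a: "a \<in> carrier H" and a': "a' \<in> carrier H"
    and b: "b \<in> carrier H" and c: "c \<in> carrier H" and d: "d \<in> carrier H"
  shows "eta_rep (a \<otimes>\<^bsub>H\<^esub> a') b c d - eta_rep a b c d - eta_rep a' b c d \<in> \<K>"
proof -
  note K = add_subgroup_tensor_kernel
  define \<alpha> where "\<alpha> = frag_of (Leaf (a \<otimes>\<^bsub>H\<^esub> a')) - frag_of (Leaf a) - frag_of (Leaf a')"
  have \<alpha>: "\<alpha> \<in> \<I>" "Poly_Mapping.keys \<alpha> \<subseteq> homogeneous_words H 1"
    using hrel.additive[OF a a'] hrel_in_qlie_ideal keys_hrel[OF H] unfolding \<alpha>_def by blast+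
  let ?z = "frag_of (Node (Leaf c) (Leaf d))"
  have z: "Poly_Mapping.keys ?z \<subseteq> homogeneous_words H 2"
    using c d by simp
  have leaf: "Poly_Mapping.keys (frag_of (Leaf e)) \<subseteq> homogeneous_words H 1" if "e \<in> carrier H" for e
    using that by (simp add: homogeneous_words_def)
  have words: "x \<in> carrier (word_ring H)" if "Poly_Mapping.keys x \<subseteq> homogeneous_words H m" for x m
    using that by (auto simp: homogeneous_words_def)
  have 1: "pure_rep (a \<otimes>\<^bsub>H\<^esub> a') (frag_of (Node (Leaf b) (Node (Leaf c) (Leaf d))))
     - pure_rep a (frag_of (Node (Leaf b) (Node (Leaf c) (Leaf d))))
     - pure_rep a' (frag_of (Node (Leaf b) (Node (Leaf c) (Leaf d)))) \<in> \<K>"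
    using a a' b c d by (intro pure_rep_mult) auto
  have 2: "lin_pure_rep b (word_bracket ?z \<alpha>) \<in> \<K>"
    using lin_pure_rep_ideal[OF b qlie_ideal.bracket_right[OF words[OF z] \<alpha>(1)]]
      keys_word_bracket_homogeneous[OF z \<alpha>(2)] by (simp add: numeral_eq_Suc)
  have \<alpha>b: "word_bracket \<alpha> (frag_of (Leaf b)) \<in> \<I>"
    "Poly_Mapping.keys (word_bracket \<alpha> (frag_of (Leaf b))) \<subseteq> homogeneous_words H 2"
    using qlie_ideal.bracket_left[OF \<alpha>(1) words[OF leaf[OF b]]]
      keys_word_bracket_homogeneous[OF \<alpha>(2) leaf[OF b]] by (simp_all add: numeral_eq_Suc)
  have 3: "lin_pure_rep c (word_bracket (frag_of (Leaf d)) (word_bracket \<alpha> (frag_of (Leaf b)))) \<in> \<K>"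
    using lin_pure_rep_ideal[OF c qlie_ideal.bracket_right[OF words[OF leaf[OF d]] \<alpha>b(1)]]
      keys_word_bracket_homogeneous[OF leaf[OF d] \<alpha>b(2)] by (simp add: numeral_eq_Suc)
  have 4: "lin_pure_rep d (word_bracket (word_bracket \<alpha> (frag_of (Leaf b))) (frag_of (Leaf c))) \<in> \<K>"
    using lin_pure_rep_ideal[OF d qlie_ideal.bracket_left[OF \<alpha>b(1) words[OF leaf[OF c]]]]
      keys_word_bracket_homogeneous[OF \<alpha>b(2) leaf[OF c]] by (simp add: numeral_eq_Suc)
  show ?thesis
    using add_subgroup_add[OF K add_subgroup_add[OF K 1 2] add_subgroup_add[OF K 3 4]]
    by (simp add: eta_rep_def \<alpha>_def word_bracket_simps algebra_simps)
qed

lemma eta_rep_linear2: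
  assumes a: "a \<in> carrier H" and b: "b \<in> carrier H" and b': "b' \<in> carrier H"
    and c: "c \<in> carrier H" and d: "d \<in> carrier H"
  shows "eta_rep a (b \<otimes>\<^bsub>H\<^esub> b') c d - eta_rep a b c d - eta_rep a b' c d \<in> \<K>"
proof -
  note K = add_subgroup_tensor_kernel
  have bb: "b \<otimes>\<^bsub>H\<^esub> b' \<in> carrier H"
    using b b' by simp
  show ?thesis
    using add_subgroup_diff[OF K add_subgroup_diff[OF K add_subgroup_diff[OF K
          eta_rep_antisym[OF a bb c d] eta_rep_antisym[OF a b c d]] eta_rep_antisym[OF a b' c d]]
        eta_rep_linear1[OF b b' a c d]]
    by (simp add: algebra_simps)
qed

text \<open>Every label is the root once in each of the three trees, and the three brackets with which it is
  paired add up to zero by the Jacobi identity.\<close>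

lemma eta_rep_IHX:
  assumes a: "a \<in> carrier H" and b: "b \<in> carrier H" and c: "c \<in> carrier H" and d: "d \<in> carrier H"
  shows "eta_rep a b c d + eta_rep b c a d + eta_rep c a b d \<in> \<K>"
proof -
  note K = add_subgroup_tensor_kernel
  have jacobi: "lin_pure_rep h (frag_of (Node (Node (Leaf x) (Leaf y)) (Leaf z))
      + frag_of (Node (Node (Leaf y) (Leaf z)) (Leaf x))
      + frag_of (Node (Node (Leaf z) (Leaf x)) (Leaf y))) \<in> \<K>"
    if "h \<in> carrier H" "x \<in> carrier H" "y \<in> carrier H" "z \<in> carrier H" for h x y z
    using hrel.jacobi[of "Leaf x" H "Leaf y" "Leaf z"] that
    by (intro lin_pure_rep_hrel) (simp_all add: numeral_eq_Suc)
  have antisym: "lin_pure_rep h (frag_of (Node (Leaf x) (Node (Leaf y) (Leaf z)))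
      + frag_of (Node (Node (Leaf y) (Leaf z)) (Leaf x))) \<in> \<K>"
    if "h \<in> carrier H" "x \<in> carrier H" "y \<in> carrier H" "z \<in> carrier H" for h x y z
    using hrel.antisym[of "Leaf x" H "Node (Leaf y) (Leaf z)"] that
    by (intro lin_pure_rep_hrel) (simp_all add: numeral_eq_Suc)
  have antisym': "lin_pure_rep h (frag_of (Node (Node (Leaf x) (Leaf y)) (Leaf z))
      + frag_of (Node (Node (Leaf y) (Leaf x)) (Leaf z))) \<in> \<K>"
    if "h \<in> carrier H" "x \<in> carrier H" "y \<in> carrier H" "z \<in> carrier H" for h x y z
  proof -
    have "word_bracket (word_bracket (frag_of (Leaf x)) (frag_of (Leaf y))
        + word_bracket (frag_of (Leaf y)) (frag_of (Leaf x))) (frag_of (Leaf z)) \<in> \<I>"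
      using that by (intro qlie_ideal.bracket_left qlie_ideal.antisym) auto
    then show ?thesis
      using that by (intro lin_pure_rep_ideal keys_add_subset) (auto simp: word_bracket_simps)
  qed
  \<comment> \<open>the Jacobi identity in the shape in which three of the four roots produce it\<close>
  have J: "lin_pure_rep h (frag_of (Node (Leaf x) (Node (Leaf y) (Leaf z)))
      + frag_of (Node (Leaf z) (Node (Leaf x) (Leaf y)))
      + frag_of (Node (Node (Leaf x) (Leaf z)) (Leaf y))) \<in> \<K>"
    if "h \<in> carrier H" "x \<in> carrier H" "y \<in> carrier H" "z \<in> carrier H" for h x y z
    using add_subgroup_diff[OF K add_subgroup_add[OF K add_subgroup_add[OF K
          antisym[of h x y z] antisym[of h z x y]] antisym'[of h x z y]] jacobi[of h x y z]] that
    by (simp add: algebra_simps)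
  show ?thesis
    using add_subgroup_add[OF K add_subgroup_add[OF K add_subgroup_add[OF K
          J[OF a b c d] J[OF b c a d]] J[OF c a b d]] jacobi[OF d a b c]]
    by (simp add: eta_rep_def algebra_simps)
qed

section \<open>The relations of the tree group\<close>

definition tree_relators :: "('h utree \<Rightarrow>\<^sub>0 int) set" where
  "tree_relators = iso_relators H 2 \<union> AS_relators H 2 \<union> IHX_relators H 2 \<union> linearity_relators H 2"

abbreviation "\<N> \<equiv> generate (free_Abelian_group (utrees H 2)) tree_relators"

text \<open>By the symmetry that exchanges the two ends of the tree, the reversed vertex may be assumed to be
  the first one.\<close>

lemma reverse_at_in_utrees:
  assumes T: "T \<in> utrees H 2" "v \<in> trivalent T"
  obtains w p q r s where "H_shape T v w p q r s" "H_shape (reverse_at v T) v w q p r s"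
    "lab T ` {p, q, r, s} \<subseteq> carrier H" "reverse_at v T \<in> utrees H 2"
proof -
  obtain u w p q r s where S: "H_shape T u w p q r s" "lab T ` {p, q, r, s} \<subseteq> carrier H"
    using utrees_H_shape[OF T(1)] .
  note result = that
  have wlog: thesis if S: "H_shape T v w p q r s" "lab T ` {p, q, r, s} \<subseteq> carrier H" for w p q r s
  proof (rule result[OF S(1) H_shape_reverse_at[OF S(1)] S(2)])
    show "reverse_at v T \<in> utrees H 2"
      by (rule H_shape_in_utrees[OF H_shape_reverse_at[OF S(1)]]) (use S(2) in auto)
  qed
  have "v = u \<or> v = w"
    using T(2) by (simp add: H_shape_vertices[OF S(1)])
  then show thesis
    using wlog[of w p q r s] wlog[of u r s p q] S H_shape_swap[OF S(1)] by auto
qed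

lemma relabel_in_utrees:
  assumes T: "T \<in> utrees H 2" and a: "a \<in> carrier H"
  shows "relabel v a T \<in> utrees H 2"
proof -
  obtain u w p q r s where S: "H_shape T u w p q r s" "lab T ` {p, q, r, s} \<subseteq> carrier H"
    using utrees_H_shape[OF T] .
  show ?thesis
    by (rule H_shape_in_utrees[of _ u w p q r s]) (use S a in \<open>auto simp: H_shape_relabel lab_relabel\<close>)
qed

lemma tree_relators_subset: "tree_relators \<subseteq> carrier (free_Abelian_group (utrees H 2))"
proof
  fix x assume "x \<in> tree_relators"
  then consider "x \<in> iso_relators H 2" | "x \<in> AS_relators H 2" | "x \<in> IHX_relators H 2"
    | "x \<in> linearity_relators H 2"
    by (auto simp: tree_relators_def)
  then show "x \<in> carrier (free_Abelian_group (utrees H 2))"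
  proof cases
    case 1
    then show ?thesis
      unfolding iso_relators_def by (elim CollectE exE conjE) (simp add: keys_diff_subset)
  next
    case 2
    then obtain T v where x: "x = frag_of T + frag_of (reverse_at v T)"
      and T: "T \<in> utrees H 2" "v \<in> trivalent T"
      unfolding AS_relators_def by blast
    obtain w p q r s where "reverse_at v T \<in> utrees H 2"
      using reverse_at_in_utrees[OF T] by metis
    then show ?thesis
      using T unfolding x by (simp add: keys_add_subset)
  next
    case 3
    then show ?thesis
      unfolding IHX_relators_def by (elim CollectE exE conjE) (simp add: keys_add_subset)
  next
    case 4
    then show ?thesis
      unfolding linearity_relators_def
      by (elim CollectE exE conjE) (simp add: keys_diff_subset relabel_in_utrees)
  qed
qed

lemma subgroup_tree_relations: "subgroup \<N> (free_Abelian_group (utrees H 2))"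
  and add_subgroup_tree_relations: "add_subgroup \<N>"
  by (rule generate_frag[OF tree_relators_subset])+

lemma eta_frag_in_pairs:
  assumes "T \<in> utrees H 2"
  shows "Poly_Mapping.keys (eta_frag T) \<subseteq> pairs"
proof -
  obtain u w p q r s where S: "H_shape T u w p q r s" "lab T ` {p, q, r, s} \<subseteq> carrier H"
    using utrees_H_shape[OF assms] .
  then show ?thesis
    by (simp add: eta_frag_H_shape[OF S(1)] keys_eta_rep)
qed

lemma frag_extend_eta_frag_relators:
  assumes "x \<in> tree_relators"
  shows "frag_extend eta_frag x \<in> \<K>"
proof -
  note K = add_subgroup_tensor_kernel
  consider "x \<in> iso_relators H 2" | "x \<in> AS_relators H 2" | "x \<in> IHX_relators H 2"
    | "x \<in> linearity_relators H 2"
    using assms by (auto simp: tree_relators_def)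
  then show ?thesis
  proof cases
    case 1
    then obtain T T' where x: "x = frag_of T - frag_of T'"
      and T: "T \<in> utrees H 2" "T' \<in> utrees H 2" "utree_iso T T'"
      unfolding iso_relators_def by blast
    obtain u w p q r s where S: "H_shape T u w p q r s"
      using utrees_H_shape[OF T(1)] .
    obtain u' w' p' q' r' s' where S': "H_shape T' u' w' p' q' r' s'"
      "lab T' p' = lab T p" "lab T' q' = lab T q" "lab T' r' = lab T r" "lab T' s' = lab T s"
      using utree_iso_H_shape[OF S T(2,3)] .
    have "eta_frag T = eta_frag T'"
      using S' by (simp add: eta_frag_H_shape[OF S] eta_frag_H_shape[OF S'(1)])
    then show ?thesis
      by (simp add: x frag_extend_diff add_subgroup_zero[OF K])
  next
    case 2
    then obtain T v where x: "x = frag_of T + frag_of (reverse_at v T)"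
      and T: "T \<in> utrees H 2" "v \<in> trivalent T"
      unfolding AS_relators_def by blast
    obtain w p q r s where S: "H_shape T v w p q r s" "H_shape (reverse_at v T) v w q p r s"
        "lab T ` {p, q, r, s} \<subseteq> carrier H"
      using reverse_at_in_utrees[OF T] by metis
    show ?thesis
      using S(3) eta_rep_antisym[of "lab T p" "lab T q" "lab T r" "lab T s"]
      by (simp add: x frag_extend_add eta_frag_H_shape[OF S(1)] eta_frag_H_shape[OF S(2)])
  next
    case 3
    then obtain T\<^sub>1 T\<^sub>2 T\<^sub>3 A B C D where x: "x = frag_of T\<^sub>1 + frag_of T\<^sub>2 + frag_of T\<^sub>3"
      and T: "T\<^sub>1 \<in> utrees H 2" "T\<^sub>2 \<in> utrees H 2" "T\<^sub>3 \<in> utrees H 2"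
      and W: "is_W T\<^sub>1 A B C D" "is_W T\<^sub>2 B C A D" "is_W T\<^sub>3 C A B D"
      unfolding IHX_relators_def by blast
    have eta: "\<exists>a b c d. A = Leaf a \<and> B = Leaf b \<and> C = Leaf c \<and> D = Leaf d \<and> eta_frag T = eta_rep a b c d
        \<and> {a, b, c, d} \<subseteq> carrier H"
      if T: "T \<in> utrees H 2" "is_W T A B C D" for T A B C D
    proof -
      obtain u w p q r s where "H_shape T u w p q r s" 
        using utrees_H_shape[OF T(1)] .
      then obtain u' w' p' q' r' s' where S: "H_shape T u' w' p' q' r' s'"
        "A = Leaf (lab T p')" "B = Leaf (lab T q')" "C = Leaf (lab T r')" "D = Leaf (lab T s')"
        using H_shape_is_W[OF _ T(2)] by metis
      have "lab T ` univalent T \<subseteq> carrier H"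
        using T(1) unfolding utrees_def by blast
      then show ?thesis
        using S eta_frag_H_shape[OF S(1)] by (auto simp: H_shape_vertices[OF S(1)])
    qed
    obtain a b c d where abcd: "A = Leaf a" "B = Leaf b" "C = Leaf c" "D = Leaf d"
      "eta_frag T\<^sub>1 = eta_rep a b c d" "{a, b, c, d} \<subseteq> carrier H"
      using eta[OF T(1) W(1)] by auto
    then have "eta_frag T\<^sub>2 = eta_rep b c a d" "eta_frag T\<^sub>3 = eta_rep c a b d"
      using eta[OF T(2) W(2)] eta[OF T(3) W(3)] by auto
    then show ?thesis
      using abcd(6) eta_rep_IHX[of a b c d] by (simp add: x frag_extend_add abcd(5))
  next
    case 4
    then obtain T v a b where x: "x = frag_of (relabel v (a \<otimes>\<^bsub>H\<^esub> b) T) - frag_of (relabel v a T) - frag_of (relabel v b T)"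
      and T: "T \<in> utrees H 2" "v \<in> univalent T" and ab: "a \<in> carrier H" "b \<in> carrier H"
      unfolding linearity_relators_def by blast
    have wlog: "frag_extend eta_frag x \<in> \<K>"
      if S: "H_shape T u w p q r s" "lab T ` {p, q, r, s} \<subseteq> carrier H" and v: "v = p \<or> v = q" for u w p q r s
    proof -
      have e: "eta_frag (relabel v h T) = eta_rep (lab (relabel v h T) p) (lab (relabel v h T) q)
          (lab (relabel v h T) r) (lab (relabel v h T) s)" for h
        using S(1) by (intro eta_frag_H_shape) (simp add: H_shape_relabel)
      have d: "p \<noteq> q" "p \<noteq> r" "p \<noteq> s" "q \<noteq> r" "q \<noteq> s"
        using H_shape_distinct[OF S(1)] by auto
      from v show ?thesis
      proof
        assume v: "v = p"
        show ?thesis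
          using S(2) ab d[symmetric] eta_rep_linear1[of a b "lab T q" "lab T r" "lab T s"]
          by (simp add: x frag_extend_diff e[unfolded v] lab_relabel v)
      next
        assume v: "v = q"
        show ?thesis
          using S(2) ab d d[symmetric] eta_rep_linear2[of "lab T p" a b "lab T r" "lab T s"]
          by (simp add: x frag_extend_diff e[unfolded v] lab_relabel v)
      qed
    qed
    obtain u w p q r s where S: "H_shape T u w p q r s" "lab T ` {p, q, r, s} \<subseteq> carrier H"
      using utrees_H_shape[OF T(1)] .
    have "v = p \<or> v = q \<or> v = r \<or> v = s"
      using T(2) by (simp add: H_shape_vertices[OF S(1)])
    then show ?thesis
      using wlog[OF S] wlog[OF H_shape_swap[OF S(1)]] S(2) by auto
  qed
qed

lemma frag_extend_eta_frag_relations: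
  assumes "x \<in> \<N>"
  shows "frag_extend eta_frag x \<in> \<K>"
  using generate_frag_subset[OF tree_relators_subset
      add_subgroup_vimage_frag_extend[OF add_subgroup_tensor_kernel, of eta_frag]]
    frag_extend_eta_frag_relators assms by blast

section \<open>The bracket map on representatives\<close>

text \<open>Homomorphisms out of the tensor product are defined on generators \<open>(h, l)\<close> with \<open>l\<close> a coset.  A
  function of a word is turned into a function of \<open>l\<close> by choosing a homogeneous representative.\<close>

definition cubic_rep :: "('h rtree \<Rightarrow>\<^sub>0 int) set \<Rightarrow> ('h rtree \<Rightarrow>\<^sub>0 int)" where
  "cubic_rep l = (SOME x. Poly_Mapping.keys x \<subseteq> homogeneous_words H 3 \<and> l = \<I> #>\<^bsub>word_ring H\<^esub> x)"

lemma cubic_rep: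
  assumes "l \<in> carrier cubic_part"
  shows "Poly_Mapping.keys (cubic_rep l) \<subseteq> homogeneous_words H 3"
    and "l = \<I> #>\<^bsub>word_ring H\<^esub> cubic_rep l"
proof -
  have "\<exists>x. Poly_Mapping.keys x \<subseteq> homogeneous_words H 3 \<and> l = \<I> #>\<^bsub>word_ring H\<^esub> x"
    using assms by (auto simp: carrier_qlie_deg[OF H])
  from someI_ex[OF this] show "Poly_Mapping.keys (cubic_rep l) \<subseteq> homogeneous_words H 3"
    "l = \<I> #>\<^bsub>word_ring H\<^esub> cubic_rep l"
    by (simp_all add: cubic_rep_def)
qed

lemma cubic_rep_coset:
  assumes "Poly_Mapping.keys x \<subseteq> homogeneous_words H 3"
  shows "cubic_rep (\<I> #>\<^bsub>word_ring H\<^esub> x) - x \<in> \<I>"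
  using cubic_rep(2)[OF qlie_coset_in_carrier[OF assms]] by (metis qlie_coset_eq_iff)

lemma cubic_rep_mult:
  assumes "l \<in> carrier cubic_part" "l' \<in> carrier cubic_part"
  shows "cubic_rep (l \<otimes>\<^bsub>cubic_part\<^esub> l') - cubic_rep l - cubic_rep l' \<in> \<I>"
proof -
  have "l \<otimes>\<^bsub>cubic_part\<^esub> l' = \<I> #>\<^bsub>word_ring H\<^esub> (cubic_rep l + cubic_rep l')"
    using cubic_rep[OF assms(1)] cubic_rep[OF assms(2)] qlie_coset_mult by metis
  then show ?thesis
    using cubic_rep_coset[OF keys_add_subset[OF cubic_rep(1)[OF assms(1)] cubic_rep(1)[OF assms(2)]]]
    by (simp add: diff_diff_add)
qed

text \<open>The criterion for a function \<open>f\<close>, bilinear up to elements of \<open>N\<close>, to descend to the tensor product: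
  it has to kill the ideal, for then the chosen representatives do not matter.\<close>

lemma frag_extend_pairs_tensor_kernel:
  assumes N: "add_subgroup N"
    and left: "\<And>a b x. a \<in> carrier H \<Longrightarrow> b \<in> carrier H \<Longrightarrow> Poly_Mapping.keys x \<subseteq> homogeneous_words H 3 \<Longrightarrow>
      f (a \<otimes>\<^bsub>H\<^esub> b) x - f a x - f b x \<in> N"
    and diff: "\<And>a x y. a \<in> carrier H \<Longrightarrow> f a (x - y) = f a x - f a y"
    and ideal: "\<And>a x. a \<in> carrier H \<Longrightarrow> x \<in> \<I> \<Longrightarrow> f a x \<in> N"
    and z: "z \<in> \<K>"
  shows "frag_extend (\<lambda>(h, l). f h (cubic_rep l)) z \<in> N"
proof -
  have "x \<in> {z. frag_extend (\<lambda>(h, l). f h (cubic_rep l)) z \<in> N}"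
    if "x \<in> tensor_relators H cubic_part" for x
    using that unfolding tensor_relators_def
  proof (elim UnE CollectE exE conjE)
    fix a a' l
    assume "x = frag_of (a \<otimes>\<^bsub>H\<^esub> a', l) - frag_of (a, l) - frag_of (a', l)"
      "a \<in> carrier H" "a' \<in> carrier H" "l \<in> carrier cubic_part"
    then show "x \<in> {z. frag_extend (\<lambda>(h, l). f h (cubic_rep l)) z \<in> N}"
      using left cubic_rep(1) by (simp add: frag_extend_diff)
  next
    fix a l l'
    assume "x = frag_of (a, l \<otimes>\<^bsub>cubic_part\<^esub> l') - frag_of (a, l) - frag_of (a, l')"
      and l: "a \<in> carrier H" "l \<in> carrier cubic_part" "l' \<in> carrier cubic_part"
    then show "x \<in> {z. frag_extend (\<lambda>(h, l). f h (cubic_rep l)) z \<in> N}"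
      using ideal[OF l(1) cubic_rep_mult[OF l(2,3)]] by (simp add: frag_extend_diff diff[OF l(1)])
  qed
  then show ?thesis
    using tensor_kernel_subset[OF add_subgroup_vimage_frag_extend[OF N]] z by blast
qed

definition beta_frag :: "'h \<times> ('h rtree \<Rightarrow>\<^sub>0 int) set \<Rightarrow> ('h rtree \<Rightarrow>\<^sub>0 int)" where
  "beta_frag = (\<lambda>(h, l). word_bracket (frag_of (Leaf h)) (cubic_rep l))"

lemma frag_extend_beta_frag_pure_repsor_kernel:
  assumes "z \<in> \<K>"
  shows "frag_extend beta_frag z \<in> \<I>"
  unfolding beta_frag_def
proof (rule frag_extend_pairs_tensor_kernel[OF add_subgroup_qlie_ideal _ _ _ assms])
  fix a b and x :: "'h rtree \<Rightarrow>\<^sub>0 int"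
  assume ab: "a \<in> carrier H" "b \<in> carrier H" and x: "Poly_Mapping.keys x \<subseteq> homogeneous_words H 3"
  have "x \<in> carrier (word_ring H)"
    using x homogeneous_words_subset[OF H] by auto
  from qlie_ideal.bracket_left[OF qlie_ideal.additive[OF ab] this]
  show "word_bracket (frag_of (Leaf (a \<otimes>\<^bsub>H\<^esub> b))) x - word_bracket (frag_of (Leaf a)) x
      - word_bracket (frag_of (Leaf b)) x \<in> \<I>"
    by (simp add: word_bracket_simps)
qed (auto simp: word_bracket_simps intro: qlie_ideal.bracket_right)

lemma beta_frag_pure_rep:
  assumes h: "h \<in> carrier H" and x: "Poly_Mapping.keys x \<subseteq> homogeneous_words H 3"
  shows "frag_extend beta_frag (pure_rep h x) - word_bracket (frag_of (Leaf h)) x \<in> \<I>"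
  using qlie_ideal.bracket_right[of "frag_of (Leaf h)" H, OF _ cubic_rep_coset[OF x]] h
  by (simp add: pure_rep_def beta_frag_def word_bracket_simps)

text \<open>With \<open>y = [a, b]\<close> and \<open>z = [c, d]\<close>, the terms at the roots \<open>a\<close> and \<open>b\<close> add up to
  \<open>[y, z]\<close> by the Jacobi identity, and those at \<open>c\<close> and \<open>d\<close> to \<open>[z, y]\<close>.\<close>

lemma frag_extend_beta_frag_eta_rep:
  assumes a: "a \<in> carrier H" and b: "b \<in> carrier H" and c: "c \<in> carrier H" and d: "d \<in> carrier H"
  shows "frag_extend beta_frag (eta_rep a b c d) \<in> \<I>"
proof -
  note I = add_subgroup_qlie_ideal[of H]
  let ?y = "Node (Leaf a) (Leaf b)" and ?z = "Node (Leaf c) (Leaf d)"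
  define n where "n t u = frag_of (Node t u)" for t u :: "'h rtree"
  have anti: "n t u + n u t \<in> \<I>" if "t \<in> words H" "u \<in> words H" for t u
    using qlie_ideal.antisym[of "frag_of t" H "frag_of u"] that by (simp add: n_def)
  have half: "n (Leaf x) (Node (Leaf x') t) + n (Leaf x') (Node t (Leaf x)) - n (Node (Leaf x) (Leaf x')) t \<in> \<I>"
    if "x \<in> carrier H" "x' \<in> carrier H" "t \<in> words H" for x x' t
  proof -
    have "n (Node (Leaf x) (Leaf x')) t + n (Node (Leaf x') t) (Leaf x) + n (Node t (Leaf x)) (Leaf x') \<in> \<I>"
      using qlie_ideal.jacobi[of "frag_of (Leaf x)" H "frag_of (Leaf x')" "frag_of t"] that by (simp add: n_def)
    from add_subgroup_diff[OF I add_subgroup_add[OF I anti[of "Leaf x" "Node (Leaf x') t"]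
          anti[of "Leaf x'" "Node t (Leaf x)"]] this] that
    show ?thesis
      by (simp add: algebra_simps)
  qed
  have "n (Leaf a) (Node (Leaf b) ?z) + n (Leaf b) (Node ?z (Leaf a))
      + n (Leaf c) (Node (Leaf d) ?y) + n (Leaf d) (Node ?y (Leaf c)) \<in> \<I>"
    using add_subgroup_add[OF I add_subgroup_add[OF I half[OF a b, of ?z] half[OF c d, of ?y]] anti[of ?y ?z]]
      a b c d by (simp add: algebra_simps)
  moreover have "frag_extend beta_frag (eta_rep a b c d)
      - (n (Leaf a) (Node (Leaf b) ?z) + n (Leaf b) (Node ?z (Leaf a))
      + n (Leaf c) (Node (Leaf d) ?y) + n (Leaf d) (Node ?y (Leaf c))) \<in> \<I>"
    unfolding eta_rep_def frag_extend_add n_def word_bracket_of[symmetric]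
    by (intro add_subgroup_cong_add[OF I] beta_frag_pure_rep) (use a b c d in auto)
  ultimately show ?thesis
    using add_subgroup_mem_iff[OF I] by blast
qed

lemma frag_extend_beta_frag_eta_frag:
  assumes "Poly_Mapping.keys x \<subseteq> utrees H 2"
  shows "frag_extend beta_frag (frag_extend eta_frag x) \<in> \<I>"
  unfolding frag_extend_frag_extend
proof (rule frag_extend_mem[OF add_subgroup_qlie_ideal])
  fix T assume "T \<in> Poly_Mapping.keys x"
  then have T: "T \<in> utrees H 2"
    using assms by blast
  obtain u w p q r s where S: "H_shape T u w p q r s" "lab T ` {p, q, r, s} \<subseteq> carrier H"
    using utrees_H_shape[OF T] .
  show "frag_extend beta_frag (eta_frag T) \<in> \<I>"
    using S(2) by (simp add: eta_frag_H_shape[OF S(1)] frag_extend_beta_frag_eta_rep)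
qed

section \<open>Exactness: a section of the bracket map modulo the image of \<open>\<eta>'\<close>\<close>

text \<open>The values on words are forced: a section of \<open>h \<otimes> \<lambda> \<mapsto> [h, \<lambda>]\<close> has to send \<open>[h, \<lambda>]\<close> to \<open>h \<otimes> \<lambda>\<close>, and
  \<open>[[a, b], z] = [a, [b, z]] - [b, [a, z]]\<close> holds by antisymmetry and the Jacobi identity.  It is to
  be shown that this respects all relations of degree 4 if the image of \<open>\<eta>'\<close> is divided out.\<close>

fun quartic_split :: "'h rtree \<Rightarrow> ('h \<times> ('h rtree \<Rightarrow>\<^sub>0 int) set \<Rightarrow>\<^sub>0 int)" where
  "quartic_split (Node (Leaf h) t) = pure_rep h (frag_of t)"
| "quartic_split (Node (Node s t) (Leaf h)) = - pure_rep h (frag_of (Node s t))"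
| "quartic_split (Node (Node (Leaf a) (Leaf b)) (Node s t)) =
     pure_rep a (frag_of (Node (Leaf b) (Node s t))) - pure_rep b (frag_of (Node (Leaf a) (Node s t)))"
| "quartic_split _ = 0"

definition bracket_section :: "('h rtree \<Rightarrow>\<^sub>0 int) \<Rightarrow> ('h \<times> ('h rtree \<Rightarrow>\<^sub>0 int) set \<Rightarrow>\<^sub>0 int)" where
  "bracket_section = frag_extend (\<lambda>t. if num_leaves t = 4 then quartic_split t else 0)"

lemma bracket_section_quartic:
  assumes "Poly_Mapping.keys x \<subseteq> homogeneous_words H 4"
  shows "bracket_section x = frag_extend quartic_split x"
  unfolding bracket_section_def
  by (rule frag_extend_eq) (use assms in \<open>auto simp: homogeneous_words_def\<close>)

lemma bracket_section_leaf:
  assumes "h \<in> carrier H" "Poly_Mapping.keys x \<subseteq> homogeneous_words H 3"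
  shows "bracket_section (word_bracket (frag_of (Leaf h)) x) = lin_pure_rep h x"
proof -
  have "bracket_section (word_bracket (frag_of (Leaf h)) x) =
      frag_extend quartic_split (word_bracket (frag_of (Leaf h)) x)"
    using keys_word_bracket_homogeneous[of "frag_of (Leaf h)" H 1 x 3] assms
    by (intro bracket_section_quartic) (simp add: homogeneous_words_def)
  then show ?thesis
    by (simp add: word_bracket_def frag_extend_frag_extend lin_pure_rep_def)
qed

lemma hrel_degree_pos: "hrel H k r \<Longrightarrow> 1 \<le> k"
  by (induction rule: hrel.induct) (use num_leaves_pos in \<open>auto simp: Suc_le_eq\<close>)

lemma hrel_degree_1:
  assumes "hrel H 1 r"
  obtains a b where "a \<in> carrier H" "b \<in> carrier H"
    "r = frag_of (Leaf (a \<otimes>\<^bsub>H\<^esub> b)) - frag_of (Leaf a) - frag_of (Leaf b)"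
  using assms
proof cases
  case (antisym s t)
  then show ?thesis
    using num_leaves_pos[of s] num_leaves_pos[of t] by linarith
next
  case (jacobi s t u)
  then show ?thesis
    using num_leaves_pos[of s] num_leaves_pos[of t] num_leaves_pos[of u] by linarith
next
  case (right t k r)
  then show ?thesis
    using num_leaves_pos[of t] hrel_degree_pos[of k r] by linarith
qed (use that in blast)

lemma hrel_degree_2:
  assumes "hrel H 2 r"
  shows "(\<exists>a b. r = frag_of (Node (Leaf a) (Leaf b)) + frag_of (Node (Leaf b) (Leaf a))) \<or>
    (\<exists>a b c. a \<in> carrier H \<and> b \<in> carrier H \<and> c \<in> carrier H \<and>
      r = frag_of (Node (Leaf c) (Leaf (a \<otimes>\<^bsub>H\<^esub> b))) - frag_of (Node (Leaf c) (Leaf a)) - frag_of (Node (Leaf c) (Leaf b)))"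
  using assms
proof cases
  case (antisym s t)
  then have "num_leaves s = Suc 0" "num_leaves t = Suc 0"
    using num_leaves_pos[of s] num_leaves_pos[of t] by linarith+
  then show ?thesis
    using antisym by (auto simp: num_leaves_eq_1)
next
  case (jacobi s t u)
  then show ?thesis
    using num_leaves_pos[of s] num_leaves_pos[of t] num_leaves_pos[of u] by linarith
next
  case (right t k r')
  then have "num_leaves t = Suc 0" "k = 1"
    using num_leaves_pos[of t] hrel_degree_pos[of k r'] by linarith+
  then obtain c a b where C: "t = Leaf c" "a \<in> carrier H" "b \<in> carrier H"
    "r' = frag_of (Leaf (a \<otimes>\<^bsub>H\<^esub> b)) - frag_of (Leaf a) - frag_of (Leaf b)"
    using right hrel_degree_1[of r'] by (metis num_leaves_eq_1)
  then have "r = frag_of (Node (Leaf c) (Leaf (a \<otimes>\<^bsub>H\<^esub> b))) - frag_of (Node (Leaf c) (Leaf a))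
      - frag_of (Node (Leaf c) (Leaf b))" "c \<in> carrier H"
    using right by (simp_all add: word_bracket_simps)
  then show ?thesis
    using C(2,3) by blast
qed auto

text \<open>The subgroup \<open>M\<close> stands for the preimage of the image of \<open>\<eta>'\<close>.\<close>

context
  fixes M :: "('h \<times> ('h rtree \<Rightarrow>\<^sub>0 int) set \<Rightarrow>\<^sub>0 int) set"
  assumes M: "add_subgroup M" "\<K> \<subseteq> M"
    and eta_M: "\<And>a b c d. a \<in> carrier H \<Longrightarrow> b \<in> carrier H \<Longrightarrow> c \<in> carrier H \<Longrightarrow> d \<in> carrier H \<Longrightarrow>
      eta_rep a b c d \<in> M"
begin

text \<open>This is the only relation that makes it necessary to divide out the image of \<open>\<eta>'\<close>: for
  \<open>[[a, b], [c, d]] + [[c, d], [a, b]]\<close> the four terms of \<open>\<eta>'\<close> of the tree with labels \<open>a\<close>, \<open>b\<close>,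
  \<open>c\<close>, \<open>d\<close> remain.\<close>

lemma quartic_split_antisym:
  assumes s: "s \<in> words H" and t: "t \<in> words H" and 4: "num_leaves s + num_leaves t = 4"
  shows "quartic_split (Node s t) + quartic_split (Node t s) \<in> M"
proof -
  consider "num_leaves s = Suc 0" "num_leaves t = 3" | "num_leaves s = 2" "num_leaves t = 2"
    | "num_leaves s = 3" "num_leaves t = Suc 0"
    using 4 num_leaves_pos[of s] num_leaves_pos[of t] by linarith
  then show ?thesis
  proof cases
    case 1
    then obtain h where "s = Leaf h"
      by (auto simp: num_leaves_eq_1)
    with 1 show ?thesis
      by (cases t) (auto simp: add_subgroup_zero[OF M(1)])
  next
    case 3
    then obtain h where "t = Leaf h"
      by (auto simp: num_leaves_eq_1)
    with 3 show ?thesis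
      by (cases s) (auto simp: add_subgroup_zero[OF M(1)])
  next
    case 2
    then obtain a b c d where st: "s = Node (Leaf a) (Leaf b)" "t = Node (Leaf c) (Leaf d)"
      by (auto simp: num_leaves_eq_2)
    then have C: "a \<in> carrier H" "b \<in> carrier H" "c \<in> carrier H" "d \<in> carrier H"
      using s t by auto
    have anti: "pure_rep h (frag_of (Node (Leaf x) (Node (Leaf y) (Leaf y')))) + pure_rep h (frag_of (Node (Node (Leaf y) (Leaf y')) (Leaf x))) \<in> M"
      if "h \<in> carrier H" "x \<in> carrier H" "y \<in> carrier H" "y' \<in> carrier H" for h x y y'
    proof -
      have "hrel H 3 (frag_of (Node (Leaf x) (Node (Leaf y) (Leaf y'))) + frag_of (Node (Node (Leaf y) (Leaf y')) (Leaf x)))"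
        using hrel.antisym[of "Leaf x" H "Node (Leaf y) (Leaf y')"] that by (simp add: numeral_eq_Suc)
      from lin_pure_rep_hrel[OF that(1) this] M(2) show ?thesis
        by auto
    qed
    show ?thesis
      using add_subgroup_diff[OF M(1) add_subgroup_diff[OF M(1) eta_M[OF C] anti[OF C(2,1,3,4)]]
          anti[OF C(4,3,1,2)]]
      by (simp add: st eta_rep_def algebra_simps)
  qed
qed

text \<open>Two of the three arguments are labels \<open>a\<close>, \<open>b\<close> and the third has the form \<open>z = [c, d]\<close>.  The two
  terms with \<open>a\<close> in the left tensor factor cancel, and those with \<open>b\<close> in it cancel by antisymmetry.\<close>

lemma quartic_split_jacobi:
  assumes s: "s \<in> words H" and t: "t \<in> words H" and u: "u \<in> words H"
    and 4: "num_leaves s + num_leaves t + num_leaves u = 4"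
  shows "quartic_split (Node (Node s t) u) + quartic_split (Node (Node t u) s)
    + quartic_split (Node (Node u s) t) \<in> M"
proof -
  have main: "quartic_split (Node (Node (Leaf a) (Leaf b)) z) + quartic_split (Node (Node (Leaf b) z) (Leaf a))
    + quartic_split (Node (Node z (Leaf a)) (Leaf b)) \<in> M"
    if C: "a \<in> carrier H" "b \<in> carrier H" "z \<in> words H" and 2: "num_leaves z = 2" for a b z
  proof -
    obtain c d where z: "z = Node (Leaf c) (Leaf d)"
      using 2 by (auto simp: num_leaves_eq_2)
    have "hrel H 3 (frag_of (Node (Leaf a) z) + frag_of (Node z (Leaf a)))"
      using hrel.antisym[of "Leaf a" H z] that by (simp add: numeral_eq_Suc)
    then have "lin_pure_rep b (frag_of (Node (Leaf a) z) + frag_of (Node z (Leaf a))) \<in> M"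
      using lin_pure_rep_hrel[OF C(2)] M(2) by blast
    from add_subgroup_minus[OF M(1) this] show ?thesis
      by (simp add: z algebra_simps)
  qed
  consider "num_leaves s = Suc 0" "num_leaves t = Suc 0" "num_leaves u = 2"
    | "num_leaves s = Suc 0" "num_leaves t = 2" "num_leaves u = Suc 0"
    | "num_leaves s = 2" "num_leaves t = Suc 0" "num_leaves u = Suc 0"
    using 4 num_leaves_pos[of s] num_leaves_pos[of t] num_leaves_pos[of u] by linarith
  then show ?thesis
  proof cases
    case 1
    then obtain a b where st: "s = Leaf a" "t = Leaf b"
      by (auto simp: num_leaves_eq_1)
    show ?thesis
      using main[of a b u] s t u 1 unfolding st by simp
  next
    case 2
    then obtain a b where st: "u = Leaf a" "s = Leaf b"
      by (auto simp: num_leaves_eq_1)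
    show ?thesis
      using main[of a b t] s t u 2 unfolding st by (simp only: Leaf_in_words ac_simps)
  next
    case 3
    then obtain a b where st: "t = Leaf a" "u = Leaf b"
      by (auto simp: num_leaves_eq_1)
    show ?thesis
      using main[of a b s] s t u 3 unfolding st by (simp only: Leaf_in_words ac_simps)
  qed
qed

text \<open>If \<open>t\<close> has one or two leaves, \<open>r\<close> ends up in the right tensor factor, inside brackets; if it has
  three, \<open>r\<close> is an additivity relation in the left tensor factor.\<close>

lemma quartic_split_right:
  assumes t: "t \<in> words H" and r: "hrel H k r" and 4: "num_leaves t + k = 4"
  shows "frag_extend quartic_split (word_bracket (frag_of t) r) \<in> M"
proof -
  have expand: "frag_extend quartic_split (word_bracket (frag_of t) r)
      = frag_extend (\<lambda>s. quartic_split (Node t s)) r"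
    by (simp add: word_bracket_def frag_extend_frag_extend)
  note keys = keys_hrel[OF H r]
  consider "num_leaves t = Suc 0" "k = 3" | "num_leaves t = 2" "k = 2" | "num_leaves t = 3" "k = 1"
    using 4 num_leaves_pos[of t] hrel_degree_pos[OF r] by linarith
  then show ?thesis
  proof cases
    case 1
    then obtain h where h: "t = Leaf h"
      by (auto simp: num_leaves_eq_1)
    have "lin_pure_rep h r \<in> M"
      using lin_pure_rep_hrel[of h r] r t M(2) 1 h by auto
    then show ?thesis
      unfolding expand by (simp add: h lin_pure_rep_def)
  next
    case 2
    then obtain a b where ab: "t = Node (Leaf a) (Leaf b)"
      by (auto simp: num_leaves_eq_2)
    then have C: "a \<in> carrier H" "b \<in> carrier H"
      using t by auto
    have "frag_extend (\<lambda>s. quartic_split (Node t s)) r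
        = frag_extend (\<lambda>s. pure_rep a (frag_of (Node (Leaf b) s)) - pure_rep b (frag_of (Node (Leaf a) s))) r"
    proof (rule frag_extend_eq)
      fix s assume "s \<in> Poly_Mapping.keys r"
      then have "num_leaves s = 2"
        using keys 2 by (auto simp: homogeneous_words_def)
      then show "quartic_split (Node t s) = pure_rep a (frag_of (Node (Leaf b) s)) - pure_rep b (frag_of (Node (Leaf a) s))"
        by (auto simp: num_leaves_eq_2 ab)
    qed
    also have "\<dots> = lin_pure_rep a (word_bracket (frag_of (Leaf b)) r) - lin_pure_rep b (word_bracket (frag_of (Leaf a)) r)"
      by (simp add: lin_pure_rep_def word_bracket_def frag_extend_frag_extend frag_extend_diff_fun)
    also have "\<dots> \<in> M"
    proof (rule add_subgroup_diff[OF M(1)])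
      have "hrel H 3 (word_bracket (frag_of (Leaf x)) r)" if "x \<in> carrier H" for x
        using hrel.right[of "Leaf x" H k r] that r 2 by (simp add: numeral_eq_Suc)
      then show "lin_pure_rep a (word_bracket (frag_of (Leaf b)) r) \<in> M"
        "lin_pure_rep b (word_bracket (frag_of (Leaf a)) r) \<in> M"
        using lin_pure_rep_hrel C M(2) by blast+
    qed
    finally show ?thesis
      by (simp add: expand)
  next
    case 3
    then obtain a b where r: "a \<in> carrier H" "b \<in> carrier H"
      "r = frag_of (Leaf (a \<otimes>\<^bsub>H\<^esub> b)) - frag_of (Leaf a) - frag_of (Leaf b)"
      using hrel_degree_1 r by metis
    obtain t1 t2 where t12: "t = Node t1 t2"
      using 3 by (cases t) auto
    have "pure_rep (a \<otimes>\<^bsub>H\<^esub> b) (frag_of t) - pure_rep a (frag_of t) - pure_rep b (frag_of t) \<in> M"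
      using pure_rep_mult[OF r(1,2), of "frag_of t"] t 3 M(2) by (auto simp: homogeneous_words_def)
    from add_subgroup_minus[OF M(1) this] show ?thesis
      unfolding expand by (simp add: r(3) frag_extend_diff frag_extend_add t12 algebra_simps)
  qed
qed

lemma bracket_section_ideal:
  assumes "x \<in> \<I>"
  shows "bracket_section x \<in> M"
proof -
  have "r \<in> {x. bracket_section x \<in> M}" if r: "hrel H k r" for k r
  proof (cases "k = 4")
    case False
    have "bracket_section r = 0"
      unfolding bracket_section_def
      by (rule frag_extend_eq_0) (use keys_hrel[OF H r] False in \<open>auto simp: homogeneous_words_def\<close>)
    then show ?thesis
      by (simp add: add_subgroup_zero[OF M(1)])
  next
    case True
    have "frag_extend quartic_split r \<in> M"
      using r unfolding True
    proof cases
      case (antisym s t)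
      then show ?thesis
        using quartic_split_antisym[of s t] by (simp add: frag_extend_add)
    next
      case (jacobi s t u)
      then show ?thesis
        using quartic_split_jacobi[of s t u] by (simp add: frag_extend_add)
    next
      case (right t k r)
      then show ?thesis
        using quartic_split_right[of t k r] by simp
    qed simp
    then show ?thesis
      using bracket_section_quartic keys_hrel[OF H r] True by simp
  qed
  then show ?thesis
    using qlie_ideal_subset[OF H, of "{x. bracket_section x \<in> M}"] assms
      add_subgroup_vimage_frag_extend[OF M(1)] unfolding bracket_section_def by blast
qed

end

text \<open>Applying the section to \<open>\<beta>' z\<close> gives \<open>z\<close> back modulo the tensor relations.\<close>

lemma exactness:
  assumes z: "Poly_Mapping.keys z \<subseteq> pairs" and beta: "frag_extend beta_frag z \<in> \<I>"
  obtains x where "Poly_Mapping.keys x \<subseteq> utrees H 2" "z - frag_extend eta_frag x \<in> \<K>"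
proof -
  note K = add_subgroup_tensor_kernel
  define M where "M = {z. \<exists>x. Poly_Mapping.keys x \<subseteq> utrees H 2 \<and> z - frag_extend eta_frag x \<in> \<K>}"
  have M: "add_subgroup M"
    unfolding M_def by (rule add_subgroup_frag_extend_image[OF K])
  have KM: "\<K> \<subseteq> M"
    unfolding M_def by (auto intro!: exI[of _ 0])
  have "eta_rep a b c d \<in> M"
    if "a \<in> carrier H" "b \<in> carrier H" "c \<in> carrier H" "d \<in> carrier H" for a b c d
    unfolding M_def using H_tree_in_utrees[OF that] add_subgroup_zero[OF K]
    by (auto intro!: exI[of _ "frag_of (H_tree a b c d)"] simp: eta_frag_H_shape[OF H_shape_H_tree] lab_H_tree)
  then have "bracket_section (frag_extend beta_frag z) \<in> M"
    using bracket_section_ideal[OF M KM _ beta] by blast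
  moreover have "frag_extend frag_of z - frag_extend (\<lambda>p. bracket_section (beta_frag p)) z \<in> \<K>"
  proof (rule frag_extend_congruent[OF K])
    fix p assume "p \<in> Poly_Mapping.keys z"
    then obtain h l where p: "p = (h, l)" "h \<in> carrier H" "l \<in> carrier cubic_part"
      using z by auto
    have "frag_of p = pure_rep h (cubic_rep l)"
      using cubic_rep(2)[OF p(3)] by (simp add: pure_rep_def p(1))
    moreover have "bracket_section (beta_frag p) = lin_pure_rep h (cubic_rep l)"
      using bracket_section_leaf[OF p(2) cubic_rep(1)[OF p(3)]] by (simp add: beta_frag_def p(1))
    ultimately show "frag_of p - bracket_section (beta_frag p) \<in> \<K>"
      using pure_rep_lin_pure_rep[OF p(2) cubic_rep(1)[OF p(3)]] by simp
  qed
  then have "z - bracket_section (frag_extend beta_frag z) \<in> M"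
    using KM frag_expansion[of z] by (auto simp: bracket_section_def frag_extend_frag_extend)
  ultimately have "z \<in> M"
    using add_subgroup_mem_iff[OF M] by blast
  then show thesis
    using that by (auto simp: M_def)
qed

end

section \<open>Straightening\<close>

text \<open>A function with the symmetries of a curvature tensor (antisymmetric in the first two arguments,
  symmetric under exchange of the two pairs, first Bianchi identity) is determined by its values on
  the standard tableaux with columns \<open>(i, j)\<close> and \<open>(k, l)\<close>, that is for \<open>i < j\<close>, \<open>k < l\<close>, \<open>i \<le> k\<close>
  and \<open>j \<le> l\<close>.  Here \<open>w\<close> is arbitrary, and \<open>straight w\<close> is the function with these symmetries that
  agrees with \<open>w\<close> on standard tableaux.\<close>

context
  fixes w :: "nat \<Rightarrow> nat \<Rightarrow> nat \<Rightarrow> nat \<Rightarrow> 'a::ab_group_add"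
begin

text \<open>Two columns are either comparable, hence standard in one of the two orders, or nested.  In the
  nested case \<open>i < k < l < j\<close> the Bianchi identity expresses the value by those for the columns
  \<open>(i, l)\<close>, \<open>(k, j)\<close> and for \<open>(i, k)\<close>, \<open>(l, j)\<close>.\<close>

definition straight_cols :: "nat \<Rightarrow> nat \<Rightarrow> nat \<Rightarrow> nat \<Rightarrow> 'a" where
  "straight_cols i j k l =
    (if i \<le> k \<and> j \<le> l then w i j k l
     else if k \<le> i \<and> l \<le> j then w k l i j
     else if i < k then w i l k j - w i k l j
     else w k j i l - w k i j l)"

text \<open>The value for \<open>i = j\<close> is zero and not just of order two: the Bianchi identity for \<open>i\<close>, \<open>i\<close>, \<open>k\<close>, \<open>l\<close>
  contains two further terms, which cancel by antisymmetry.\<close>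

definition straight :: "nat \<Rightarrow> nat \<Rightarrow> nat \<Rightarrow> nat \<Rightarrow> 'a" where
  "straight i j k l =
    (if i = j \<or> k = l then 0
     else if i < j then (if k < l then straight_cols i j k l else - straight_cols i j l k)
     else (if k < l then - straight_cols j i k l else straight_cols j i l k))"

lemma straight_antisym: "straight j i k l = - straight i j k l"
  by (simp add: straight_def)

lemma straight_cols_sym: "straight_cols k l i j = straight_cols i j k l"
  by (simp add: straight_cols_def)

lemma straight_sym: "straight k l i j = straight i j k l"
  using straight_cols_sym by (simp add: straight_def)

text \<open>The left hand side is alternating in \<open>i\<close>, \<open>j\<close>, \<open>k\<close>, so these may be assumed to be sorted.\<close>

lemma straight_bianchi: "straight i j k l + straight j k i l + straight k i j l = 0"
proof -
  have sorted: "straight i j k l + straight j k i l + straight k i j l = 0"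
    if "i \<le> j" "j \<le> k" for i j k
    using that
    by (cases i l rule: linorder_cases; cases j l rule: linorder_cases; cases k l rule: linorder_cases;
        cases "i = j"; cases "j = k"; simp add: straight_def straight_cols_def)
  define B where "B i j k = straight i j k l + straight j k i l + straight k i j l" for i j k
  have cyclic: "B j k i = B i j k" for i j k
    by (simp add: B_def algebra_simps)
  have swap: "B j i k = - B i j k" for i j k
    using straight_antisym[of i j k l] straight_antisym[of j k i l] straight_antisym[of k i j l]
    by (simp add: B_def)
  have "B i j k = 0" if "i \<le> j" "j \<le> k" for i j k
    using sorted[OF that] by (simp add: B_def)
  then have "B i j k = 0"
    using cyclic swap by (metis linear neg_equal_0_iff_equal)
  then show ?thesis
    by (simp add: B_def)
qed

end

text \<open>If \<open>w\<close> itself has the symmetries modulo \<open>N\<close>, straightening does not change it modulo \<open>N\<close>.\<close>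

lemma straight_congruent:
  assumes N: "add_subgroup N"
    and as: "\<And>i j k l. {i, j, k, l} \<subseteq> S \<Longrightarrow> w i j k l + w j i k l \<in> N"
    and sym: "\<And>i j k l. {i, j, k, l} \<subseteq> S \<Longrightarrow> w k l i j - w i j k l \<in> N"
    and ihx: "\<And>i j k l. {i, j, k, l} \<subseteq> S \<Longrightarrow> w i j k l + w j k i l + w k i j l \<in> N"
    and S: "{i, j, k, l} \<subseteq> S"
  shows "straight w i j k l - w i j k l \<in> N"
proof -
  note add = add_subgroup_add[OF N] and diff = add_subgroup_diff[OF N] and minus = add_subgroup_minus[OF N]
  have as2: "w i j k l + w i j l k \<in> N" if "{i, j, k, l} \<subseteq> S" for i j k l
    using diff[OF diff[OF as[of k l i j] sym[of i j k l]] sym[of i j l k]] that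
    by (simp add: algebra_simps)
  have zero1: "w i i k l \<in> N" if "{i, k, l} \<subseteq> S" for i k l
    using diff[OF ihx[of i i k l] as[of i k i l]] that by (simp add: algebra_simps)
  have zero2: "w i j k k \<in> N" if "{i, j, k} \<subseteq> S" for i j k
    using diff[OF zero1[of k i j] sym[of i j k k]] that by simp
  have nested: "w i l k j - w i k l j - w i j k l \<in> N" if "{i, j, k, l} \<subseteq> S" for i j k l
    using add[OF diff[OF add[OF diff[OF sym[of i l j k] ihx[of i j k l]] as2[of i l k j]] as[of i k l j]]
        as2[of k i l j]] that
    by (simp add: algebra_simps)
  have cols: "straight_cols w i j k l - w i j k l \<in> N" if "{i, j, k, l} \<subseteq> S" for i j k l
  proof -
    have "w k j i l - w k i j l - w i j k l \<in> N"
      using add[OF nested[of k l i j] sym[of i j k l]] that by (simp add: algebra_simps)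
    then show ?thesis
      using that nested[of i j k l] sym[of i j k l] add_subgroup_zero[OF N]
      by (simp add: straight_cols_def)
  qed
  have 1: "- straight_cols w i j l k - w i j k l \<in> N"
    using minus[OF add[OF cols[of i j l k] as2[of i j l k]]] S by (simp add: algebra_simps minus_diff_commute)
  have 2: "- straight_cols w j i k l - w i j k l \<in> N"
    using minus[OF add[OF cols[of j i k l] as[of j i k l]]] S by (simp add: algebra_simps minus_diff_commute)
  have 3: "straight_cols w j i l k - w i j k l \<in> N"
    using diff[OF add[OF cols[of j i l k] as[of j i l k]] as2[of i j l k]] S by (simp add: algebra_simps minus_diff_commute)
  show ?thesis
  proof (cases "i = j \<or> k = l")
    case True
    then show ?thesis
      using S minus[OF zero1[of i k l]] minus[OF zero2[of i j k]] by (auto simp: straight_def)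
  next
    case False
    then show ?thesis
      using S 1 2 3 cols[of i j k l] by (simp add: straight_def)
  qed
qed

section \<open>Quadrilinear extension\<close>

definition quad_extend ::
    "('i \<Rightarrow> 'i \<Rightarrow> 'i \<Rightarrow> 'i \<Rightarrow> 'c \<Rightarrow>\<^sub>0 int) \<Rightarrow> ('i \<Rightarrow>\<^sub>0 int) \<Rightarrow> ('i \<Rightarrow>\<^sub>0 int) \<Rightarrow> ('i \<Rightarrow>\<^sub>0 int) \<Rightarrow> ('i \<Rightarrow>\<^sub>0 int)
      \<Rightarrow> 'c \<Rightarrow>\<^sub>0 int" where
  "quad_extend f x y z u =
     frag_extend (\<lambda>i. frag_extend (\<lambda>j. frag_extend (\<lambda>k. frag_extend (f i j k) u) z) y) x"

lemma quad_extend_of [simp]: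
  "quad_extend f (frag_of i) (frag_of j) (frag_of k) (frag_of l) = f i j k l"
  by (simp add: quad_extend_def)

lemma quad_extend_diff:
  "quad_extend f (x - x') y z u = quad_extend f x y z u - quad_extend f x' y z u"
  "quad_extend f x (y - y') z u = quad_extend f x y z u - quad_extend f x y' z u"
  "quad_extend f x y (z - z') u = quad_extend f x y z u - quad_extend f x y z' u"
  "quad_extend f x y z (u - u') = quad_extend f x y z u - quad_extend f x y z u'"
  by (simp_all add: quad_extend_def frag_extend_diff frag_extend_diff_fun)

lemma quad_extend_add1:
  "quad_extend f (x + x') y z u = quad_extend f x y z u + quad_extend f x' y z u"
  by (simp add: quad_extend_def frag_extend_add)

text \<open>A multilinear congruence need only be checked on basis elements.\<close>

lemma additive_mem:
  assumes N: "add_subgroup N"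
    and diff: "\<And>x x'. Poly_Mapping.keys x \<subseteq> S \<Longrightarrow> Poly_Mapping.keys x' \<subseteq> S \<Longrightarrow> Q (x - x') - (Q x - Q x') \<in> N"
    and one: "\<And>i. i \<in> S \<Longrightarrow> Q (frag_of i) \<in> N"
    and x: "Poly_Mapping.keys x \<subseteq> S"
  shows "Q x \<in> N"
  using x
proof (rule free_Abelian_group_induct)
  show "Q 0 \<in> N"
    using diff[of 0 0] by simp
  show "Q (x - y) \<in> N" if "Poly_Mapping.keys x \<subseteq> S" "Poly_Mapping.keys y \<subseteq> S" "Q x \<in> N" "Q y \<in> N" for x y
    using diff[OF that(1,2)] add_subgroup_diff[OF N that(3,4)] add_subgroup_mem_iff[OF N] by blast
qed (rule one)

lemma quad_additive_mem:
  assumes N: "add_subgroup N"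
    and diff: "\<And>x x' y z u. \<lbrakk>Poly_Mapping.keys x \<subseteq> S; Poly_Mapping.keys x' \<subseteq> S; Poly_Mapping.keys y \<subseteq> S;
        Poly_Mapping.keys z \<subseteq> S; Poly_Mapping.keys u \<subseteq> S\<rbrakk> \<Longrightarrow>
        Q (x - x') y z u - (Q x y z u - Q x' y z u) \<in> N"
      "\<And>x y y' z u. \<lbrakk>Poly_Mapping.keys x \<subseteq> S; Poly_Mapping.keys y \<subseteq> S; Poly_Mapping.keys y' \<subseteq> S;
        Poly_Mapping.keys z \<subseteq> S; Poly_Mapping.keys u \<subseteq> S\<rbrakk> \<Longrightarrow>
        Q x (y - y') z u - (Q x y z u - Q x y' z u) \<in> N"
      "\<And>x y z z' u. \<lbrakk>Poly_Mapping.keys x \<subseteq> S; Poly_Mapping.keys y \<subseteq> S; Poly_Mapping.keys z \<subseteq> S;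
        Poly_Mapping.keys z' \<subseteq> S; Poly_Mapping.keys u \<subseteq> S\<rbrakk> \<Longrightarrow>
        Q x y (z - z') u - (Q x y z u - Q x y z' u) \<in> N"
      "\<And>x y z u u'. \<lbrakk>Poly_Mapping.keys x \<subseteq> S; Poly_Mapping.keys y \<subseteq> S; Poly_Mapping.keys z \<subseteq> S;
        Poly_Mapping.keys u \<subseteq> S; Poly_Mapping.keys u' \<subseteq> S\<rbrakk> \<Longrightarrow>
        Q x y z (u - u') - (Q x y z u - Q x y z u') \<in> N"
    and one: "\<And>i j k l. {i, j, k, l} \<subseteq> S \<Longrightarrow> Q (frag_of i) (frag_of j) (frag_of k) (frag_of l) \<in> N"
    and keys: "Poly_Mapping.keys x \<subseteq> S" "Poly_Mapping.keys y \<subseteq> S" "Poly_Mapping.keys z \<subseteq> S"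
      "Poly_Mapping.keys u \<subseteq> S"
  shows "Q x y z u \<in> N"
proof -
  have of: "Poly_Mapping.keys (frag_of i) \<subseteq> S" if "i \<in> S" for i
    using that by simp
  have 1: "Q (frag_of i) (frag_of j) (frag_of k) u \<in> N"
    if "i \<in> S" "j \<in> S" "k \<in> S" "Poly_Mapping.keys u \<subseteq> S" for i j k u
    by (rule additive_mem[OF N diff(4)[OF of[OF that(1)] of[OF that(2)] of[OF that(3)]] _ that(4)])
       (use one that in auto)
  have 2: "Q (frag_of i) (frag_of j) z u \<in> N"
    if "i \<in> S" "j \<in> S" "Poly_Mapping.keys z \<subseteq> S" "Poly_Mapping.keys u \<subseteq> S" for i j z u
    by (rule additive_mem[OF N diff(3)[OF of[OF that(1)] of[OF that(2)] _ _ that(4)] _ that(3)])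
       (use 1 that in auto)
  have 3: "Q (frag_of i) y z u \<in> N"
    if "i \<in> S" "Poly_Mapping.keys y \<subseteq> S" "Poly_Mapping.keys z \<subseteq> S" "Poly_Mapping.keys u \<subseteq> S" for i y z u
    by (rule additive_mem[OF N diff(2)[OF of[OF that(1)] _ _ that(3,4)] _ that(2)])
       (use 2 that in auto)
  show ?thesis
    by (rule additive_mem[where Q = "\<lambda>x. Q x y z u", OF N diff(1)[OF _ _ keys(2,3,4)] _ keys(1)])
       (use 3 keys in auto)
qed

lemma quad_extend_straight:
  shows quad_extend_straight_antisym:
      "quad_extend (straight w) y x z u = - quad_extend (straight w) x y z u"
    and quad_extend_straight_sym:
      "quad_extend (straight w) z u x y = quad_extend (straight w) x y z u"
    and quad_extend_straight_bianchi:
      "quad_extend (straight w) x y z u + quad_extend (straight w) y z x u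
        + quad_extend (straight w) z x y u = 0"
proof -
  have N: "add_subgroup {0 :: 'b \<Rightarrow>\<^sub>0 int}"
    by (simp add: add_subgroup_def)
  note Q = quad_additive_mem[OF N, where S = UNIV]
  have as: "straight w j i k l + straight w i j k l = 0" for i j k l
    by (simp add: straight_antisym[of w j i])
  have sy: "straight w k l i j - straight w i j k l = 0" for i j k l
    by (simp add: straight_sym[of w k l])
  have bi: "straight w i j k l + (straight w j k i l + straight w k i j l) = 0" for i j k l
    using straight_bianchi[of w i j k l] by (simp add: add.assoc)
  have "quad_extend (straight w) y x z u + quad_extend (straight w) x y z u \<in> {0}"
    by (rule Q[where Q = "\<lambda>x y z u. quad_extend (straight w) y x z u + quad_extend (straight w) x y z u"])
       (simp_all add: quad_extend_diff as algebra_simps)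
  then show "quad_extend (straight w) y x z u = - quad_extend (straight w) x y z u"
    by (simp add: eq_neg_iff_add_eq_0)
  have "quad_extend (straight w) z u x y - quad_extend (straight w) x y z u \<in> {0}"
    by (rule Q[where Q = "\<lambda>x y z u. quad_extend (straight w) z u x y - quad_extend (straight w) x y z u"])
       (simp_all add: quad_extend_diff sy algebra_simps)
  then show "quad_extend (straight w) z u x y = quad_extend (straight w) x y z u"
    by simp
  have "quad_extend (straight w) x y z u + quad_extend (straight w) y z x u
        + quad_extend (straight w) z x y u \<in> {0}"
    by (rule Q[where Q = "\<lambda>x y z u. quad_extend (straight w) x y z u + quad_extend (straight w) y z x u
          + quad_extend (straight w) z x y u"])
       (simp_all add: quad_extend_diff bi algebra_simps)
  then show "quad_extend (straight w) x y z u + quad_extend (straight w) y z x u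
        + quad_extend (straight w) z x y u = 0"
    by simp
qed

context label_group
begin

section \<open>The relations between the standard trees\<close>

lemma iso_relation:
  assumes "T \<in> utrees H 2" "T' \<in> utrees H 2" "utree_iso T T'"
  shows "frag_of T - frag_of T' \<in> \<N>"
  using assms unfolding tree_relators_def iso_relators_def by (intro generate.incl) blast

lemma H_tree_antisym:
  assumes "a \<in> carrier H" "b \<in> carrier H" "c \<in> carrier H" "d \<in> carrier H"
  shows "frag_of (H_tree a b c d) + frag_of (H_tree b a c d) \<in> \<N>"
proof -
  let ?T = "H_tree a b c d"
  note S = H_shape_reverse_at[OF H_shape_H_tree[of a b c d]]
  have T: "?T \<in> utrees H 2" "0 \<in> trivalent ?T"
    using assms by (simp_all add: H_tree_in_utrees H_shape_vertices[OF H_shape_H_tree])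
  have "frag_of ?T + frag_of (reverse_at 0 ?T) \<in> \<N>"
    using T unfolding tree_relators_def AS_relators_def by (intro generate.incl) blast
  moreover have "frag_of (reverse_at 0 ?T) - frag_of (H_tree b a c d) \<in> \<N>"
  proof (rule iso_relation)
    show "reverse_at 0 ?T \<in> utrees H 2"
      by (rule H_shape_in_utrees[OF S]) (use assms in \<open>simp add: lab_H_tree\<close>)
    show "H_tree b a c d \<in> utrees H 2"
      using assms by (simp add: H_tree_in_utrees)
    show "utree_iso (reverse_at 0 ?T) (H_tree b a c d)"
      by (rule H_shape_utree_iso[OF S H_shape_H_tree]) (simp_all add: lab_H_tree)
  qed
  ultimately show ?thesis
    using add_subgroup_diff[OF add_subgroup_tree_relations] by fastforce
qed

lemma H_tree_sym:
  assumes "a \<in> carrier H" "b \<in> carrier H" "c \<in> carrier H" "d \<in> carrier H"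
  shows "frag_of (H_tree c d a b) - frag_of (H_tree a b c d) \<in> \<N>"
proof (rule iso_relation)
  show "utree_iso (H_tree c d a b) (H_tree a b c d)"
    by (rule H_shape_utree_iso[OF H_shape_swap[OF H_shape_H_tree] H_shape_H_tree]) (simp_all add: lab_H_tree)
qed (use assms in \<open>simp_all add: H_tree_in_utrees\<close>)

lemma H_tree_IHX:
  assumes "a \<in> carrier H" "b \<in> carrier H" "c \<in> carrier H" "d \<in> carrier H"
  shows "frag_of (H_tree a b c d) + frag_of (H_tree b c a d) + frag_of (H_tree c a b d) \<in> \<N>"
proof -
  have "is_W (H_tree a b c d) (Leaf a) (Leaf b) (Leaf c) (Leaf d)" for a b c d :: 'h
    using H_shape_branches(3)[OF H_shape_H_tree[of a b c d]]
      H_shape_branches(3)[OF H_shape_swap[OF H_shape_H_tree[of a b c d]]]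
    unfolding is_W_def lab_H_tree by blast
  then show ?thesis
    using H_tree_in_utrees[OF assms] H_tree_in_utrees[OF assms(2,3,1,4)] H_tree_in_utrees[OF assms(3,1,2,4)]
    unfolding tree_relators_def IHX_relators_def by (intro generate.incl) blast
qed

lemma H_tree_linear1:
  assumes "a \<in> carrier H" "a' \<in> carrier H" "b \<in> carrier H" "c \<in> carrier H" "d \<in> carrier H"
  shows "frag_of (H_tree (a \<otimes>\<^bsub>H\<^esub> a') b c d) - frag_of (H_tree a b c d) - frag_of (H_tree a' b c d) \<in> \<N>"
proof -
  have relabel: "relabel 2 h (H_tree a b c d) = H_tree h b c d" for h
    by (auto simp: relabel_def H_tree_def)
  have "H_tree a b c d \<in> utrees H 2" "2 \<in> univalent (H_tree a b c d)"
    using assms by (simp_all add: H_tree_in_utrees H_shape_vertices[OF H_shape_H_tree])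
  then have "frag_of (relabel 2 (a \<otimes>\<^bsub>H\<^esub> a') (H_tree a b c d)) - frag_of (relabel 2 a (H_tree a b c d))
      - frag_of (relabel 2 a' (H_tree a b c d)) \<in> \<N>"
    using assms(1,2) unfolding tree_relators_def linearity_relators_def by (intro generate.incl) blast
  then show ?thesis
    by (simp add: relabel)
qed

lemma H_tree_linear2:
  assumes "a \<in> carrier H" "b \<in> carrier H" "b' \<in> carrier H" "c \<in> carrier H" "d \<in> carrier H"
  shows "frag_of (H_tree a (b \<otimes>\<^bsub>H\<^esub> b') c d) - frag_of (H_tree a b c d) - frag_of (H_tree a b' c d) \<in> \<N>"
proof -
  note N = add_subgroup_tree_relations
  have bb: "b \<otimes>\<^bsub>H\<^esub> b' \<in> carrier H"
    using assms by simp
  from add_subgroup_diff[OF N add_subgroup_diff[OF N add_subgroup_diff[OF N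
          H_tree_antisym[OF assms(1) bb assms(4,5)] H_tree_antisym[OF assms(1,2,4,5)]]
          H_tree_antisym[OF assms(1,3,4,5)]] H_tree_linear1[OF assms(2,3,1,4,5)]]
  show ?thesis
    by (simp add: algebra_simps)
qed

lemma H_tree_linear3:
  assumes "a \<in> carrier H" "b \<in> carrier H" "c \<in> carrier H" "c' \<in> carrier H" "d \<in> carrier H"
  shows "frag_of (H_tree a b (c \<otimes>\<^bsub>H\<^esub> c') d) - frag_of (H_tree a b c d) - frag_of (H_tree a b c' d) \<in> \<N>"
proof -
  note N = add_subgroup_tree_relations
  have cc: "c \<otimes>\<^bsub>H\<^esub> c' \<in> carrier H"
    using assms by simp
  from add_subgroup_add[OF N add_subgroup_add[OF N add_subgroup_diff[OF N H_tree_linear1[OF assms(3,4,5,1,2)]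
          H_tree_sym[OF assms(1,2) cc assms(5)]] H_tree_sym[OF assms(1,2,3,5)]] H_tree_sym[OF assms(1,2,4,5)]]
  show ?thesis
    by (simp add: algebra_simps)
qed

lemma H_tree_linear4:
  assumes "a \<in> carrier H" "b \<in> carrier H" "c \<in> carrier H" "d \<in> carrier H" "d' \<in> carrier H"
  shows "frag_of (H_tree a b c (d \<otimes>\<^bsub>H\<^esub> d')) - frag_of (H_tree a b c d) - frag_of (H_tree a b c d') \<in> \<N>"
proof -
  note N = add_subgroup_tree_relations
  have dd: "d \<otimes>\<^bsub>H\<^esub> d' \<in> carrier H"
    using assms by simp
  from add_subgroup_add[OF N add_subgroup_add[OF N add_subgroup_diff[OF N H_tree_linear2[OF assms(3,4,5,1,2)]
          H_tree_sym[OF assms(1,2,3) dd]] H_tree_sym[OF assms(1,2,3,4)]] H_tree_sym[OF assms(1,2,3,5)]]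
  show ?thesis
    by (simp add: algebra_simps)
qed

lemma utrees_H_tree:
  assumes "T \<in> utrees H 2"
  obtains a b c d where "a \<in> carrier H" "b \<in> carrier H" "c \<in> carrier H" "d \<in> carrier H"
    "frag_of T - frag_of (H_tree a b c d) \<in> \<N>" "eta_frag T = eta_rep a b c d"
proof -
  obtain u v p q r s where S: "H_shape T u v p q r s" "lab T ` {p, q, r, s} \<subseteq> carrier H"
    using utrees_H_shape[OF assms] .
  have "utree_iso T (H_tree (lab T p) (lab T q) (lab T r) (lab T s))"
    by (rule H_shape_utree_iso[OF S(1) H_shape_H_tree]) (simp_all add: lab_H_tree)
  then show thesis
    using S(2) assms
    by (intro that[of "lab T p" "lab T q" "lab T r" "lab T s"] iso_relation eta_frag_H_shape[OF S(1)])
       (auto intro: H_tree_in_utrees)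
qed

section \<open>Functionals on the tensor product\<close>

text \<open>Attaching the label \<open>h\<close> to the root of a cubic tree turns a quadrilinear function \<open>\<nu>\<close> with the
  symmetries of the tree group into a homomorphism on the tensor product.\<close>

context
  fixes \<nu> :: "'h \<Rightarrow> 'h \<Rightarrow> 'h \<Rightarrow> 'h \<Rightarrow> 'c \<Rightarrow>\<^sub>0 int"
  assumes \<nu>_add: "\<And>a a' b c d. \<lbrakk>a \<in> carrier H; a' \<in> carrier H; b \<in> carrier H; c \<in> carrier H; d \<in> carrier H\<rbrakk>
      \<Longrightarrow> \<nu> (a \<otimes>\<^bsub>H\<^esub> a') b c d = \<nu> a b c d + \<nu> a' b c d"
    and \<nu>_antisym: "\<And>a b c d. \<nu> b a c d = - \<nu> a b c d"
    and \<nu>_sym: "\<And>a b c d. \<nu> c d a b = \<nu> a b c d"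
    and \<nu>_bianchi: "\<And>a b c d. \<nu> a b c d + \<nu> b c a d + \<nu> c a b d = 0"
begin

lemma \<nu>_antisym': "\<nu> a b d c = - \<nu> a b c d"
  using \<nu>_sym \<nu>_antisym by metis

fun cubic_eval :: "'h \<Rightarrow> 'h rtree \<Rightarrow> 'c \<Rightarrow>\<^sub>0 int" where
  "cubic_eval h (Node (Leaf b) (Node (Leaf c) (Leaf d))) = \<nu> h b c d"
| "cubic_eval h (Node (Node (Leaf c) (Leaf d)) (Leaf b)) = - \<nu> h b c d"
| "cubic_eval h _ = 0"

lemma cubic_eval_degree: "num_leaves t \<noteq> 3 \<Longrightarrow> cubic_eval h t = 0"
  by (induction h t rule: cubic_eval.induct) auto

lemma cubic_eval_antisym: "cubic_eval h (Node s t) + cubic_eval h (Node t s) = 0"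
proof -
  have "cubic_eval h (Node (Leaf b) t) = - cubic_eval h (Node t (Leaf b))" for b t
  proof (cases t)
    case (Node t1 t2)
    then show ?thesis by (cases t1; cases t2) auto
  qed auto
  then show ?thesis
    by (cases s; cases t) auto
qed

lemma \<nu>_add4:
  assumes "a \<in> carrier H" "b \<in> carrier H" "c \<in> carrier H" "d \<in> carrier H" "d' \<in> carrier H"
  shows "\<nu> a b c (d \<otimes>\<^bsub>H\<^esub> d') = \<nu> a b c d + \<nu> a b c d'"
  using \<nu>_add[of d d' c a b] assms \<nu>_sym \<nu>_antisym' by (metis minus_add_distrib)

lemma \<nu>_add2:
  assumes "a \<in> carrier H" "b \<in> carrier H" "b' \<in> carrier H" "c \<in> carrier H" "d \<in> carrier H"
  shows "\<nu> a (b \<otimes>\<^bsub>H\<^esub> b') c d = \<nu> a b c d + \<nu> a b' c d"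
  using \<nu>_add4[of c d a b b'] assms \<nu>_sym by metis

text \<open>Antisymmetry at the vertex next to the root holds by construction, at the other vertex by that of
  \<open>\<nu>\<close> in the last two arguments; the Jacobi identity corresponds to the Bianchi identity.\<close>

lemma cubic_eval_hrel:
  assumes h: "h \<in> carrier H" and r: "hrel H k r"
  shows "frag_extend (cubic_eval h) r = 0"
proof (cases "k = 3")
  case False
  then show ?thesis
    using keys_hrel[OF H r]
    by (intro frag_extend_eq_0 cubic_eval_degree) (auto simp: homogeneous_words_def)
next
  case True
  from r show ?thesis unfolding True
  proof cases
    case (antisym s t)
    then show ?thesis
      by (simp add: frag_extend_add cubic_eval_antisym)
  next
    case (jacobi s t u)
    then have "num_leaves s = Suc 0" "num_leaves t = Suc 0" "num_leaves u = Suc 0"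
      using num_leaves_pos[of s] num_leaves_pos[of t] num_leaves_pos[of u] by linarith+
    then obtain a b c where abc: "s = Leaf a" "t = Leaf b" "u = Leaf c"
      by (auto simp: num_leaves_eq_1)
    have "\<nu> h c a b = - \<nu> a b c h" "\<nu> h a b c = - \<nu> b c a h" "\<nu> h b c a = - \<nu> c a b h"
      using \<nu>_sym \<nu>_antisym' by metis+
    then show ?thesis
      using \<nu>_bianchi[of a b c h] jacobi by (simp add: abc frag_extend_add)
  next
    case (right t k r')
    have expand: "frag_extend (cubic_eval h) r = frag_extend (\<lambda>s. cubic_eval h (Node t s)) r'"
      using right by (simp add: word_bracket_def frag_extend_frag_extend)
    consider "num_leaves t = Suc 0" "k = 2" | "num_leaves t = 2" "k = 1"
      using right num_leaves_pos[of t] hrel_degree_pos[of k r'] by linarith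
    then show ?thesis
    proof cases
      case 1
      then obtain b where b: "t = Leaf b" "b \<in> carrier H"
        using right by (auto simp: num_leaves_eq_1)
      have "hrel H 2 r'"
        using right 1 by simp
      from hrel_degree_2[OF this] show ?thesis
        unfolding expand b(1)
      proof (elim disjE exE conjE)
        fix c d assume "r' = frag_of (Node (Leaf c) (Leaf d)) + frag_of (Node (Leaf d) (Leaf c))"
        then show "frag_extend (\<lambda>s. cubic_eval h (Node (Leaf b) s)) r' = 0"
          using \<nu>_antisym'[of h b d c] by (simp add: frag_extend_add)
      qed (simp add: frag_extend_diff \<nu>_add4 h b(2))
    next
      case 2
      then obtain c d where cd: "t = Node (Leaf c) (Leaf d)" "c \<in> carrier H" "d \<in> carrier H"
        using right by (auto simp: num_leaves_eq_2)
      obtain a b where ab: "a \<in> carrier H" "b \<in> carrier H"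
        "r' = frag_of (Leaf (a \<otimes>\<^bsub>H\<^esub> b)) - frag_of (Leaf a) - frag_of (Leaf b)"
        using hrel_degree_1[of r'] right 2 by metis
      show ?thesis
        unfolding expand by (simp add: cd ab frag_extend_diff \<nu>_add2 h)
    qed
  qed simp
qed

lemma cubic_eval_ideal:
  assumes "h \<in> carrier H" "x \<in> \<I>"
  shows "frag_extend (cubic_eval h) x = 0"
proof -
  have "add_subgroup {x. frag_extend (cubic_eval h) x \<in> {0}}"
    by (rule add_subgroup_vimage_frag_extend) (simp add: add_subgroup_def)
  then show ?thesis
    using qlie_ideal_subset[OF H, of "{x. frag_extend (cubic_eval h) x \<in> {0}}"] cubic_eval_hrel assms
    by blast
qed

lemma cubic_eval_mult:
  assumes "a \<in> carrier H" "b \<in> carrier H" "t \<in> words H"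
  shows "cubic_eval (a \<otimes>\<^bsub>H\<^esub> b) t = cubic_eval a t + cubic_eval b t"
  using assms by (cases "(a, t)" rule: cubic_eval.cases) (auto simp: \<nu>_add)

definition tensor_eval :: "'h \<times> ('h rtree \<Rightarrow>\<^sub>0 int) set \<Rightarrow> 'c \<Rightarrow>\<^sub>0 int" where
  "tensor_eval = (\<lambda>(h, l). frag_extend (cubic_eval h) (cubic_rep l))"

lemma tensor_eval_kernel:
  assumes "z \<in> \<K>"
  shows "frag_extend tensor_eval z = 0"
proof -
  have "frag_extend tensor_eval z \<in> {0}"
    unfolding tensor_eval_def
  proof (rule frag_extend_pairs_tensor_kernel[OF _ _ _ _ assms])
    fix a b and x :: "'h rtree \<Rightarrow>\<^sub>0 int"
    assume ab: "a \<in> carrier H" "b \<in> carrier H" and x: "Poly_Mapping.keys x \<subseteq> homogeneous_words H 3"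
    have "frag_extend (cubic_eval (a \<otimes>\<^bsub>H\<^esub> b)) x = frag_extend (\<lambda>t. cubic_eval a t + cubic_eval b t) x"
      by (rule frag_extend_eq) (use x ab in \<open>auto simp: homogeneous_words_def intro!: cubic_eval_mult\<close>)
    then show "frag_extend (cubic_eval (a \<otimes>\<^bsub>H\<^esub> b)) x - frag_extend (cubic_eval a) x
        - frag_extend (cubic_eval b) x \<in> {0}"
      by (simp add: frag_extend_add_fun)
  qed (auto simp: add_subgroup_def frag_extend_diff cubic_eval_ideal)
  then show ?thesis by simp
qed

lemma tensor_eval_pure_rep:
  assumes "h \<in> carrier H" "t \<in> homogeneous_words H 3"
  shows "frag_extend tensor_eval (pure_rep h (frag_of t)) = cubic_eval h t"
  using cubic_eval_ideal[OF assms(1) cubic_rep_coset[of "frag_of t"]] assms(2)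
  by (simp add: pure_rep_def tensor_eval_def frag_extend_diff)

text \<open>Each of the four ways to choose a root and to reattach its label gives the same tree.\<close>

lemma tensor_eval_eta_rep:
  assumes "a \<in> carrier H" "b \<in> carrier H" "c \<in> carrier H" "d \<in> carrier H"
  shows "frag_extend tensor_eval (eta_rep a b c d) = frag_cmul 4 (\<nu> a b c d)"
proof -
  have "frag_extend tensor_eval (eta_rep a b c d) = \<nu> a b c d - \<nu> b a c d + \<nu> c d a b - \<nu> d c a b"
    unfolding eta_rep_def frag_extend_add using assms by (simp add: tensor_eval_pure_rep)
  also have "\<dots> = \<nu> a b c d + \<nu> a b c d + \<nu> a b c d + \<nu> a b c d"
    using \<nu>_antisym[of b a c d] \<nu>_antisym[of d c a b] \<nu>_sym[of c d a b] by simp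
  also have "\<dots> = frag_cmul (1 + 1 + 1 + 1) (\<nu> a b c d)"
    unfolding frag_cmul_distrib by simp
  finally show ?thesis by simp
qed

end

section \<open>Injectivity\<close>

text \<open>For free \<open>H\<close> the straightened values define a homomorphism \<open>\<nu>\<close> from the tree group to a free
  abelian group, the one on all trees, such that \<open>\<nu>\<close> followed by the projection to the tree group is
  the identity.  If \<open>x\<close> is in the kernel of \<open>\<eta>'\<close>, then \<open>4 \<nu>(x) = 0\<close> by the preceding section.  This
  equation holds in a group without torsion, hence \<open>\<nu>(x) = 0\<close> and \<open>x\<close> is zero in the tree group.\<close>

lemma eta_frag_injective:
  assumes \<theta>: "\<theta> \<in> iso (free_Abelian_group (S :: nat set)) H"
    and x: "Poly_Mapping.keys x \<subseteq> utrees H 2" and eta: "frag_extend eta_frag x \<in> \<K>"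
  shows "x \<in> \<N>"
proof -
  note N = add_subgroup_tree_relations
  let ?F = "free_Abelian_group S"
  have hom: "\<theta> \<in> hom ?F H" and bij: "bij_betw \<theta> (carrier ?F) (carrier H)"
    using \<theta> by (auto simp: iso_def)
  have \<theta>C: "\<theta> y \<in> carrier H" if "Poly_Mapping.keys y \<subseteq> S" for y
    using hom that by (intro hom_in_carrier[OF hom]) simp
  have \<theta>_add: "\<theta> (y + z) = \<theta> y \<otimes>\<^bsub>H\<^esub> \<theta> z" if "Poly_Mapping.keys y \<subseteq> S" "Poly_Mapping.keys z \<subseteq> S" for y z
    using hom_mult[OF hom, of y z] that by simp
  define \<kappa> where "\<kappa> = inv_into (carrier ?F) \<theta>"
  have \<kappa>: "Poly_Mapping.keys (\<kappa> a) \<subseteq> S" "\<theta> (\<kappa> a) = a" if "a \<in> carrier H" for a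
    using bij that inv_into_into[of a \<theta> "carrier ?F"] f_inv_into_f[of a \<theta> "carrier ?F"]
    by (auto simp: \<kappa>_def bij_betw_def)
  have \<kappa>\<theta>: "\<kappa> (\<theta> y) = y" if "Poly_Mapping.keys y \<subseteq> S" for y
    using bij that by (simp add: \<kappa>_def bij_betw_def)
  have \<kappa>_mult: "\<kappa> (a \<otimes>\<^bsub>H\<^esub> b) = \<kappa> a + \<kappa> b" if "a \<in> carrier H" "b \<in> carrier H" for a b
    using \<kappa>\<theta>[of "\<kappa> a + \<kappa> b"] \<theta>_add[of "\<kappa> a" "\<kappa> b"] \<kappa>[OF that(1)] \<kappa>[OF that(2)]
    by (simp add: keys_add_subset)
  \<comment> \<open>\<open>e i\<close> is the basis of \<open>H\<close> and \<open>\<kappa>\<close> are the coordinates with respect to it\<close>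
  define e where "e i = \<theta> (frag_of i)" for i
  have e: "e i \<in> carrier H" if "i \<in> S" for i
    using \<theta>C that by (simp add: e_def)
  define w where "w i j k l = frag_of (H_tree (e i) (e j) (e k) (e l))" for i j k l
  define \<nu> where "\<nu> a b c d = quad_extend (straight w) (\<kappa> a) (\<kappa> b) (\<kappa> c) (\<kappa> d)" for a b c d
  have \<nu>_add: "\<nu> (a \<otimes>\<^bsub>H\<^esub> a') b c d = \<nu> a b c d + \<nu> a' b c d" if "a \<in> carrier H" "a' \<in> carrier H" for a a' b c d
    using that by (simp add: \<nu>_def \<kappa>_mult quad_extend_add1)
  have \<nu>_laws: "\<nu> b a c d = - \<nu> a b c d" "\<nu> c d a b = \<nu> a b c d"
    "\<nu> a b c d + \<nu> b c a d + \<nu> c a b d = 0" for a b c d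
    unfolding \<nu>_def
    by (rule quad_extend_straight_antisym, rule quad_extend_straight_sym, rule quad_extend_straight_bianchi)
  have straight_w: "w i j k l - straight w i j k l \<in> \<N>" if "{i, j, k, l} \<subseteq> S" for i j k l
  proof (rule add_subgroup_sym[OF N straight_congruent[OF N _ _ _ that]])
    fix i j k l assume "{i, j, k, l} \<subseteq> S"
    then have C: "e i \<in> carrier H" "e j \<in> carrier H" "e k \<in> carrier H" "e l \<in> carrier H"
      using e by auto
    show "w i j k l + w j i k l \<in> \<N>" "w k l i j - w i j k l \<in> \<N>" "w i j k l + w j k i l + w k i j l \<in> \<N>"
      unfolding w_def using H_tree_antisym[OF C] H_tree_sym[OF C] H_tree_IHX[OF C] by blast+
  qed
  \<comment> \<open>the tree with labels \<open>\<theta> y\<close>, \<open>\<theta> z\<close>, \<open>\<theta> u\<close>, \<open>\<theta> v\<close> is quadrilinear modulo the tree relations, so that it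
    is congruent to \<open>\<nu>\<close> because this is the case for basis elements\<close>
  define tr where "tr y z u v = frag_of (H_tree (\<theta> y) (\<theta> z) (\<theta> u) (\<theta> v))" for y z u v
  have \<theta>_diff: "\<theta> (y - z) \<otimes>\<^bsub>H\<^esub> \<theta> z = \<theta> y" "\<theta> (y - z) \<in> carrier H"
    if "Poly_Mapping.keys y \<subseteq> S" "Poly_Mapping.keys z \<subseteq> S" for y z
    using \<theta>_add[OF keys_diff_subset[OF that] that(2)] \<theta>C keys_diff_subset[OF that] by simp_all
  have linear: "p - (q - r) \<in> \<N>" if "q - p - r \<in> \<N>" for p q r :: "'h utree \<Rightarrow>\<^sub>0 int"
    using add_subgroup_minus[OF N that] by (simp add: algebra_simps)
  have tr_diff: "tr (y - y') z u v - (tr y z u v - tr y' z u v) \<in> \<N>"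
    "tr z (y - y') u v - (tr z y u v - tr z y' u v) \<in> \<N>"
    "tr z u (y - y') v - (tr z u y v - tr z u y' v) \<in> \<N>"
    "tr z u v (y - y') - (tr z u v y - tr z u v y') \<in> \<N>"
    if "Poly_Mapping.keys y \<subseteq> S" "Poly_Mapping.keys y' \<subseteq> S" "Poly_Mapping.keys z \<subseteq> S"
      "Poly_Mapping.keys u \<subseteq> S" "Poly_Mapping.keys v \<subseteq> S" for y y' z u v
    unfolding tr_def
    using H_tree_linear1[OF \<theta>_diff(2)[OF that(1,2)] \<theta>C[OF that(2)] \<theta>C[OF that(3)] \<theta>C[OF that(4)] \<theta>C[OF that(5)]]
      H_tree_linear2[OF \<theta>C[OF that(3)] \<theta>_diff(2)[OF that(1,2)] \<theta>C[OF that(2)] \<theta>C[OF that(4)] \<theta>C[OF that(5)]]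
      H_tree_linear3[OF \<theta>C[OF that(3)] \<theta>C[OF that(4)] \<theta>_diff(2)[OF that(1,2)] \<theta>C[OF that(2)] \<theta>C[OF that(5)]]
      H_tree_linear4[OF \<theta>C[OF that(3)] \<theta>C[OF that(4)] \<theta>C[OF that(5)] \<theta>_diff(2)[OF that(1,2)] \<theta>C[OF that(2)]]
    unfolding \<theta>_diff(1)[OF that(1,2)] by - (rule linear; assumption)+
  have split: "(p - p') - ((q - q') - (r - r')) \<in> \<N>" if "p - (q - r) \<in> \<N>" "p' = q' - r'"
    for p p' q q' r r' :: "'h utree \<Rightarrow>\<^sub>0 int"
    using that(1) unfolding that(2) by (simp add: algebra_simps)
  have tr_quad: "tr y z u v - quad_extend (straight w) y z u v \<in> \<N>"
    if "Poly_Mapping.keys y \<subseteq> S" "Poly_Mapping.keys z \<subseteq> S" "Poly_Mapping.keys u \<subseteq> S" "Poly_Mapping.keys v \<subseteq> S"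
    for y z u v
  proof (rule quad_additive_mem[OF N _ _ _ _ _ that,
        where Q = "\<lambda>y z u v. tr y z u v - quad_extend (straight w) y z u v"])
    show "tr (frag_of i) (frag_of j) (frag_of k) (frag_of l)
        - quad_extend (straight w) (frag_of i) (frag_of j) (frag_of k) (frag_of l) \<in> \<N>"
      if "{i, j, k, l} \<subseteq> S" for i j k l
      using straight_w[OF that] by (simp add: tr_def w_def e_def)
  qed (rule split; simp add: tr_diff quad_extend_diff)+
  have tree_\<nu>: "frag_of (H_tree a b c d) - \<nu> a b c d \<in> \<N>"
    if "a \<in> carrier H" "b \<in> carrier H" "c \<in> carrier H" "d \<in> carrier H" for a b c d
    using tr_quad[of "\<kappa> a" "\<kappa> b" "\<kappa> c" "\<kappa> d"] \<kappa> that by (simp add: tr_def \<nu>_def)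
  define ev where "ev = tensor_eval \<nu>"
  have ev_kernel: "frag_extend ev z = 0" if "z \<in> \<K>" for z
    unfolding ev_def by (rule tensor_eval_kernel[OF \<nu>_add \<nu>_laws that])
  have ev_eta: "frag_extend ev (eta_rep a b c d) = frag_cmul 4 (\<nu> a b c d)"
    if "a \<in> carrier H" "b \<in> carrier H" "c \<in> carrier H" "d \<in> carrier H" for a b c d
    unfolding ev_def by (rule tensor_eval_eta_rep[OF \<nu>_add \<nu>_laws that])
  have "\<exists>y. frag_of T - y \<in> \<N> \<and> frag_extend ev (eta_frag T) = frag_cmul 4 y" if T2: "T \<in> utrees H 2" for T
  proof -
    obtain a b c d where T: "a \<in> carrier H" "b \<in> carrier H" "c \<in> carrier H" "d \<in> carrier H"
      "frag_of T - frag_of (H_tree a b c d) \<in> \<N>" "eta_frag T = eta_rep a b c d"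
      using utrees_H_tree[OF T2] .
    have "frag_of T - \<nu> a b c d \<in> \<N>"
      using add_subgroup_trans[OF N T(5) tree_\<nu>[OF T(1-4)]] .
    then show ?thesis
      using T ev_eta by auto
  qed
  then obtain f where f: "frag_of T - f T \<in> \<N>" "frag_extend ev (eta_frag T) = frag_cmul 4 (f T)"
    if "T \<in> utrees H 2" for T
    by metis
  have cong: "x - frag_extend f x \<in> \<N>"
    using frag_extend_congruent[OF N, of x frag_of f] f(1) x frag_expansion[of x] by (metis subsetD)
  have "frag_cmul 4 (frag_extend f x) = frag_extend (\<lambda>T. frag_cmul 4 (f T)) x"
    by (simp add: frag_extend_cmul_fun)
  also have "\<dots> = frag_extend ev (frag_extend eta_frag x)"
    unfolding frag_extend_frag_extend by (rule frag_extend_eq) (use f(2) x in auto)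
  also have "\<dots> = 0"
    by (rule ev_kernel[OF eta])
  finally have "frag_extend f x = 0"
    by simp
  then show ?thesis
    using cong by simp
qed

section \<open>The maps of the theorem\<close>

lemma tensor_quotient: "tensor H cubic_part = free_Abelian_group pairs Mod \<K>"
  by (simp add: tensor_def)

lemma tensor_quotient_properties:
  "comm_group (tensor H cubic_part)"
  "mult (tensor H cubic_part) = mult (free_Abelian_group pairs Mod \<K>)"
  "one (tensor H cubic_part) = \<K>"
  "carrier (tensor H cubic_part) \<subseteq> carrier (free_Abelian_group pairs Mod \<K>)"
  using comm_group_frag_quotient[OF subgroup_tensor_kernel] by (simp_all add: tensor_quotient)

lemma carrier_tensor:
  "carrier (tensor H cubic_part) = {\<K> #>\<^bsub>free_Abelian_group pairs\<^esub> z | z. Poly_Mapping.keys z \<subseteq> pairs}"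
  by (simp add: tensor_quotient carrier_frag_quotient[OF subgroup_tensor_kernel])

lemma tree_group_quotient: "tree_group H 2 = free_Abelian_group (utrees H 2) Mod \<N>"
  by (simp add: tree_group_def tree_relators_def)

lemma univalent_homogeneous:
  assumes "T \<in> utrees H 2" "i \<in> univalent T"
  shows "lab T i \<in> carrier H" "rooted_at T i \<in> homogeneous_words H 3"
proof -
  obtain u v p q r s where S: "H_shape T u v p q r s" "lab T ` {p, q, r, s} \<subseteq> carrier H"
    using utrees_H_shape[OF assms(1)] .
  have "i = p \<or> i = q \<or> i = r \<or> i = s"
    using assms(2) by (simp add: H_shape_vertices[OF S(1)])
  then show "lab T i \<in> carrier H" "rooted_at T i \<in> homogeneous_words H 3"
    using S(2) H_shape_rooted_at[OF S(1)] by (elim disjE; simp)+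
qed

lemma eta_tree_coset:
  assumes T: "T \<in> utrees H 2"
  shows "eta_tree H 2 T = \<K> #>\<^bsub>free_Abelian_group pairs\<^esub> eta_frag T"
    and "eta_tree H 2 T \<in> carrier (tensor H cubic_part)"
proof -
  interpret Q: comm_group "tensor H cubic_part"
    by (rule tensor_quotient_properties)
  let ?c = "\<lambda>z. \<K> #>\<^bsub>free_Abelian_group pairs\<^esub> z"
  let ?g = "\<lambda>i. pure_rep (lab T i) (frag_of (rooted_at T i))"
  have keys: "Poly_Mapping.keys (?g i) \<subseteq> pairs" if "i \<in> univalent T" for i
    using univalent_homogeneous[OF T that] by (intro keys_pure_rep) auto
  then have carr: "?c (?g i) \<in> carrier (tensor H cubic_part)" if "i \<in> univalent T" for i
    using that unfolding carrier_tensor by blast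
  have pure: "pure_tensor H cubic_part (lab T i) (iterated_bracket H (rooted_at T i)) = ?c (?g i)"
    if "i \<in> univalent T" for i
    using univalent_homogeneous(2)[OF T that] iterated_bracket_eq_coset[OF H, of "rooted_at T i"]
    by (simp add: pure_tensor_def pure_rep_def homogeneous_words_def)
  have fin: "finite (univalent T)"
    using T by (auto simp: utrees_def is_tree_def univalent_def)
  have "eta_tree H 2 T = finprod (tensor H cubic_part) (\<lambda>i. ?c (?g i)) (univalent T)"
    unfolding eta_tree_def by (simp, rule Q.finprod_cong') (use pure carr in auto)
  also have "\<dots> = ?c (eta_frag T)"
    unfolding eta_frag_def
    by (rule finprod_frag_coset[OF subgroup_tensor_kernel tensor_quotient_properties fin carr keys])
  finally show "eta_tree H 2 T = ?c (eta_frag T)" .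
  then show "eta_tree H 2 T \<in> carrier (tensor H cubic_part)"
    using eta_frag_in_pairs[OF T] unfolding carrier_tensor by blast
qed

lemma eta_coset:
  assumes "Poly_Mapping.keys x \<subseteq> utrees H 2"
  shows "eta H 2 (\<N> #>\<^bsub>free_Abelian_group (utrees H 2)\<^esub> x)
    = \<K> #>\<^bsub>free_Abelian_group pairs\<^esub> frag_extend eta_frag x"
proof -
  have "eta H 2 = quot_lift (tensor H cubic_part) (eta_tree H 2)"
    by (simp add: eta_def)
  then show ?thesis
    using quot_lift_frag_coset[OF subgroup_tensor_kernel tensor_quotient_properties subgroup_tree_relations
        eta_tree_coset eta_frag_in_pairs frag_extend_eta_frag_relations assms]
    by simp
qed

lemma beta_coset:
  assumes "Poly_Mapping.keys z \<subseteq> pairs"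
  shows "beta H 2 (\<K> #>\<^bsub>free_Abelian_group pairs\<^esub> z) = \<I> #>\<^bsub>word_ring H\<^esub> frag_extend beta_frag z"
proof -
  let ?f = "\<lambda>(h, l). qlie_bracket H (qlie_gen H h) l"
  have beta: "beta H 2 = quot_lift (qlie_deg H 4) ?f"
    by (simp add: beta_def)
  have f: "?f k = \<I> #>\<^bsub>word_ring H\<^esub> beta_frag k" "Poly_Mapping.keys (beta_frag k) \<subseteq> homogeneous_words H 4"
    if k: "k \<in> pairs" for k
  proof -
    obtain h l where hl: "k = (h, l)" "h \<in> carrier H" "l \<in> carrier cubic_part"
      using k by auto
    note l = cubic_rep[OF hl(3)]
    have "?f k = qlie_bracket H (\<I> #>\<^bsub>word_ring H\<^esub> frag_of (Leaf h)) (\<I> #>\<^bsub>word_ring H\<^esub> cubic_rep l)"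
      using l(2) by (simp add: hl(1) qlie_gen_def)
    also have "\<dots> = \<I> #>\<^bsub>word_ring H\<^esub> beta_frag k"
      using qlie_bracket_coset[OF H, of "frag_of (Leaf h)" "cubic_rep l"] hl(2) l(1)
        homogeneous_words_subset[OF H, of 3] by (simp add: beta_frag_def hl(1))
    finally show "?f k = \<I> #>\<^bsub>word_ring H\<^esub> beta_frag k" .
    show "Poly_Mapping.keys (beta_frag k) \<subseteq> homogeneous_words H 4"
      using keys_word_bracket_homogeneous[of "frag_of (Leaf h)" H 1 "cubic_rep l" 3] l(1) hl(2)
      by (simp add: beta_frag_def hl(1) homogeneous_words_def)
  qed
  have fC: "?f k \<in> carrier (qlie_deg H 4)" and fS: "Poly_Mapping.keys (beta_frag k) \<subseteq> words H"
    if "k \<in> pairs" for k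
    using f[OF that] qlie_coset_in_carrier homogeneous_words_subset[OF H, of 4] by auto
  show ?thesis
    unfolding beta
    by (rule quot_lift_frag_coset[OF subgroup_qlie_ideal[OF H] qlie_deg_quotient[OF H] subgroup_tensor_kernel
          f(1) fC fS frag_extend_beta_frag_pure_repsor_kernel assms])
qed

lemma carrier_D_group:
  "carrier (D_group H 2) =
     {\<K> #>\<^bsub>free_Abelian_group pairs\<^esub> z | z. Poly_Mapping.keys z \<subseteq> pairs \<and> frag_extend beta_frag z \<in> \<I>}"
proof -
  have zero: "beta H 2 (\<K> #>\<^bsub>free_Abelian_group pairs\<^esub> z) = \<I> \<longleftrightarrow> frag_extend beta_frag z \<in> \<I>"
    if "Poly_Mapping.keys z \<subseteq> pairs" for z
    using qlie_coset_eq_iff[of "frag_extend beta_frag z" 0] frag_coset_zero[OF subgroup_qlie_ideal[OF H]]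
    by (simp add: beta_coset[OF that])
  have "carrier (D_group H 2) = {X \<in> carrier (tensor H cubic_part). beta H 2 X = \<I>}"
    by (simp add: D_group_def kernel_def one_qlie_deg[OF H])
  also have "\<dots> = {\<K> #>\<^bsub>free_Abelian_group pairs\<^esub> z | z.
      Poly_Mapping.keys z \<subseteq> pairs \<and> frag_extend beta_frag z \<in> \<I>}"
    unfolding carrier_tensor
  proof (intro equalityI subsetI)
    fix X
    assume "X \<in> {X \<in> {\<K> #>\<^bsub>free_Abelian_group pairs\<^esub> z | z. Poly_Mapping.keys z \<subseteq> pairs}. beta H 2 X = \<I>}"
    then obtain z where "X = \<K> #>\<^bsub>free_Abelian_group pairs\<^esub> z" "Poly_Mapping.keys z \<subseteq> pairs" "beta H 2 X = \<I>"
      by blast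
    then show "X \<in> {\<K> #>\<^bsub>free_Abelian_group pairs\<^esub> z | z. Poly_Mapping.keys z \<subseteq> pairs \<and> frag_extend beta_frag z \<in> \<I>}"
      using zero[of z] by blast
  next
    fix X
    assume "X \<in> {\<K> #>\<^bsub>free_Abelian_group pairs\<^esub> z | z. Poly_Mapping.keys z \<subseteq> pairs \<and> frag_extend beta_frag z \<in> \<I>}"
    then obtain z where "X = \<K> #>\<^bsub>free_Abelian_group pairs\<^esub> z" "Poly_Mapping.keys z \<subseteq> pairs"
      "frag_extend beta_frag z \<in> \<I>"
      by blast
    then show "X \<in> {X \<in> {\<K> #>\<^bsub>free_Abelian_group pairs\<^esub> z | z. Poly_Mapping.keys z \<subseteq> pairs}. beta H 2 X = \<I>}"
      using zero[of z] by blast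
  qed
  finally show ?thesis .
qed

lemma keys_frag_extend_eta_frag:
  assumes "Poly_Mapping.keys x \<subseteq> utrees H 2"
  shows "Poly_Mapping.keys (frag_extend eta_frag x) \<subseteq> pairs"
  using frag_extend_mem[OF add_subgroup_frags[of pairs], of x eta_frag] eta_frag_in_pairs assms by blast

lemma eta_iso:
  assumes \<theta>: "\<theta> \<in> iso (free_Abelian_group (S :: nat set)) H"
  shows "eta H 2 \<in> iso (tree_group H 2) (D_group H 2)"
proof -
  let ?t = "\<lambda>x. \<N> #>\<^bsub>free_Abelian_group (utrees H 2)\<^esub> x"
  let ?k = "\<lambda>z. \<K> #>\<^bsub>free_Abelian_group pairs\<^esub> z"
  note eq_N = frag_coset_eq_iff[OF subgroup_tree_relations]
  note eq_K = frag_coset_eq_iff[OF subgroup_tensor_kernel]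
  have carrier: "carrier (tree_group H 2) = {?t x | x. Poly_Mapping.keys x \<subseteq> utrees H 2}"
    by (simp add: tree_group_quotient carrier_frag_quotient[OF subgroup_tree_relations])
  have into: "eta H 2 X \<in> carrier (D_group H 2)" if "X \<in> carrier (tree_group H 2)" for X
    using that eta_coset keys_frag_extend_eta_frag frag_extend_beta_frag_eta_frag
    unfolding carrier carrier_D_group by blast
  have mult: "eta H 2 (X \<otimes>\<^bsub>tree_group H 2\<^esub> Y) = eta H 2 X \<otimes>\<^bsub>D_group H 2\<^esub> eta H 2 Y"
    if XY: "X \<in> carrier (tree_group H 2)" "Y \<in> carrier (tree_group H 2)" for X Y
  proof -
    obtain x y where x: "X = ?t x" "Poly_Mapping.keys x \<subseteq> utrees H 2"
      and y: "Y = ?t y" "Poly_Mapping.keys y \<subseteq> utrees H 2"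
      using XY unfolding carrier by blast
    have "X \<otimes>\<^bsub>tree_group H 2\<^esub> Y = ?t (x + y)"
      using frag_coset_mult[OF subgroup_tree_relations x(2) y(2)] by (simp add: tree_group_quotient x y)
    moreover have "?k (frag_extend eta_frag x) \<otimes>\<^bsub>D_group H 2\<^esub> ?k (frag_extend eta_frag y)
        = ?k (frag_extend eta_frag (x + y))"
      using frag_coset_mult[OF subgroup_tensor_kernel keys_frag_extend_eta_frag[OF x(2)]
          keys_frag_extend_eta_frag[OF y(2)]]
      by (simp add: D_group_def tensor_quotient frag_extend_add)
    ultimately show ?thesis
      by (simp add: x y eta_coset keys_add_subset)
  qed
  have inj: "inj_on (eta H 2) (carrier (tree_group H 2))"
  proof (rule inj_onI)
    fix X Y assume XY: "X \<in> carrier (tree_group H 2)" "Y \<in> carrier (tree_group H 2)"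
      and eq: "eta H 2 X = eta H 2 Y"
    obtain x y where x: "X = ?t x" "Poly_Mapping.keys x \<subseteq> utrees H 2"
      and y: "Y = ?t y" "Poly_Mapping.keys y \<subseteq> utrees H 2"
      using XY unfolding carrier by blast
    have "frag_extend eta_frag (x - y) \<in> \<K>"
      using eq eq_K by (simp add: x y eta_coset frag_extend_diff)
    then have "x - y \<in> \<N>"
      by (rule eta_frag_injective[OF \<theta> keys_diff_subset[OF x(2) y(2)]])
    then show "X = Y"
      using eq_N by (simp add: x y)
  qed
  have onto: "Z \<in> eta H 2 ` carrier (tree_group H 2)" if Z: "Z \<in> carrier (D_group H 2)" for Z
  proof -
    obtain z where z: "Z = ?k z" "Poly_Mapping.keys z \<subseteq> pairs" "frag_extend beta_frag z \<in> \<I>"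
      using Z unfolding carrier_D_group by blast
    obtain x where x: "Poly_Mapping.keys x \<subseteq> utrees H 2" "z - frag_extend eta_frag x \<in> \<K>"
      using exactness[OF z(2,3)] .
    have "Z = eta H 2 (?t x)"
      using x(2) eq_K by (simp add: z(1) eta_coset[OF x(1)])
    then show ?thesis
      using x(1) unfolding carrier by blast
  qed
  show ?thesis
    unfolding iso_def hom_def bij_betw_def using into mult inj onto by auto
qed

end

theorem theorem2p7:
  fixes H :: "('h, 'b) monoid_scheme"
  assumes "fg_free_abelian_group H"
  shows "eta H 2 \<in> iso (tree_group H 2) (D_group H 2)"
proof -
  obtain S :: "nat set" and \<theta> where "comm_group H" and \<theta>: "\<theta> \<in> iso (free_Abelian_group S) H"
    using assms by (auto simp: fg_free_abelian_group_def is_iso_def)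
  then interpret label_group H
    by (simp add: label_group_def)
  show ?thesis
    by (rule eta_iso[OF \<theta>])
qed

end
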